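(* Let $G$ be a decomposable graph with vertex set $V$, with cliques $C_1,\dots,C_k$ in a perfect order and corresponding minimal separators $S_2,\dots,S_k$, let $\mathcal D$ be the set of nonempty complete subsets of $G$, and let $(s,\alpha)$ be such that $I_{\mathcal D}(s,\alpha)<+\infty$. Then the distribution of $p^G$ induced from the prior $\pi_{\mathcal D}(\theta_{\mathcal D}\mid s,\alpha)$ by the change of variables $\theta_{\mathcal D}\mapsto p^G$ is identical to the hyper Dirichlet distribution with hyperparameters, for $D\in\mathcal D^{C_l}$ (respectively $D\in\mathcal D^{S_l}$) and $i_D\in\mathcal I_D^*$, $$\alpha^{C_l}(i_D,i^*_{D^c})=\sum_{C_l\supseteq F\supseteq D}\ \sum_{\substack{j_F\in\mathcal I_F^*\\ (j_F)_D=i_D}}(-1)^{|F\setminus D|}s(j_F),\qquad \alpha_\varnothing^{C_l}=\alpha+\sum_{\varnothing\ne D\subseteq C_l}(-1)^{|D|}\sum_{i_D\in\mathcal I_D^*}s(i_D),$$ $$\alpha^{S_l}(i_D,i^*_{D^c})=\sum_{S_l\supseteq F\supseteq D}\ \sum_{\substack{j_F\in\mathcal I_F^*\\ (j_F)_D=i_D}}(-1)^{|F\setminus D|}s(j_F),\qquad \alpha_\varnothing^{S_l}=\alpha+\sum_{\varnothing\neq D\subseteq S_l}(-1)^{|D|}\sum_{i_D\in\mathcal I_D^*}s(i_D).$$ Moreover, $$I_{\mathcal D}(s,\alpha)=\frac{\prod_{l=1}^k\Gamma(\alpha_\varnothing^{C_l})\prod_{D\in\mathcal D^{C_l}}\prod_{i_D\in\mathcal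 I_D^*}\Gamma(\alpha^{C_l}(i_D,i^*_{D^c}))}{\Gamma(\alpha)\prod_{l=2}^k\Gamma(\alpha_\varnothing^{S_l})\prod_{D\in\mathcal D^{S_l}}\prod_{i_D\in\mathcal I_D^*}\Gamma(\alpha^{S_l}(i_D,i^*_{D^c}))}.$$
   Context: Cells. $V$ is a finite nonempty set; for each $\gamma\in V$, $\mathcal I_\gamma$ is a finite set of levels with at least two elements, one of which is denoted $0$. $\mathcal I=\prod_{\gamma\in V}\mathcal I_\gamma$, $i^*=(0,\dots,0)$, $\mathcal I_E=\prod_{\gamma\in E}\mathcal I_\gamma$, and $\mathcal I_E^*=\{i_E\in\mathcal I_E:\ i_\gamma\neq 0\ \forall\gamma\in E\}$ (one element if $E=\varnothing$). For $F\subseteq E$ and $i_E\in\mathcal I_E$, $i_F=(i_E)_F$ is the subvector indexed by $F$. For $i_E\in\mathcal I^*_E$, $i(E)=(i_E,i^*_{E^c})\in\mathcal I$ is the cell equal to $i_E$ on $E$ and $0$ elsewhere. Model and prior. $\mathcal D$ is the set of nonempty complete subsets of $V$ in $G$, $d_{\mathcal D}=\sum_{D\in\mathcal D}|\mathcal I_D^*|$. For $\theta_{\mathcal D}=(\theta(i_D),D\in\mathcal D,i_D\in\mathcal I_D^* )\in\mathbb R^{d_{\mathcal D}}$ let $$Z(\theta_{\mathcal D})=1+\sum_{E\subseteq V,\,E\ne\varnothing}\sum_{i_E\in\mathcal I_E^*}\exp\sum_{F\in\mathcal D,F\subseteq E}\theta(i_F),\qquad p(i(E))=Z(\theta_{\mathcal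 D})^{-1}\exp\sum_{F\in\mathcal D,F\subseteq E}\theta(i_F)\quad (E\subseteq V,\ i_E\in\mathcal I_E^* ).$$ The prior with hyperparameters $s=(s(i_D),D\in\mathcal D,i_D\in\mathcal I_D^* )\in\mathbb R^{d_{\mathcal D}}$, $\alpha\in\mathbb R$ has Lebesgue density $$\pi_{\mathcal D}(\theta_{\mathcal D}\mid s,\alpha)=I_{\mathcal D}(s,\alpha)^{-1}\exp\Big\{\sum_{D\in\mathcal D}\sum_{i_D\in\mathcal I_D^*}\theta(i_D)s(i_D)-\alpha\log Z(\theta_{\mathcal D})\Big\},$$ where $I_{\mathcal D}(s,\alpha)\in(0,+\infty]$ is the integral of the exponential factor. Perfect order: cliques (maximal complete subsets) are ordered so that $S_l=C_l\cap\bigcup_{j<l}C_j$ is contained in some $C_i$, $i<l$, for each $l=2,\dots,k$. Marginal probabilities and $p^G$. For $A=C_l$ or $A=S_l$, $\mathcal D^A$ is the set of nonempty subsets of $A$ (all complete). For $D\subseteq A$ and $i_D\in\mathcal I_D^*$, $p^A(i_D,i^*_{D^c})$ is the $A$-marginal probability of the marginal cell equal to $i_D$ on $D$ and $0$ on $A\setminus D$, i.e. the sum of $p(j)$ over $j\in\mathcal I$ with $j_A$ equal to that marginal cell; $p^A_\varnothing$ is the $A$-marginal probability of the all-zero $A$-cell. The vector $p^G$ of free marginal probabilities is $$p^G=\Big(p^{C_l}(i_D,i^*_{D^c}),\,D\in\mathcal D^{C_l}\setminus\textstyle\bigcup_{j=2}^k\mathcal D^{S_j},\,l=1,\dots,k;\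 \ p^{S_l}(i_D,i^*_{D^c}),\,D\in\mathcal D^{S_l},\,l=2,\dots,k;\ \ i_D\in\mathcal I_D^*\Big),$$ where each $D$ is listed once: for each $D$ contained in some separator, one fixed separator $S_{l}\supseteq D$ is chosen (arbitrarily). Hyper Dirichlet. The hyper Dirichlet distribution with positive hyperparameters $\alpha_\varnothing^{A},\alpha^{A}(i_D,i^*_{D^c})$, $D\in\mathcal D^A$, $i_D\in\mathcal I_D^*$, $A\in\{C_1,\dots,C_k,S_2,\dots,S_k\}$, is the distribution whose density with respect to Lebesgue measure in the coordinates $p^G$ (on the range of $p^G$) is $$\frac{\prod_{l=1}^k\mathrm{Dir}_{C_l}}{\prod_{l=2}^k\mathrm{Dir}_{S_l}},\qquad \mathrm{Dir}_{A}=\frac{\Gamma\big(\alpha_\varnothing^{A}+\sum_{D\in\mathcal D^{A}}\sum_{i_D\in\mathcal I_D^*}\alpha^{A}(i_D,i^*_{D^c})\big)}{\Gamma(\alpha_\varnothing^{A})\prod_{D\in\mathcal D^{A},\,i_D\in\mathcal I_D^*}\Gamma(\alpha^{A}(i_D,i^*_{D^c}))}(p_\varnothing^{A})^{\alpha_\varnothing^{A}-1}\prod_{D\in\mathcal D^{A},\,i_D\in\mathcal I_D^*}\big(p^{A}(i_D,i^*_{D^c})\big)^{\alpha^{A}(i_D,i^*_{D^c})-1},$$ the hyperparameters being hyperconsistent: whenever $S_l=C_i\cap C_j$, the marginal distribution on $S_l$ obtained from the Dirichlet distribution on $C_i$ and that obtained from the one on $C_j$ coincide. *)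

theory Defs
  imports "HOL-Probability.Probability"
begin

section \<open>Decomposable graphs and perfect orders of cliques\<close>

definition simple_graph :: "'v set \<Rightarrow> 'v set set \<Rightarrow> bool" where
  "simple_graph V E \<longleftrightarrow> E \<subseteq> {{x, y} |x y. x \<in> V \<and> y \<in> V \<and> x \<noteq> y}"

definition complete_in :: "'v set set \<Rightarrow> 'v set \<Rightarrow> bool" where
  "complete_in E A \<longleftrightarrow> (\<forall>x\<in>A. \<forall>y\<in>A. x \<noteq> y \<longrightarrow> {x, y} \<in> E)"

definition induced_edges :: "'v set set \<Rightarrow> 'v set \<Rightarrow> 'v set set" where
  "induced_edges E A = {e \<in> E. e \<subseteq> A}"

text \<open>
  A graph is decomposable if it is complete or has a proper decomposition \<open>(A, B, S)\<close> into
  decomposable induced subgraphs.  Since \<open>A\<close>, \<open>B\<close>, \<open>S\<close> partition the vertex set, \<open>S\<close> separates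
  \<open>A\<close> from \<open>B\<close> precisely if no edge joins \<open>A\<close> to \<open>B\<close>.  The set \<open>S\<close> may be empty, so the graph
  need not be connected.
\<close>
inductive decomposable :: "'v set \<Rightarrow> 'v set set \<Rightarrow> bool" where
  complete: "complete_in E V \<Longrightarrow> decomposable V E"
| decomposition:
    "\<lbrakk>A \<noteq> {}; B \<noteq> {}; A \<inter> B = {}; A \<inter> S = {}; B \<inter> S = {};
      complete_in E S; \<forall>a\<in>A. \<forall>b\<in>B. {a, b} \<notin> E;
      decomposable (A \<union> S) (induced_edges E (A \<union> S));
      decomposable (B \<union> S) (induced_edges E (B \<union> S))\<rbrakk>
     \<Longrightarrow> decomposable (A \<union> B \<union> S) E"

definition complete_sets :: "'v set \<Rightarrow> 'v set set \<Rightarrow> 'v set set" where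
  "complete_sets V E = {D. D \<subseteq> V \<and> D \<noteq> {} \<and> complete_in E D}"

definition cliques :: "'v set \<Rightarrow> 'v set set \<Rightarrow> 'v set set" where
  "cliques V E = {A. A \<subseteq> V \<and> complete_in E A \<and>
     (\<forall>B. A \<subseteq> B \<and> B \<subseteq> V \<and> complete_in E B \<longrightarrow> B = A)}"

text \<open>Cliques are numbered \<open>C 1, \<dots>, C k\<close> and separators \<open>separator C 2, \<dots>, separator C k\<close>.\<close>

definition separator :: "(nat \<Rightarrow> 'v set) \<Rightarrow> nat \<Rightarrow> 'v set" where
  "separator C l = C l \<inter> (\<Union>j\<in>{1..<l}. C j)"

definition perfect_order :: "'v set \<Rightarrow> 'v set set \<Rightarrow> (nat \<Rightarrow> 'v set) \<Rightarrow> nat \<Rightarrow> bool" where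
  "perfect_order V E C k \<longleftrightarrow> bij_betw C {1..k} (cliques V E) \<and>
     (\<forall>l\<in>{2..k}. \<exists>i\<in>{1..<l}. separator C l \<subseteq> C i)"

section \<open>Cells\<close>

text \<open>
  \<open>L \<gamma>\<close> is the set of levels of \<open>\<gamma>\<close>.  Cells are extensional functions, so that the subvector of
  a cell \<open>i\<close> indexed by \<open>F\<close> is \<open>restrict i F\<close>.
\<close>

definition cells :: "('v \<Rightarrow> 'l set) \<Rightarrow> 'v set \<Rightarrow> ('v \<Rightarrow> 'l) set" where
  "cells L A = PiE A L"

definition cells_star :: "('v \<Rightarrow> 'l::zero set) \<Rightarrow> 'v set \<Rightarrow> ('v \<Rightarrow> 'l) set" where
  "cells_star L A = PiE A (\<lambda>\<gamma>. L \<gamma> - {0})"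

definition zero_fill :: "'v set \<Rightarrow> 'v set \<Rightarrow> ('v \<Rightarrow> 'l::zero) \<Rightarrow> 'v \<Rightarrow> 'l" where
  "zero_fill A D i = (\<lambda>\<gamma>\<in>A. if \<gamma> \<in> D then i \<gamma> else 0)"

definition zero_cell :: "'v set \<Rightarrow> 'v \<Rightarrow> 'l::zero" where
  "zero_cell A = (\<lambda>\<gamma>\<in>A. 0)"

text \<open>A coordinate indexed by \<open>i\<^sub>D\<close> is addressed by the pair \<open>(D, i\<^sub>D)\<close>.\<close>

type_synonym ('v, 'l) coord = "'v set \<times> ('v \<Rightarrow> 'l)"

definition coords :: "'v set \<Rightarrow> 'v set set \<Rightarrow> ('v \<Rightarrow> 'l::zero set) \<Rightarrow> ('v, 'l) coord set" where
  "coords V E L = (SIGMA D:complete_sets V E. cells_star L D)"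

definition sub_coords :: "('v \<Rightarrow> 'l::zero set) \<Rightarrow> 'v set \<Rightarrow> ('v, 'l) coord set" where
  "sub_coords L A = (SIGMA D:{D. D \<subseteq> A \<and> D \<noteq> {}}. cells_star L D)"

abbreviation lebesgue_on_coords :: "('v, 'l) coord set \<Rightarrow> (('v, 'l) coord \<Rightarrow> real) measure" where
  "lebesgue_on_coords J \<equiv> PiM J (\<lambda>_. lborel)"

section \<open>The log-linear model and its conjugate prior\<close>

definition partition_fun ::
  "'v set \<Rightarrow> 'v set set \<Rightarrow> ('v \<Rightarrow> 'l::zero set) \<Rightarrow> (('v, 'l) coord \<Rightarrow> real) \<Rightarrow> real" where
  "partition_fun V E L \<theta> = 1 + (\<Sum>A | A \<subseteq> V \<and> A \<noteq> {}. \<Sum>i\<in>cells_star L A.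
     exp (\<Sum>F | F \<in> complete_sets V E \<and> F \<subseteq> A. \<theta> (F, restrict i F)))"

text \<open>
  Every cell \<open>j\<close> is of the form \<open>zero_fill V A i\<close> with \<open>i\<close> in \<open>cells_star L A\<close> for exactly one
  \<open>A \<subseteq> V\<close>, namely for its support, and then \<open>i = restrict j A\<close>.
\<close>
definition cell_prob ::
  "'v set \<Rightarrow> 'v set set \<Rightarrow> ('v \<Rightarrow> 'l::zero set) \<Rightarrow> (('v, 'l) coord \<Rightarrow> real) \<Rightarrow> ('v \<Rightarrow> 'l) \<Rightarrow> real" where
  "cell_prob V E L \<theta> j =
     exp (\<Sum>F | F \<in> complete_sets V E \<and> F \<subseteq> {\<gamma> \<in> V. j \<gamma> \<noteq> 0}. \<theta> (F, restrict j F))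
       / partition_fun V E L \<theta>"

definition marginal_prob ::
  "'v set \<Rightarrow> 'v set set \<Rightarrow> ('v \<Rightarrow> 'l::zero set) \<Rightarrow> (('v, 'l) coord \<Rightarrow> real)
     \<Rightarrow> 'v set \<Rightarrow> ('v \<Rightarrow> 'l) \<Rightarrow> real" where
  "marginal_prob V E L \<theta> A a = (\<Sum>j | j \<in> cells L V \<and> restrict j A = a. cell_prob V E L \<theta> j)"

definition prior_kernel ::
  "'v set \<Rightarrow> 'v set set \<Rightarrow> ('v \<Rightarrow> 'l::zero set) \<Rightarrow> (('v, 'l) coord \<Rightarrow> real) \<Rightarrow> real
     \<Rightarrow> (('v, 'l) coord \<Rightarrow> real) \<Rightarrow> real" where
  "prior_kernel V E L s \<alpha> \<theta> =
     exp ((\<Sum>D\<in>complete_sets V E. \<Sum>i\<in>cells_star L D. \<theta> (D, i) * s (D, i))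
          - \<alpha> * ln (partition_fun V E L \<theta>))"

definition prior_integral ::
  "'v set \<Rightarrow> 'v set set \<Rightarrow> ('v \<Rightarrow> 'l::zero set) \<Rightarrow> (('v, 'l) coord \<Rightarrow> real) \<Rightarrow> real \<Rightarrow> ennreal" where
  "prior_integral V E L s \<alpha> =
     (\<integral>\<^sup>+\<theta>. ennreal (prior_kernel V E L s \<alpha> \<theta>) \<partial>lebesgue_on_coords (coords V E L))"

definition prior ::
  "'v set \<Rightarrow> 'v set set \<Rightarrow> ('v \<Rightarrow> 'l::zero set) \<Rightarrow> (('v, 'l) coord \<Rightarrow> real) \<Rightarrow> real
     \<Rightarrow> (('v, 'l) coord \<Rightarrow> real) measure" where
  "prior V E L s \<alpha> = density (lebesgue_on_coords (coords V E L))
     (\<lambda>\<theta>. ennreal (prior_kernel V E L s \<alpha> \<theta>) / prior_integral V E L s \<alpha>)"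

section \<open>The free marginal probabilities\<close>

text \<open>
  \<open>host D\<close> is the set \<open>A\<close> whose marginal supplies the coordinates \<open>p\<^sup>A(i\<^sub>D, 0)\<close>: an arbitrarily
  chosen separator containing \<open>D\<close> if there is one, and otherwise the clique containing \<open>D\<close>
  (which is then unique).
\<close>
definition free_marginal_choice ::
  "'v set \<Rightarrow> 'v set set \<Rightarrow> (nat \<Rightarrow> 'v set) \<Rightarrow> nat \<Rightarrow> ('v set \<Rightarrow> 'v set) \<Rightarrow> bool" where
  "free_marginal_choice V E C k host \<longleftrightarrow> (\<forall>D\<in>complete_sets V E. D \<subseteq> host D \<and>
     (if \<exists>l\<in>{2..k}. D \<subseteq> separator C l then host D \<in> separator C ` {2..k}
      else host D \<in> C ` {1..k}))"

definition free_marginals ::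
  "'v set \<Rightarrow> 'v set set \<Rightarrow> ('v \<Rightarrow> 'l::zero set) \<Rightarrow> ('v set \<Rightarrow> 'v set)
     \<Rightarrow> (('v, 'l) coord \<Rightarrow> real) \<Rightarrow> ('v, 'l) coord \<Rightarrow> real" where
  "free_marginals V E L host \<theta> = (\<lambda>(D, i)\<in>coords V E L.
     marginal_prob V E L \<theta> (host D) (zero_fill (host D) D i))"

section \<open>Dirichlet and hyper Dirichlet distributions\<close>

definition dirichlet_fun ::
  "('v \<Rightarrow> 'l::zero set) \<Rightarrow> 'v set \<Rightarrow> real \<Rightarrow> (('v, 'l) coord \<Rightarrow> real)
     \<Rightarrow> real \<Rightarrow> (('v, 'l) coord \<Rightarrow> real) \<Rightarrow> real" where
  "dirichlet_fun L A a0 a p0 p =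
     Gamma (a0 + (\<Sum>x\<in>sub_coords L A. a x)) / (Gamma a0 * (\<Prod>x\<in>sub_coords L A. Gamma (a x)))
       * p0 powr (a0 - 1) * (\<Prod>x\<in>sub_coords L A. p x powr (a x - 1))"

definition dirichlet ::
  "('v \<Rightarrow> 'l::zero set) \<Rightarrow> 'v set \<Rightarrow> real \<Rightarrow> (('v, 'l) coord \<Rightarrow> real)
     \<Rightarrow> (('v, 'l) coord \<Rightarrow> real) measure" where
  "dirichlet L A a0 a = density (lebesgue_on_coords (sub_coords L A))
     (\<lambda>p. if (\<forall>x\<in>sub_coords L A. 0 < p x) \<and> (\<Sum>x\<in>sub_coords L A. p x) < 1
          then ennreal (dirichlet_fun L A a0 a (1 - (\<Sum>x\<in>sub_coords L A. p x)) p) else 0)"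

text \<open>
  The free coordinates of the marginal on \<open>S \<subseteq> A\<close> of a probability table on the \<open>A\<close>-cells.  The
  all-zero \<open>A\<close>-cell, which is not a free coordinate, never restricts to the \<open>S\<close>-cell
  \<open>zero_fill S D i\<close>, because \<open>D\<close> is nonempty.
\<close>
definition table_marginal ::
  "('v \<Rightarrow> 'l::zero set) \<Rightarrow> 'v set \<Rightarrow> 'v set \<Rightarrow> (('v, 'l) coord \<Rightarrow> real)
     \<Rightarrow> ('v, 'l) coord \<Rightarrow> real" where
  "table_marginal L A S p = (\<lambda>(D, i)\<in>sub_coords L S.
     \<Sum>(F, j) | (F, j) \<in> sub_coords L A \<and> restrict (zero_fill A F j) S = zero_fill S D i. p (F, j))"

text \<open>
  Hyperparameters are families indexed by \<open>A\<close>: \<open>a0 A\<close> belongs to the all-zero \<open>A\<close>-cell and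
  \<open>a A (D, i)\<close> to the \<open>A\<close>-cell \<open>zero_fill A D i\<close>.
\<close>

definition hyperconsistent ::
  "('v \<Rightarrow> 'l::zero set) \<Rightarrow> (nat \<Rightarrow> 'v set) \<Rightarrow> nat \<Rightarrow> ('v set \<Rightarrow> real)
     \<Rightarrow> ('v set \<Rightarrow> ('v, 'l) coord \<Rightarrow> real) \<Rightarrow> bool" where
  "hyperconsistent L C k a0 a \<longleftrightarrow>
     (\<forall>l\<in>{2..k}. \<forall>i\<in>{1..k}. \<forall>j\<in>{1..k}. i \<noteq> j \<and> separator C l = C i \<inter> C j \<longrightarrow>
        distr (dirichlet L (C i) (a0 (C i)) (a (C i)))
          (lebesgue_on_coords (sub_coords L (separator C l))) (table_marginal L (C i) (separator C l))
      = distr (dirichlet L (C j) (a0 (C j)) (a (C j)))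
          (lebesgue_on_coords (sub_coords L (separator C l))) (table_marginal L (C j) (separator C l)))"

text \<open>
  On the range of \<open>p\<^sup>G\<close> all the marginal probabilities \<open>p\<^sup>A\<close> are functions of \<open>p\<^sup>G\<close>; here they
  are evaluated at the parameter with the given value of \<open>p\<^sup>G\<close>.
\<close>
definition hyper_dirichlet_density ::
  "'v set \<Rightarrow> 'v set set \<Rightarrow> ('v \<Rightarrow> 'l::zero set) \<Rightarrow> (nat \<Rightarrow> 'v set) \<Rightarrow> nat \<Rightarrow> ('v set \<Rightarrow> 'v set)
     \<Rightarrow> ('v set \<Rightarrow> real) \<Rightarrow> ('v set \<Rightarrow> ('v, 'l) coord \<Rightarrow> real)
     \<Rightarrow> (('v, 'l) coord \<Rightarrow> real) \<Rightarrow> ennreal" where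
  "hyper_dirichlet_density V E L C k host a0 a q =
     (let \<Theta> = space (lebesgue_on_coords (coords V E L));
          \<theta> = inv_into \<Theta> (free_marginals V E L host) q;
          Dir = (\<lambda>A. dirichlet_fun L A (a0 A) (a A)
                   (marginal_prob V E L \<theta> A (zero_cell A))
                   (\<lambda>(D, i). marginal_prob V E L \<theta> A (zero_fill A D i)))
      in if q \<in> free_marginals V E L host ` \<Theta>
         then ennreal ((\<Prod>l\<in>{1..k}. Dir (C l)) / (\<Prod>l\<in>{2..k}. Dir (separator C l)))
         else 0)"

definition hyper_dirichlet_distributed ::
  "'v set \<Rightarrow> 'v set set \<Rightarrow> ('v \<Rightarrow> 'l::zero set) \<Rightarrow> (nat \<Rightarrow> 'v set) \<Rightarrow> nat \<Rightarrow> ('v set \<Rightarrow> 'v set)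
     \<Rightarrow> ('v set \<Rightarrow> real) \<Rightarrow> ('v set \<Rightarrow> ('v, 'l) coord \<Rightarrow> real)
     \<Rightarrow> 'b measure \<Rightarrow> ('b \<Rightarrow> ('v, 'l) coord \<Rightarrow> real) \<Rightarrow> bool" where
  "hyper_dirichlet_distributed V E L C k host a0 a M X \<longleftrightarrow>
     (\<forall>A \<in> C ` {1..k} \<union> separator C ` {2..k}. 0 < a0 A \<and> (\<forall>x\<in>sub_coords L A. 0 < a A x)) \<and>
     hyperconsistent L C k a0 a \<and>
     distributed M (lebesgue_on_coords (coords V E L)) X
       (hyper_dirichlet_density V E L C k host a0 a)"

section \<open>The hyperparameters of the induced distribution\<close>

definition induced_hyper ::
  "('v \<Rightarrow> 'l::zero set) \<Rightarrow> (('v, 'l) coord \<Rightarrow> real) \<Rightarrow> 'v set \<Rightarrow> ('v, 'l) coord \<Rightarrow> real" where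
  "induced_hyper L s A = (\<lambda>(D, i).
     \<Sum>F | D \<subseteq> F \<and> F \<subseteq> A. \<Sum>j | j \<in> cells_star L F \<and> restrict j D = i.
       (- 1) ^ card (F - D) * s (F, j))"

definition induced_hyper_zero ::
  "('v \<Rightarrow> 'l::zero set) \<Rightarrow> (('v, 'l) coord \<Rightarrow> real) \<Rightarrow> real \<Rightarrow> 'v set \<Rightarrow> real" where
  "induced_hyper_zero L s \<alpha> A =
     \<alpha> + (\<Sum>D | D \<noteq> {} \<and> D \<subseteq> A. (- 1) ^ card D * (\<Sum>i\<in>cells_star L D. s (D, i)))"

end

theory Submission
  imports Defs
begin

text \<open>
  The cliques are added one at a time.  Let \<open>C\<close> be the next clique, \<open>H\<close> the union of the
  earlier ones and \<open>S = C \<inter> H\<close>.  The new coordinates of \<open>\<theta>\<close> belong to the faces of \<open>C\<close> that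
  are not contained in \<open>H\<close>.  Summed over the faces of a cell they give its log-odds against the
  \<open>C\<close>-cell with the same restriction to \<open>S\<close> that vanishes on \<open>C - H\<close>.  So the \<open>C\<close>-marginal
  arises from the \<open>S\<close>-marginal by distributing the mass of each \<open>S\<close>-cell over the \<open>C\<close>-cells above
  it, its block, in proportion to the odds (\<open>marginal_clique\<close>).  Summing out \<open>C - H\<close> multiplies the
  weight of an \<open>H\<close>-cell by the total odds of its block.  The logarithm of this factor is a function
  of the restriction to \<open>S\<close>, and all faces of \<open>S\<close> already belong to the model because \<open>S\<close> lies in
  an earlier clique; so the factor can be absorbed into the old coordinates, and the \<open>H\<close>-marginal is
  the smaller model at a modified parameter (\<open>marginal_old\<close>).

  The passage from \<open>\<theta>\<close> to the modified old coordinates and the log-odds adds to each coordinate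
  a function of coordinates of lower rank.  Such a triangular shear preserves Lebesgue measure
  (\<open>triangular_shear\<close>), so no determinant has to be computed.

  The hyperparameters of a table on \<open>A\<close> are the Moebius inverse of \<open>s\<close>, with \<open>\<alpha>\<close> as the value at
  the empty face: their sum over the \<open>A\<close>-cells with given nonzero levels \<open>j\<close> on \<open>F\<close> is \<open>s (F, j)\<close>
  (\<open>sum_table_hyper\<close>).  By this duality the linear form \<open>\<Sum>\<theta> s\<close> becomes a combination of logarithms
  of cell probabilities with the hyperparameters as coefficients.  The prior kernel therefore is the
  kernel of the smaller model times a function of the log-odds (\<open>model_kernel_glue\<close>), and in the end
  it is the product of all \<open>P\<^sub>C\<close> to the powers \<open>\<alpha>\<^sup>C\<close>, divided by the same expression for the
  separators (\<open>tower_kernel\<close>).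

  The function of the log-odds integrates to a product of Dirichlet integrals, one for each
  \<open>S\<close>-cell, which is evaluated by integrating one log-odds at a time: Beta integrals, whose product
  telescopes to a quotient of Gamma functions.  A Beta integral is never zero, and it is infinite
  unless both of its parameters are positive.  Hence a finite prior integral forces all the
  hyperparameters to be positive; as \<open>C\<close> is a maximal complete set, it has a vertex outside \<open>H\<close>, so
  that each \<open>S\<close>-cell occurs (\<open>tower_integral\<close>).

  The map from log-odds to proportions is treated in the same way, by one logistic substitution per
  coordinate (\<open>nn_integral_block_softmax\<close>).  With the free coordinates taken from the first clique
  that contains a face, the change of variables has the density \<open>\<Prod>P\<^sub>C / \<Prod>P\<^sub>S\<close> (\<open>tower_chart\<close>).  Any
  other admissible choice of the marginals that supply the coordinates gives the same density: each
  choice is obtained by inclusion-exclusion from the probabilities that a cell has the levels \<open>j\<close> on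
  \<open>F\<close>, and this is again a triangular shear (\<open>lebesgue_chart_change_hosts\<close>).  Dividing the kernel by
  this density lowers each exponent by one, which gives the hyper Dirichlet density.  Each Dirichlet
  factor contains \<open>\<Gamma>(\<alpha>)\<close>, because all the tables have total \<open>\<alpha>\<close>; as there is one clique more than
  there are separators, a single \<open>\<Gamma>(\<alpha>)\<close> remains, in the denominator of the prior integral.

  Finally, a Dirichlet distribution on the \<open>A\<close>-cells is the law of the cell probabilities in the
  model with the single clique \<open>A\<close> (\<open>dirichlet_eq_saturated_prior\<close>).  Gluing \<open>A\<close> to one of its
  subsets \<open>S\<close> shows that its \<open>S\<close>-marginal is the Dirichlet distribution with the hyperparameters of
  \<open>S\<close> (\<open>dirichlet_marginal\<close>).  These do not refer to \<open>A\<close>, whence hyperconsistency.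
\<close>

section \<open>Triangular shears of Lebesgue measure\<close>

abbreviation Leb :: "'i set \<Rightarrow> ('i \<Rightarrow> real) measure" where
  "Leb J \<equiv> PiM J (\<lambda>_. lborel)"

lemma space_Leb: "space (Leb J) = extensional J"
  by (simp add: space_PiM PiE_UNIV_domain PiE_def)

interpretation Leb: product_sigma_finite "\<lambda>_. lborel :: real measure"
  by (simp add: lborel.sigma_finite_measure_axioms product_sigma_finite.intro)

lemma sigma_finite_Leb: "finite J \<Longrightarrow> sigma_finite_measure (Leb J)"
  by (rule Leb.sigma_finite)

lemma borel_measurable_component_Leb [measurable (raw)]:
  assumes "f \<in> measurable N (Leb J)" "j \<in> J"
  shows "(\<lambda>w. f w j) \<in> borel_measurable N"
proof -
  have "(\<lambda>x. x j) \<in> measurable (Leb J) lborel"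
    by (rule measurable_component_singleton) (use assms in auto)
  from measurable_compose[OF assms(1) this] show ?thesis by simp
qed

lemma measurable_Leb_component: "j \<in> J \<Longrightarrow> (\<lambda>x. x j) \<in> borel_measurable (Leb J)"
  by (rule borel_measurable_component_Leb[OF measurable_ident_sets]) auto

lemma measurable_Leb_restrict:
  assumes "\<And>j. j \<in> J \<Longrightarrow> (\<lambda>w. f w j) \<in> borel_measurable N"
  shows "(\<lambda>w. \<lambda>j\<in>J. f w j) \<in> measurable N (Leb J)"
  by (rule measurable_restrict) (use assms in simp)

lemma measurable_Leb_subset: "I \<subseteq> J \<Longrightarrow> (\<lambda>x. restrict x I) \<in> measurable (Leb J) (Leb I)"
  by (rule measurable_restrict_subset)

lemma measurable_Leb_upd:
  assumes "f \<in> measurable N (Leb J)" "g \<in> borel_measurable N"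
  shows "(\<lambda>w. (f w)(j := g w)) \<in> measurable N (Leb (insert j J))"
  by (rule measurable_fun_upd[of _ J]) (use assms in auto)

definition shear :: "'i set \<Rightarrow> ('i \<Rightarrow> ('i \<Rightarrow> real) \<Rightarrow> real) \<Rightarrow> ('i \<Rightarrow> real) \<Rightarrow> 'i \<Rightarrow> real" where
  "shear J g x = (\<lambda>j\<in>J. x j + g j x)"

lemma measurable_shear:
  assumes "\<And>j. j \<in> J \<Longrightarrow> g j \<in> borel_measurable (Leb J)"
  shows "shear J g \<in> measurable (Leb J) (Leb J)"
  unfolding shear_def
  by (rule measurable_Leb_restrict) (use assms in \<open>auto intro!: borel_measurable_add borel_measurable_component_Leb\<close>)

text \<open>
  Induction along the rank.  The last coordinate is translated by a function of the others; so it is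
  integrated first, where the translation disappears, and it is solved for last.  The inverse is
  stated with the integral formula because a change of variables also needs a measurable left
  inverse.
\<close>
lemma triangular_shear:
  fixes r :: "'i \<Rightarrow> nat"
  assumes "finite J"
    and "\<And>j. j \<in> J \<Longrightarrow> g j \<in> borel_measurable (Leb J)"
    and "\<And>j x y. j \<in> J \<Longrightarrow> (\<And>i. i \<in> J \<Longrightarrow> r i < r j \<Longrightarrow> x i = y i) \<Longrightarrow> g j x = g j y"
  shows "\<exists>T. T \<in> measurable (Leb J) (Leb J)
           \<and> (\<forall>x\<in>space (Leb J). T (shear J g x) = x \<and> shear J g (T x) = x)
           \<and> (\<forall>f\<in>borel_measurable (Leb J). (\<integral>\<^sup>+x. f (shear J g x) \<partial>Leb J) = (\<integral>\<^sup>+x. f x \<partial>Leb J))"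
  using assms
proof (induction J rule: finite_ranking_induct[where f = r])
  case empty
  show ?case
  proof -
    have "shear {} g x = x" if "x \<in> space (Leb {})" for x
      using that by (simp add: shear_def space_Leb extensional_def fun_eq_iff)
    then show ?thesis by (intro exI[of _ "\<lambda>x. x"]) (metis (no_types, lifting) measurable_ident nn_integral_cong id_def eq_id_iff)
  qed
next
  case (insert j J)
  show ?case
  proof (cases "j \<in> J")
    case True
    then have eq: "insert j J = J" by blast
    show ?thesis unfolding eq
      by (rule insert.IH[OF insert.prems[unfolded eq]])
  next
    case False
    note J = \<open>finite J\<close> \<open>j \<notin> J\<close>
    have upd: "g i (x(j := y)) = g i x" if "i \<in> insert j J" for i x y
    proof (rule insert.prems(2)[OF that])
      fix i' assume "i' \<in> insert j J" "r i' < r i"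
      then have "i' \<noteq> j" using insert.hyps(2)[of i] that by auto
      then show "(x(j := y)) i' = x i'" by simp
    qed
    have gm: "g i \<in> borel_measurable (Leb J)" if "i \<in> insert j J" for i
    proof -
      have "(\<lambda>x. g i (x(j := 0))) \<in> borel_measurable (Leb J)"
        by (rule measurable_compose[OF measurable_Leb_upd insert.prems(1)[OF that]]) auto
      then show ?thesis by (simp add: upd[OF that])
    qed
    have "\<exists>T. T \<in> measurable (Leb J) (Leb J)
           \<and> (\<forall>x\<in>space (Leb J). T (shear J g x) = x \<and> shear J g (T x) = x)
           \<and> (\<forall>f\<in>borel_measurable (Leb J). (\<integral>\<^sup>+x. f (shear J g x) \<partial>Leb J) = (\<integral>\<^sup>+x. f x \<partial>Leb J))"
    proof (rule insert.IH)
      fix i and x y :: "'i \<Rightarrow> real" assume "i \<in> J" "\<And>i'. i' \<in> J \<Longrightarrow> r i' < r i \<Longrightarrow> x i' = y i'"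
      then show "g i x = g i y"
        using insert.prems(2)[of i x y] insert.hyps(2)[of i]
        by (metis insertE insertI2 not_le)
    qed (use gm in auto)
    then obtain T where T: "T \<in> measurable (Leb J) (Leb J)"
      and inv: "\<And>x. x \<in> space (Leb J) \<Longrightarrow> T (shear J g x) = x \<and> shear J g (T x) = x"
      and int: "\<And>f. f \<in> borel_measurable (Leb J)
        \<Longrightarrow> (\<integral>\<^sup>+x. f (shear J g x) \<partial>Leb J) = (\<integral>\<^sup>+x. f x \<partial>Leb J)" by blast
    have sh: "shear (insert j J) g (x(j := y)) = (shear J g x)(j := y + g j x)" for x y
      using J by (auto simp: shear_def fun_eq_iff upd)
    let ?T = "\<lambda>y. (T (restrict y J))(j := y j - g j (T (restrict y J)))"
    have res: "restrict y J \<in> space (Leb J)" for y :: "'i \<Rightarrow> real" by (simp add: space_Leb)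
    have TJ: "T x \<in> extensional J" if "x \<in> extensional J" for x
      using measurable_space[OF T, of x] that by (simp add: space_Leb)
    have decomp: "\<exists>x\<in>extensional J. \<exists>y. z = x(j := y)" if "z \<in> extensional (insert j J)" for z :: "'i \<Rightarrow> real"
      by (rule bexI[of _ "restrict z J"], rule exI[of _ "z j"])
         (use that J in \<open>auto simp: fun_eq_iff extensional_def\<close>)
    have Tm: "?T \<in> measurable (Leb (insert j J)) (Leb (insert j J))"
    proof -
      have 1: "(\<lambda>y. T (restrict y J)) \<in> measurable (Leb (insert j J)) (Leb J)"
        by (rule measurable_compose[OF measurable_Leb_subset T]) auto
      have 2: "(\<lambda>y. y j - g j (T (restrict y J))) \<in> borel_measurable (Leb (insert j J))"
        by (intro borel_measurable_diff measurable_compose[OF 1 gm] measurable_Leb_component) auto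
      show ?thesis by (rule measurable_Leb_upd[OF 1 2])
    qed
    moreover have "?T (shear (insert j J) g z) = z \<and> shear (insert j J) g (?T z) = z"
      if z: "z \<in> space (Leb (insert j J))" for z
    proof -
      from z obtain x y where x: "x \<in> extensional J" and zxy: "z = x(j := y)"
        using decomp[of z] by (auto simp: space_Leb)
      have r1: "restrict (x'(j := y')) J = x'" if "x' \<in> extensional J" for x' and y' :: real
        using that J by (auto simp: fun_eq_iff extensional_def)
      have "shear J g x \<in> extensional J" by (simp add: shear_def)
      then have "?T (shear (insert j J) g z) = z"
        unfolding zxy sh using inv[of x] x by (simp add: r1 space_Leb)
      moreover have "shear (insert j J) g (?T z) = z"
        unfolding sh unfolding zxy using inv[of x] x TJ[OF x] by (simp add: r1 space_Leb)
      ultimately show ?thesis by blast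
    qed
    moreover have "(\<integral>\<^sup>+x. f (shear (insert j J) g x) \<partial>Leb (insert j J)) = (\<integral>\<^sup>+x. f x \<partial>Leb (insert j J))"
      if f: "f \<in> borel_measurable (Leb (insert j J))" for f
    proof -
      have shm: "shear (insert j J) g \<in> measurable (Leb (insert j J)) (Leb (insert j J))"
        by (rule measurable_shear) (rule insert.prems(1))
      have fu: "(\<lambda>(x, y). f (x(j := y))) \<in> borel_measurable (Leb J \<Otimes>\<^sub>M lborel)"
        unfolding split_beta by (rule measurable_compose[OF measurable_Leb_upd f]) auto
      have hm: "(\<lambda>x. \<integral>\<^sup>+y. f (x(j := y)) \<partial>lborel) \<in> borel_measurable (Leb J)"
        using lborel.borel_measurable_nn_integral[OF fu] by simp
      have "(\<integral>\<^sup>+x. f (shear (insert j J) g x) \<partial>Leb (insert j J))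
          = (\<integral>\<^sup>+x. \<integral>\<^sup>+y. f ((shear J g x)(j := y + g j x)) \<partial>lborel \<partial>Leb J)"
        by (subst Leb.product_nn_integral_insert[OF J measurable_compose[OF shm f]]) (simp add: sh)
      also have "\<dots> = (\<integral>\<^sup>+x. \<integral>\<^sup>+y. f ((shear J g x)(j := y)) \<partial>lborel \<partial>Leb J)"
      proof (rule nn_integral_cong)
        fix x assume "x \<in> space (Leb J)"
        then have "(\<lambda>y. f ((shear J g x)(j := y))) \<in> borel_measurable borel"
          using measurable_Pair2[OF fu, of "shear J g x"] by (simp add: shear_def space_Leb)
        from nn_integral_real_affine[OF this, of 1 "g j x"]
        show "(\<integral>\<^sup>+y. f ((shear J g x)(j := y + g j x)) \<partial>lborel) = (\<integral>\<^sup>+y. f ((shear J g x)(j := y)) \<partial>lborel)"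
          by (simp add: add.commute)
      qed
      also have "\<dots> = (\<integral>\<^sup>+x. \<integral>\<^sup>+y. f (x(j := y)) \<partial>lborel \<partial>Leb J)"
        by (rule int[OF hm])
      also have "\<dots> = (\<integral>\<^sup>+x. f x \<partial>Leb (insert j J))"
        by (rule Leb.product_nn_integral_insert[OF J f, symmetric])
      finally show ?thesis .
    qed
    ultimately show ?thesis by blast
  qed
qed

section \<open>Logistic substitution\<close>

text \<open>
  \<open>u \<mapsto> t * exp u / (exp u + K)\<close> is an increasing bijection from the line to \<open>{0<..<t}\<close> with the
  derivative that appears in the integrand.  The substitution rule for compact intervals is applied
  to \<open>{-n..n}\<close>; then \<open>n\<close> tends to infinity.
\<close>
lemma nn_integral_logistic:
  fixes t K :: real
  assumes t: "0 < t" and K: "0 < K" and f: "f \<in> borel_measurable borel"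
  shows "(\<integral>\<^sup>+u. f (t * exp u / (exp u + K)) * ennreal (t * exp u * K / (exp u + K)\<^sup>2) \<partial>lborel)
       = (\<integral>\<^sup>+x. f x * indicator {0<..<t} x \<partial>lborel)"
proof -
  define \<phi> where "\<phi> u = t * exp u / (exp u + K)" for u
  define \<phi>' where "\<phi>' u = t * exp u * K / (exp u + K)\<^sup>2" for u
  have pos: "0 < exp u + K" for u :: real using K by (simp add: add_pos_pos)
  have nz: "exp u + K \<noteq> 0" for u :: real using pos[of u] by linarith
  have der: "(\<phi> has_real_derivative \<phi>' u) (at u)" for u
    unfolding \<phi>_def \<phi>'_def
    by (auto intro!: derivative_eq_intros simp: nz) (simp add: power2_eq_square algebra_simps)
  have \<phi>'pos: "0 < \<phi>' u" for u using t K pos[of u] by (simp add: \<phi>'_def)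
  have cont: "continuous_on S \<phi>'" for S
    unfolding \<phi>'_def by (intro continuous_intros) (use nz in auto)
  have fpos: "0 < \<phi> u" and flt: "\<phi> u < t" for u
    using t K pos[of u] by (auto simp: \<phi>_def field_simps)
  have mono: "\<phi> a < \<phi> b" if "a < b" for a b
    by (rule DERIV_pos_imp_increasing[OF that]) (use der \<phi>'pos in blast)
  have mono': "\<phi> a \<le> \<phi> b" if "a \<le> b" for a b
    using mono[of a b] that by (cases "a = b") auto
  have top: "(\<phi> \<longlongrightarrow> t) at_top" and bot: "(\<phi> \<longlongrightarrow> 0) at_bot"
  proof -
    have eq: "\<phi> u = t * (1 - K / (exp u + K))" for u
      using nz[of u] by (simp add: \<phi>_def field_simps)
    have "filterlim (\<lambda>u::real. K + exp u) at_top at_top"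
      by (rule filterlim_tendsto_add_at_top[OF tendsto_const exp_at_top])
    then have "((\<lambda>u::real. K / (exp u + K)) \<longlongrightarrow> 0) at_top"
      by (intro tendsto_divide_0[OF tendsto_const]) (simp add: add.commute filterlim_at_top_imp_at_infinity)
    then have "((\<lambda>u. t * (1 - K / (exp u + K))) \<longlongrightarrow> t * (1 - 0)) at_top"
      by (intro tendsto_intros)
    then show "(\<phi> \<longlongrightarrow> t) at_top" by (simp add: eq[abs_def])
    have "((\<lambda>u. t * exp u / (exp u + K)) \<longlongrightarrow> t * 0 / (0 + K)) at_bot"
      by (intro tendsto_intros exp_at_bot) (use K in auto)
    then show "(\<phi> \<longlongrightarrow> 0) at_bot" by (simp add: \<phi>_def[abs_def])
  qed
  let ?I = "\<lambda>n::nat. {\<phi> (- real (Suc n))..\<phi> (real (Suc n))}"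
  let ?A = "\<lambda>n::nat. {- real (Suc n)..real (Suc n)}"
  have un: "(\<Union>n. ?I n) = {0<..<t}"
  proof (intro set_eqI iffI)
    fix x assume "x \<in> (\<Union>n. ?I n)"
    then show "x \<in> {0<..<t}" using fpos flt by (auto intro: less_le_trans le_less_trans)
  next
    fix x assume x: "x \<in> {0<..<t}"
    have "eventually (\<lambda>u. x < \<phi> u) at_top" using order_tendstoD(1)[OF top] x by auto
    then obtain a where a: "x < \<phi> u" if "a \<le> u" for u by (auto simp: eventually_at_top_linorder)
    have "eventually (\<lambda>u. \<phi> u < x) at_bot" using order_tendstoD(2)[OF bot] x by auto
    then obtain b where b: "\<phi> u < x" if "u \<le> b" for u by (auto simp: eventually_at_bot_linorder)
    obtain n :: nat where "max \<bar>a\<bar> \<bar>b\<bar> \<le> real n" using real_arch_simple by blast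
    then have "a \<le> real (Suc n)" "- real (Suc n) \<le> b" by auto
    then have "x \<in> ?I n" using a b by (auto intro: less_imp_le)
    then show "x \<in> (\<Union>n. ?I n)" by blast
  qed
  have incI: "incseq ?I" and incA: "incseq ?A"
    by (intro incseq_SucI atLeastatMost_subset_iff[THEN iffD2] disjI2 conjI mono'; simp)+
  have unA: "(\<Union>n. ?A n) = UNIV"
  proof -
    have "\<exists>n. x \<in> ?A n" for x
    proof -
      obtain n :: nat where "\<bar>x\<bar> \<le> real n" using real_arch_simple by blast
      then have "x \<in> ?A n" by auto
      then show ?thesis ..
    qed
    then show ?thesis by auto
  qed
  have meas\<phi>: "(\<lambda>u. f (\<phi> u)) \<in> borel_measurable borel" "\<phi>' \<in> borel_measurable borel"
    using f unfolding \<phi>_def \<phi>'_def by measurable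
  have mc: "(\<integral>\<^sup>+x. g x * indicator (\<Union>n. S n) x \<partial>lborel) = (SUP n. \<integral>\<^sup>+x. g x * indicator (S n) x \<partial>lborel)"
    if "incseq S" "g \<in> borel_measurable borel" "\<And>n. S n \<in> sets borel" for g :: "real \<Rightarrow> ennreal" and S :: "nat \<Rightarrow> real set"
  proof -
    have "emeasure (density lborel g) (\<Union>n. S n) = (SUP n. emeasure (density lborel g) (S n))"
      by (rule SUP_emeasure_incseq[symmetric]) (use that in auto)
    then show ?thesis using that by (simp add: emeasure_density sets.countable_UN)
  qed
  have step: "(\<integral>\<^sup>+x. f x * indicator (?I n) x \<partial>lborel)
        = (\<integral>\<^sup>+u. (f (\<phi> u) * ennreal (\<phi>' u)) * indicator (?A n) u \<partial>lborel)" for n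
    using nn_integral_substitution_aux[OF f _ der cont, of "- real (Suc n)" "real (Suc n)"] \<phi>'pos
    by (simp add: less_imp_le)
  have "(\<integral>\<^sup>+x. f x * indicator {0<..<t} x \<partial>lborel) = (SUP n. \<integral>\<^sup>+x. f x * indicator (?I n) x \<partial>lborel)"
    unfolding un[symmetric] by (rule mc[OF incI f]) simp
  also have "\<dots> = (SUP n. \<integral>\<^sup>+u. (f (\<phi> u) * ennreal (\<phi>' u)) * indicator (?A n) u \<partial>lborel)"
    unfolding step ..
  also have "\<dots> = (\<integral>\<^sup>+u. (f (\<phi> u) * ennreal (\<phi>' u)) * indicator (\<Union>n. ?A n) u \<partial>lborel)"
    by (rule mc[OF incA, symmetric]) (use meas\<phi> in auto)
  finally show ?thesis unfolding unA by (simp add: \<phi>_def \<phi>'_def)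
qed

section \<open>From log-odds to proportions within blocks\<close>

text \<open>
  \<open>\<beta>\<close> assigns coordinates to blocks.  Each block has a further member, of odds 1, that is not a
  coordinate and against which the log-odds \<open>\<eta>\<close> of the others are measured.
\<close>
definition odds_total :: "'i set \<Rightarrow> ('i \<Rightarrow> 'b) \<Rightarrow> ('i \<Rightarrow> real) \<Rightarrow> 'b \<Rightarrow> real" where
  "odds_total J \<beta> \<eta> b = 1 + (\<Sum>j | j \<in> J \<and> \<beta> j = b. exp (\<eta> j))"

lemma odds_total_ge_1: "1 \<le> odds_total J \<beta> \<eta> b"
  by (simp add: odds_total_def sum_nonneg)

lemma odds_total_pos: "0 < odds_total J \<beta> \<eta> b"
  using odds_total_ge_1[of J \<beta> \<eta> b] by linarith

lemma odds_total_empty [simp]: "odds_total {} \<beta> \<eta> b = 1"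
  by (simp add: odds_total_def)

lemma odds_total_insert:
  assumes "finite J" "j \<notin> J"
  shows "odds_total (insert j J) \<beta> (\<eta>(j := u)) b
       = odds_total J \<beta> \<eta> b + (if \<beta> j = b then exp u else 0)"
proof -
  have "{i. i \<in> insert j J \<and> \<beta> i = b} = (if \<beta> j = b then insert j {i. i \<in> J \<and> \<beta> i = b} else {i. i \<in> J \<and> \<beta> i = b})"
    by auto
  moreover have "(\<Sum>i | i \<in> J \<and> \<beta> i = b. exp ((\<eta>(j := u)) i)) = (\<Sum>i | i \<in> J \<and> \<beta> i = b. exp (\<eta> i))"
    using assms by (intro sum.cong) auto
  ultimately show ?thesis
    using assms by (simp add: odds_total_def)
qed

lemma borel_measurable_odds_total:
  assumes "finite J"
  shows "(\<lambda>\<eta>. odds_total J \<beta> \<eta> b) \<in> borel_measurable (Leb J)"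
  unfolding odds_total_def
  by (intro borel_measurable_add borel_measurable_const borel_measurable_sum
      measurable_compose[OF borel_measurable_component_Leb borel_measurable_exp]) auto

text \<open>
  The mass \<open>t b\<close> of the block \<open>b\<close> is shared in proportion to the odds; what is left over is the share
  of the reference member.
\<close>
definition block_softmax :: "'i set \<Rightarrow> ('i \<Rightarrow> 'b) \<Rightarrow> ('b \<Rightarrow> real) \<Rightarrow> ('i \<Rightarrow> real) \<Rightarrow> 'i \<Rightarrow> real" where
  "block_softmax J \<beta> t \<eta> = (\<lambda>j\<in>J. t (\<beta> j) * exp (\<eta> j) / odds_total J \<beta> \<eta> (\<beta> j))"

lemma measurable_block_softmax:
  assumes "finite J"
  shows "block_softmax J \<beta> t \<in> measurable (Leb J) (Leb J)"
  unfolding block_softmax_def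
  by (intro measurable_Leb_restrict borel_measurable_divide borel_measurable_times borel_measurable_const
      borel_measurable_odds_total assms measurable_compose[OF borel_measurable_component_Leb borel_measurable_exp]) auto

lemma block_softmax_total:
  assumes "finite J"
  shows "(\<Sum>j | j \<in> J \<and> \<beta> j = b. block_softmax J \<beta> t \<eta> j) = t b - t b / odds_total J \<beta> \<eta> b"
proof -
  have "(\<Sum>j | j \<in> J \<and> \<beta> j = b. block_softmax J \<beta> t \<eta> j) = (\<Sum>j | j \<in> J \<and> \<beta> j = b. t b / odds_total J \<beta> \<eta> b * exp (\<eta> j))"
    by (intro sum.cong) (auto simp: block_softmax_def)
  also have "\<dots> = t b / odds_total J \<beta> \<eta> b * (odds_total J \<beta> \<eta> b - 1)"
    by (simp add: sum_distrib_left odds_total_def)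
  finally show ?thesis
    using odds_total_pos[of J \<beta> \<eta> b] by (simp add: field_simps)
qed

text \<open>
  The strict bound leaves some mass for the reference member of each block.
\<close>
definition block_simplex :: "'i set \<Rightarrow> ('i \<Rightarrow> 'b) \<Rightarrow> 'b set \<Rightarrow> ('b \<Rightarrow> real) \<Rightarrow> ('i \<Rightarrow> real) set" where
  "block_simplex J \<beta> B t = {x. (\<forall>j\<in>J. 0 < x j) \<and> (\<forall>b\<in>B. (\<Sum>j | j \<in> J \<and> \<beta> j = b. x j) < t b)}"

lemma block_simplex_insert:
  assumes "finite J" "j \<notin> J" "\<beta> j \<in> B"
  shows "x(j := y) \<in> block_simplex (insert j J) \<beta> B t
     \<longleftrightarrow> 0 < y \<and> x \<in> block_simplex J \<beta> B (t(\<beta> j := t (\<beta> j) - y))"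
proof -
  have s: "(\<Sum>i | i \<in> insert j J \<and> \<beta> i = b. (x(j := y)) i)
     = (\<Sum>i | i \<in> J \<and> \<beta> i = b. x i) + (if \<beta> j = b then y else 0)" for b
  proof -
    have "{i. i \<in> insert j J \<and> \<beta> i = b} = (if \<beta> j = b then insert j {i. i \<in> J \<and> \<beta> i = b} else {i. i \<in> J \<and> \<beta> i = b})"
      by auto
    moreover have "(\<Sum>i | i \<in> J \<and> \<beta> i = b. (x(j := y)) i) = (\<Sum>i | i \<in> J \<and> \<beta> i = b. x i)"
      using assms by (intro sum.cong) auto
    ultimately show ?thesis using assms by simp
  qed
  show ?thesis
    unfolding block_simplex_def mem_Collect_eq s using assms by (auto split: if_splits)
qed

lemma measurable_block_simplex:
  assumes "finite J" "finite B" "\<And>j. j \<in> J \<Longrightarrow> (\<lambda>w. x w j) \<in> borel_measurable N"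
    "\<And>b. b \<in> B \<Longrightarrow> (\<lambda>w. t w b) \<in> borel_measurable N"
  shows "{w \<in> space N. x w \<in> block_simplex J \<beta> B (t w)} \<in> sets N"
proof -
  have [measurable]: "(\<lambda>w. \<Sum>j | j \<in> J \<and> \<beta> j = b. x w j) \<in> borel_measurable N" for b
    using assms(3) by (intro borel_measurable_sum) auto
  have "{w \<in> space N. x w \<in> block_simplex J \<beta> B (t w)}
     = {w \<in> space N. \<forall>j\<in>J. 0 < x w j} \<inter> {w \<in> space N. \<forall>b\<in>B. (\<Sum>j | j \<in> J \<and> \<beta> j = b. x w j) < t w b}"
    by (auto simp: block_simplex_def)
  also have "\<dots> \<in> sets N"
    using assms by (intro sets.Int sets.sets_Collect_finite_All borel_measurable_less borel_measurable_const) auto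
  finally show ?thesis .
qed

text \<open>
  The weight is the product of the shares of all members of all blocks, in units of the mass of the
  block for the reference members.  The proof adds the coordinates one by one.  If all other
  log-odds are fixed, then the share \<open>\<phi>\<close> of the new coordinate depends on its log-odds by a logistic
  function whose constant \<open>K\<close> is the total of the odds in the rest of its block; and given \<open>\<phi>\<close> the
  other coordinates form a block softmax for the masses from which \<open>\<phi>\<close> has been taken away.  This is
  why \<open>t\<close> is arbitrary in the induction.
\<close>
lemma nn_integral_block_softmax:
  assumes "finite J" "finite B" "\<beta> ` J \<subseteq> B" "\<And>b. b \<in> B \<Longrightarrow> 0 < t b" "f \<in> borel_measurable (Leb J)"
  shows "(\<integral>\<^sup>+\<eta>. f (block_softmax J \<beta> t \<eta>) *
            ennreal ((\<Prod>j\<in>J. block_softmax J \<beta> t \<eta> j) * (\<Prod>b\<in>B. 1 / odds_total J \<beta> \<eta> b)) \<partial>Leb J)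
       = (\<integral>\<^sup>+x. f x * indicator (block_simplex J \<beta> B t) x \<partial>Leb J)"
  using assms
proof (induction J arbitrary: f t rule: finite_induct)
  case empty
  have "indicator (block_simplex {} \<beta> B t) x = (1::ennreal)" for x
    using empty by (simp add: block_simplex_def)
  moreover have "block_softmax {} \<beta> t x = x" if "x \<in> space (Leb {})" for x
    using that by (simp add: block_softmax_def space_Leb extensional_def fun_eq_iff)
  ultimately show ?case by (intro nn_integral_cong) simp
next
  case (insert j J)
  note J = \<open>finite J\<close> \<open>j \<notin> J\<close>
  note f = insert.prems(4)
  define b0 where "b0 = \<beta> j"
  define c where "c = t b0"
  have c: "0 < c" and b0: "b0 \<in> B" using insert.prems by (auto simp: c_def b0_def)
  \<comment> \<open>the masses that remain once the new coordinate has taken \<open>y\<close>\<close>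
  define t' where "t' y = t(b0 := c - y)" for y
  define D where "D \<eta> = odds_total J \<beta> \<eta> b0" for \<eta>
  define \<phi> where "\<phi> \<eta> u = c * exp u / (exp u + D \<eta>)" for \<eta> u
  define w where "w \<eta> y = (\<Prod>i\<in>J. block_softmax J \<beta> (t' y) \<eta> i) * (\<Prod>b\<in>B. 1 / odds_total J \<beta> \<eta> b)" for \<eta> y
  have Dpos: "0 < D \<eta>" for \<eta> by (simp add: D_def odds_total_pos)
  have sum_pos: "0 < exp u + D \<eta>" for u \<eta> using Dpos[of \<eta>] by (simp add: add_pos_pos)
  have rest: "c - \<phi> \<eta> u = c * D \<eta> / (exp u + D \<eta>)" for \<eta> u
    using sum_pos[of u \<eta>] by (simp add: \<phi>_def field_simps)
  have \<phi>_bounds: "0 < \<phi> \<eta> u" "\<phi> \<eta> u < c" for \<eta> u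
    using c Dpos[of \<eta>] sum_pos[of u \<eta>] by (auto simp: \<phi>_def field_simps)
  have t'pos: "0 < t' y b" if "y < c" "b \<in> B" for y b
    using that insert.prems by (auto simp: t'_def)
  have w_nonneg: "0 \<le> w \<eta> y" if "y < c" for \<eta> y
    unfolding w_def
    by (intro mult_nonneg_nonneg prod_nonneg ballI)
       (use that insert.prems in \<open>auto simp: block_softmax_def less_imp_le odds_total_pos t'pos intro!: divide_nonneg_pos mult_nonneg_nonneg\<close>)
  have softmax_upd: "block_softmax (insert j J) \<beta> t (\<eta>(j := u))
      = (block_softmax J \<beta> (t' (\<phi> \<eta> u)) \<eta>)(j := \<phi> \<eta> u)" for \<eta> u
  proof
    fix i
    show "block_softmax (insert j J) \<beta> t (\<eta>(j := u)) i
      = ((block_softmax J \<beta> (t' (\<phi> \<eta> u)) \<eta>)(j := \<phi> \<eta> u)) i"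
    proof (cases "i = j")
      case True
      then show ?thesis
        by (simp add: block_softmax_def odds_total_insert[OF J] \<phi>_def D_def c_def b0_def add.commute)
    next
      case ij: False
      show ?thesis
      proof (cases "i \<in> J")
        case True
        show ?thesis
        proof (cases "\<beta> i = b0")
          case eq: True
          have "block_softmax (insert j J) \<beta> t (\<eta>(j := u)) i = c * exp (\<eta> i) / (D \<eta> + exp u)"
            using True ij eq by (simp add: block_softmax_def odds_total_insert[OF J] c_def D_def b0_def)
          moreover have "block_softmax J \<beta> (t' (\<phi> \<eta> u)) \<eta> i = (c - \<phi> \<eta> u) * exp (\<eta> i) / D \<eta>"
            using True eq by (simp add: block_softmax_def t'_def D_def)
          ultimately show ?thesis
            using ij Dpos[of \<eta>] sum_pos[of u \<eta>] by (simp add: rest add.commute)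
        next
          case False
          then show ?thesis
            using True ij by (simp add: block_softmax_def odds_total_insert[OF J] t'_def b0_def)
        qed
      next
        case False
        then show ?thesis using ij by (simp add: block_softmax_def)
      qed
    qed
  qed
  have weight: "(\<Prod>i\<in>insert j J. block_softmax (insert j J) \<beta> t (\<eta>(j := u)) i)
        * (\<Prod>b\<in>B. 1 / odds_total (insert j J) \<beta> (\<eta>(j := u)) b)
      = w \<eta> (\<phi> \<eta> u) * (c * exp u * D \<eta> / (exp u + D \<eta>)\<^sup>2)" for \<eta> u
  proof -
    have "(\<Prod>i\<in>insert j J. block_softmax (insert j J) \<beta> t (\<eta>(j := u)) i)
       = \<phi> \<eta> u * (\<Prod>i\<in>J. block_softmax J \<beta> (t' (\<phi> \<eta> u)) \<eta> i)"
      unfolding softmax_upd using J by (simp add: prod.insert) (intro disjI2 prod.cong, auto)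
    moreover have "(\<Prod>b\<in>B. 1 / odds_total (insert j J) \<beta> (\<eta>(j := u)) b)
      = (D \<eta> / (exp u + D \<eta>)) * (\<Prod>b\<in>B. 1 / odds_total J \<beta> \<eta> b)"
    proof -
      have "(\<Prod>b\<in>B. 1 / odds_total (insert j J) \<beta> (\<eta>(j := u)) b)
          = (1 / (D \<eta> + exp u)) * (\<Prod>b\<in>B - {b0}. 1 / odds_total J \<beta> \<eta> b)"
        by (subst prod.remove[OF \<open>finite B\<close> b0])
           (auto simp: odds_total_insert[OF J] D_def b0_def intro!: arg_cong2[of _ _ _ _ "(*)"] prod.cong split: if_splits)
      moreover have "(\<Prod>b\<in>B. 1 / odds_total J \<beta> \<eta> b) = (1 / D \<eta>) * (\<Prod>b\<in>B - {b0}. 1 / odds_total J \<beta> \<eta> b)"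
        by (subst prod.remove[OF \<open>finite B\<close> b0]) (simp add: D_def)
      ultimately show ?thesis using Dpos[of \<eta>] by (simp add: add.commute)
    qed
    ultimately show ?thesis
      by (simp add: w_def \<phi>_def power2_eq_square)
  qed
  have mD [measurable]: "D \<in> borel_measurable (Leb J)"
    unfolding D_def using J by (intro borel_measurable_odds_total)
  \<comment> \<open>the integrand, as a function of the old log-odds and of the new coordinate\<close>
  define g where "g \<eta> y = f ((block_softmax J \<beta> (t' y) \<eta>)(j := y)) * ennreal (w \<eta> y)" for \<eta> y
  have snd_m: "(\<lambda>p. snd p) \<in> borel_measurable (Leb J \<Otimes>\<^sub>M (lborel :: real measure))" by simp
  have bs_m: "(\<lambda>p. block_softmax J \<beta> (t' (snd p)) (fst p) i) \<in> borel_measurable (Leb J \<Otimes>\<^sub>M lborel)"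
    if "i \<in> J" for i
  proof -
    have "(\<lambda>p. t' (snd p) (\<beta> i)) \<in> borel_measurable (Leb J \<Otimes>\<^sub>M (lborel :: real measure))"
      by (cases "\<beta> i = b0") (simp_all add: t'_def)
    moreover have "(\<lambda>p. odds_total J \<beta> (fst p) (\<beta> i)) \<in> borel_measurable (Leb J \<Otimes>\<^sub>M (lborel :: real measure))"
      by (rule measurable_compose[OF measurable_fst borel_measurable_odds_total[OF J(1)]])
    moreover have "(\<lambda>p. fst p i) \<in> borel_measurable (Leb J \<Otimes>\<^sub>M (lborel :: real measure))"
      by (rule borel_measurable_component_Leb[OF measurable_fst that])
    ultimately show ?thesis using that
      by (simp add: block_softmax_def)
  qed
  have wm: "(\<lambda>p. w (fst p) (snd p)) \<in> borel_measurable (Leb J \<Otimes>\<^sub>M lborel)"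
    unfolding w_def
    by (intro borel_measurable_times borel_measurable_prod bs_m borel_measurable_divide borel_measurable_const
        measurable_compose[OF measurable_fst borel_measurable_odds_total[OF J(1)]])
  have gm: "(\<lambda>(\<eta>, y). g \<eta> y) \<in> borel_measurable (Leb J \<Otimes>\<^sub>M lborel)"
  proof -
    have "(\<lambda>p. (\<lambda>i\<in>J. block_softmax J \<beta> (t' (snd p)) (fst p) i)) \<in> measurable (Leb J \<Otimes>\<^sub>M lborel) (Leb J)"
      by (rule measurable_Leb_restrict) (rule bs_m)
    moreover have "(\<lambda>i\<in>J. block_softmax J \<beta> s \<eta> i) = block_softmax J \<beta> s \<eta>" for s \<eta>
      by (simp add: block_softmax_def restrict_def fun_eq_iff)
    ultimately have "(\<lambda>p. block_softmax J \<beta> (t' (snd p)) (fst p)) \<in> measurable (Leb J \<Otimes>\<^sub>M lborel) (Leb J)"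
      by simp
    then have "(\<lambda>p. f ((block_softmax J \<beta> (t' (snd p)) (fst p))(j := snd p))) \<in> borel_measurable (Leb J \<Otimes>\<^sub>M lborel)"
      by (rule measurable_compose[OF measurable_Leb_upd[OF _ snd_m] f])
    moreover have "(\<lambda>p. ennreal (w (fst p) (snd p))) \<in> borel_measurable (Leb J \<Otimes>\<^sub>M lborel)"
      using wm by (rule measurable_compose) simp
    ultimately show ?thesis unfolding g_def split_beta by (rule borel_measurable_times_ennreal)
  qed
  have g1: "g \<eta> \<in> borel_measurable borel" if "\<eta> \<in> space (Leb J)" for \<eta>
    using measurable_Pair2[OF gm that] by simp
  have gI: "(\<lambda>(\<eta>, y). g \<eta> y * indicator {0<..<c} y) \<in> borel_measurable (Leb J \<Otimes>\<^sub>M lborel)"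
    using gm by (simp add: split_beta)
  have "(\<integral>\<^sup>+\<eta>. f (block_softmax (insert j J) \<beta> t \<eta>) *
            ennreal ((\<Prod>i\<in>insert j J. block_softmax (insert j J) \<beta> t \<eta> i) * (\<Prod>b\<in>B. 1 / odds_total (insert j J) \<beta> \<eta> b)) \<partial>Leb (insert j J))
      = (\<integral>\<^sup>+\<eta>. \<integral>\<^sup>+u. f (block_softmax (insert j J) \<beta> t (\<eta>(j := u))) *
            ennreal ((\<Prod>i\<in>insert j J. block_softmax (insert j J) \<beta> t (\<eta>(j := u)) i) * (\<Prod>b\<in>B. 1 / odds_total (insert j J) \<beta> (\<eta>(j := u)) b))
            \<partial>lborel \<partial>Leb J)"
  proof (rule Leb.product_nn_integral_insert[OF J])
    have fin: "finite (insert j J)" using J by simp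
    note m = measurable_block_softmax[OF fin, of \<beta> t]
    show "(\<lambda>\<eta>. f (block_softmax (insert j J) \<beta> t \<eta>) *
            ennreal ((\<Prod>i\<in>insert j J. block_softmax (insert j J) \<beta> t \<eta> i) * (\<Prod>b\<in>B. 1 / odds_total (insert j J) \<beta> \<eta> b)))
         \<in> borel_measurable (Leb (insert j J))"
      by (intro borel_measurable_times_ennreal borel_measurable_times measurable_compose[OF m f] measurable_compose[OF _ measurable_ennreal]
          borel_measurable_prod borel_measurable_component_Leb[OF m] borel_measurable_divide
          borel_measurable_const borel_measurable_odds_total fin)
  qed
  also have "\<dots> = (\<integral>\<^sup>+\<eta>. \<integral>\<^sup>+u. g \<eta> (c * exp u / (exp u + D \<eta>)) * ennreal (c * exp u * D \<eta> / (exp u + D \<eta>)\<^sup>2) \<partial>lborel \<partial>Leb J)"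
  proof (intro nn_integral_cong)
    fix \<eta> u
    have "0 \<le> c * exp u * D \<eta> / (exp u + D \<eta>)\<^sup>2" using c Dpos[of \<eta>] by simp
    then show "f (block_softmax (insert j J) \<beta> t (\<eta>(j := u))) *
            ennreal ((\<Prod>i\<in>insert j J. block_softmax (insert j J) \<beta> t (\<eta>(j := u)) i) * (\<Prod>b\<in>B. 1 / odds_total (insert j J) \<beta> (\<eta>(j := u)) b))
        = g \<eta> (c * exp u / (exp u + D \<eta>)) * ennreal (c * exp u * D \<eta> / (exp u + D \<eta>)\<^sup>2)"
      unfolding weight unfolding softmax_upd g_def \<phi>_def[symmetric]
      by (simp only: ennreal_mult[OF w_nonneg[OF \<phi>_bounds(2)]] mult.assoc)
  qed
  also have "\<dots> = (\<integral>\<^sup>+\<eta>. \<integral>\<^sup>+y. g \<eta> y * indicator {0<..<c} y \<partial>lborel \<partial>Leb J)"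
    by (intro nn_integral_cong nn_integral_logistic c Dpos g1)
  also have "\<dots> = (\<integral>\<^sup>+y. \<integral>\<^sup>+\<eta>. g \<eta> y * indicator {0<..<c} y \<partial>Leb J \<partial>lborel)"
    by (rule pair_sigma_finite.Fubini'[symmetric])
       (use gI J in \<open>auto simp: pair_sigma_finite_def sigma_finite_Leb lborel.sigma_finite_measure_axioms\<close>)
  also have "\<dots> = (\<integral>\<^sup>+y. \<integral>\<^sup>+x. f (x(j := y)) * indicator (block_simplex (insert j J) \<beta> B t) (x(j := y)) \<partial>Leb J \<partial>lborel)"
  proof (rule nn_integral_cong)
    fix y :: real
    show "(\<integral>\<^sup>+\<eta>. g \<eta> y * indicator {0<..<c} y \<partial>Leb J)
       = (\<integral>\<^sup>+x. f (x(j := y)) * indicator (block_simplex (insert j J) \<beta> B t) (x(j := y)) \<partial>Leb J)"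
    proof (cases "0 < y \<and> y < c")
      case True
      have fy: "(\<lambda>x. f (x(j := y))) \<in> borel_measurable (Leb J)"
        by (rule measurable_compose[OF measurable_Leb_upd f]) auto
      have "(\<integral>\<^sup>+\<eta>. g \<eta> y * indicator {0<..<c} y \<partial>Leb J) = (\<integral>\<^sup>+x. f (x(j := y)) * indicator (block_simplex J \<beta> B (t' y)) x \<partial>Leb J)"
      proof -
        have "(\<integral>\<^sup>+\<eta>. g \<eta> y \<partial>Leb J) = (\<integral>\<^sup>+x. f (x(j := y)) * indicator (block_simplex J \<beta> B (t' y)) x \<partial>Leb J)"
          unfolding g_def w_def by (rule insert.IH[OF _ _ _ fy]) (use insert.prems True t'pos in auto)
        then show ?thesis using True by simp
      qed
      also have "\<dots> = (\<integral>\<^sup>+x. f (x(j := y)) * indicator (block_simplex (insert j J) \<beta> B t) (x(j := y)) \<partial>Leb J)"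
        using block_simplex_insert[where \<beta> = \<beta> and B = B and t = t, OF J] True b0 by (intro nn_integral_cong)
          (simp add: indicator_def t'_def b0_def c_def)
      finally show ?thesis .
    next
      case False
      have "x(j := y) \<notin> block_simplex (insert j J) \<beta> B t" for x
      proof
        assume "x(j := y) \<in> block_simplex (insert j J) \<beta> B t"
        then have y: "0 < y" and x: "x \<in> block_simplex J \<beta> B (t(\<beta> j := t (\<beta> j) - y))"
          using block_simplex_insert[where \<beta> = \<beta> and B = B and t = t, OF J] b0 by (auto simp: b0_def)
        have "0 \<le> (\<Sum>i | i \<in> J \<and> \<beta> i = b0. x i)"
          using x by (intro sum_nonneg) (auto simp: block_simplex_def less_imp_le)
        also have "\<dots> < c - y" using x b0 by (auto simp: block_simplex_def b0_def c_def)
        finally show False using y False by simp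
      qed
      then show ?thesis using False by (auto simp: indicator_def)
    qed
  qed
  also have "\<dots> = (\<integral>\<^sup>+x. f x * indicator (block_simplex (insert j J) \<beta> B t) x \<partial>Leb (insert j J))"
  proof (rule Leb.product_nn_integral_insert_rev[OF J, symmetric])
    have "{x \<in> space (Leb (insert j J)). x \<in> block_simplex (insert j J) \<beta> B t} \<in> sets (Leb (insert j J))"
      by (rule measurable_block_simplex) (use J insert.prems(1) in \<open>auto intro!: measurable_Leb_component\<close>)
    then have "(\<lambda>x. indicator (block_simplex (insert j J) \<beta> B t) x :: ennreal) \<in> borel_measurable (Leb (insert j J))"
      by (simp add: borel_measurable_indicator_iff Int_def conj_commute)
    then show "(\<lambda>x. f x * indicator (block_simplex (insert j J) \<beta> B t) x) \<in> borel_measurable (Leb (insert j J))"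
      using f by simp
  qed
  finally show ?case .
qed

section \<open>Dirichlet integrals in log-odds coordinates\<close>

text \<open>
  The Beta integral in the log-odds coordinate.  It takes values in the extended reals because
  divergence is what makes hyperparameters positive.
\<close>
definition beta_odds :: "real \<Rightarrow> real \<Rightarrow> ennreal" where
  "beta_odds a c = (\<integral>\<^sup>+u. ennreal (exp (a * u) / (1 + exp u) powr (a + c)) \<partial>lborel)"

text \<open>
  Translating \<open>u\<close> by \<open>ln K\<close> takes the factor \<open>K\<close> out of the denominator.
\<close>
lemma nn_integral_odds_scaled:
  assumes K: "0 < K"
  shows "(\<integral>\<^sup>+u. ennreal (exp (a * u) / (K + exp u) powr A) \<partial>lborel)
       = ennreal (K powr (a - A)) * beta_odds a (A - a)"
proof -
  have m: "(\<lambda>u. ennreal (exp (a * u) / (K + exp u) powr A)) \<in> borel_measurable borel" by measurable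
  have e: "exp (a * (ln K + 1 * u)) / (K + exp (ln K + 1 * u)) powr A
     = K powr (a - A) * (exp (a * u) / (1 + exp u) powr (a + (A - a)))" for u
  proof -
    have "K + exp (ln K + 1 * u) = K * (1 + exp u)" using K by (simp add: exp_add algebra_simps)
    then have "(K + exp (ln K + 1 * u)) powr A = K powr A * (1 + exp u) powr A"
      using K by (simp add: powr_mult add_nonneg_nonneg)
    moreover have "exp (a * (ln K + 1 * u)) = K powr a * exp (a * u)"
      using K by (simp add: powr_def exp_add algebra_simps)
    ultimately show ?thesis using K by (simp add: powr_diff)
  qed
  show ?thesis
    unfolding beta_odds_def
    by (subst nn_integral_real_affine[OF m, of 1 "ln K"])
       (simp_all only: e ennreal_mult' powr_ge_zero, simp_all add: nn_integral_cmult)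
qed

lemma beta_odds_commute: "beta_odds a c = beta_odds c a"
proof -
  have e: "exp (a * (0 + (-1) * u)) / (1 + exp (0 + (-1) * u)) powr (a + c) = exp (c * u) / (1 + exp u) powr (c + a)" for u :: real
  proof -
    have "1 + exp (- u) = exp (- u) * (1 + exp u)" by (simp add: algebra_simps flip: exp_add)
    then have "(1 + exp (- u)) powr (a + c) = exp (- u * (a + c)) * (1 + exp u) powr (a + c)"
      by (simp add: powr_mult add_nonneg_nonneg) (simp add: powr_def mult.commute)
    moreover have "exp (- u * (a + c)) = exp (- (a * u)) / exp (c * u)"
      by (simp add: algebra_simps flip: exp_diff)
    ultimately show ?thesis by (simp add: add.commute)
  qed
  show ?thesis
    unfolding beta_odds_def
    by (subst nn_integral_real_affine[of _ "-1" 0]) (simp_all only: e, simp_all)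
qed

lemma beta_odds_eq_Beta:
  assumes a: "0 < a" and c: "0 < c"
  shows "beta_odds a c = ennreal (Beta a c)"
proof -
  let ?f = "\<lambda>x. ennreal (x powr (a - 1) * (1 - x) powr (c - 1))"
  have "((\<lambda>x. x powr (a - 1) * (1 - x) powr (c - 1)) has_integral Beta a c) {0<..<1}"
    using has_integral_Beta_real[OF a c] by (simp add: has_integral_Icc_iff_Ioo)
  then have "(\<integral>\<^sup>+x. ?f x * indicator {0<..<1} x \<partial>lborel) = ennreal (Beta a c)"
    by (intro nn_integral_has_integral_lebesgue') auto
  moreover have "(\<integral>\<^sup>+u. ?f (1 * exp u / (exp u + 1)) * ennreal (1 * exp u * 1 / (exp u + 1)\<^sup>2) \<partial>lborel)
      = (\<integral>\<^sup>+x. ?f x * indicator {0<..<1} x \<partial>lborel)"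
    by (rule nn_integral_logistic) auto
  moreover have "?f (1 * exp u / (exp u + 1)) * ennreal (1 * exp u * 1 / (exp u + 1)\<^sup>2)
      = ennreal (exp (a * u) / (1 + exp u) powr (a + c))" for u :: real
  proof -
    define d where "d = 1 + exp u"
    have d: "0 < d" by (simp add: d_def add_pos_pos)
    have "1 - exp u / d = 1 / d" using d by (simp add: d_def field_simps)
    then have "(exp u / d) powr (a - 1) * (1 - exp u / d) powr (c - 1) * (exp u / d\<^sup>2)
       = exp ((a - 1) * u) * exp u / (d powr (a - 1) * d powr (c - 1) * d powr 2)"
      using d by (simp add: powr_divide exp_powr_real powr_numeral mult.commute)
    also have "\<dots> = exp (a * u) / d powr (a + c)"
      by (simp add: algebra_simps flip: exp_add powr_add)
    finally show ?thesis by (simp add: d_def add.commute flip: ennreal_mult')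
  qed
  ultimately show ?thesis by (simp add: beta_odds_def)
qed

text \<open>
  For \<open>a \<le> 0\<close> the integrand is bounded away from zero on the negative half-line; the other case is
  its reflection.
\<close>
lemma beta_odds_infinite:
  assumes "a \<le> 0 \<or> c \<le> 0"
  shows "beta_odds a c = \<infinity>"
proof -
  have *: "beta_odds a c = \<infinity>" if a: "a \<le> 0" for a c
  proof -
    define m where "m = 2 powr (- \<bar>a + c\<bar>)"
    have m: "0 < m" by (simp add: m_def)
    have le: "m \<le> exp (a * u) / (1 + exp u) powr (a + c)" if u: "u \<le> 0" for u
    proof -
      have e: "1 \<le> 1 + exp u" "1 + exp u \<le> 2" using u by auto
      have "(1 + exp u) powr (a + c) \<le> (1 + exp u) powr \<bar>a + c\<bar>"
        by (rule powr_mono) (use e in auto)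
      also have "\<dots> \<le> 2 powr \<bar>a + c\<bar>" by (rule powr_mono2) (use e in auto)
      finally have "m \<le> 1 / (1 + exp u) powr (a + c)"
        using add_pos_pos[OF zero_less_one exp_gt_zero[of u]] by (simp add: m_def powr_minus divide_simps)
      also have "\<dots> \<le> exp (a * u) / (1 + exp u) powr (a + c)"
        using a u by (intro divide_right_mono) (auto simp: mult_nonpos_nonpos)
      finally show ?thesis .
    qed
    have lower: "ennreal (m * real n) \<le> beta_odds a c" for n
    proof -
      have "ennreal (m * real n) = (\<integral>\<^sup>+u. ennreal m * indicator {- real n..0} u \<partial>lborel)"
        using m by (subst nn_integral_cmult_indicator) (auto simp: ennreal_mult')
      also have "\<dots> \<le> beta_odds a c" unfolding beta_odds_def
        by (rule nn_integral_mono) (auto simp: indicator_def intro!: ennreal_leI le)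
      finally show ?thesis .
    qed
    show ?thesis
    proof (rule ccontr)
      assume "beta_odds a c \<noteq> \<infinity>"
      then obtain r where r: "beta_odds a c = ennreal r" "0 \<le> r"
        by (cases "beta_odds a c") auto
      obtain n :: nat where "r / m < real n" using reals_Archimedean2 by blast
      then have "r < m * real n" using m by (simp add: field_simps)
      then show False using lower[of n] r by (simp add: ennreal_le_iff)
    qed
  qed
  show ?thesis using assms *[of a c] *[of c a] beta_odds_commute[of a c] by metis
qed

lemma beta_odds_nonzero: "beta_odds a c \<noteq> 0"
proof (cases "0 < a \<and> 0 < c")
  case True
  then have "0 < Beta a c" by (simp add: Beta_def)
  then show ?thesis using True by (simp add: beta_odds_eq_Beta)
next
  case False
  then show ?thesis using beta_odds_infinite[of a c] by (metis ennreal_top_neq_zero infinity_ennreal_def not_less)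
qed

text \<open>
  Up to the form of the coordinates, a product of Dirichlet integrals over the blocks.  \<open>A b\<close> is the
  sum of all the parameters of the block \<open>b\<close>, so the reference member has the parameter
  \<open>A b - (\<Sum>j | j \<in> J \<and> \<beta> j = b. a j)\<close>.
\<close>
definition block_dirichlet_integral :: "'i set \<Rightarrow> ('i \<Rightarrow> 'b) \<Rightarrow> 'b set \<Rightarrow> ('i \<Rightarrow> real) \<Rightarrow> ('b \<Rightarrow> real) \<Rightarrow> ennreal" where
  "block_dirichlet_integral J \<beta> B a A =
     (\<integral>\<^sup>+\<eta>. ennreal ((\<Prod>j\<in>J. exp (a j * \<eta> j)) / (\<Prod>b\<in>B. odds_total J \<beta> \<eta> b powr A b)) \<partial>Leb J)"

lemma block_dirichlet_integral_empty: "block_dirichlet_integral {} \<beta> B a A = 1"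
proof -
  show ?thesis
    by (simp add: block_dirichlet_integral_def PiM_empty nn_integral_count_space_finite)
qed

text \<open>
  The new coordinate is integrated first.  By scaling, this leaves a power of the total odds of the
  rest of its block, which lowers the exponent \<open>A\<close> by \<open>a j\<close>.
\<close>
lemma block_dirichlet_integral_insert:
  assumes J: "finite J" "j \<notin> J" and B: "finite B" "\<beta> j \<in> B"
  shows "block_dirichlet_integral (insert j J) \<beta> B a A
       = beta_odds (a j) (A (\<beta> j) - a j) * block_dirichlet_integral J \<beta> B a (A(\<beta> j := A (\<beta> j) - a j))"
proof -
  define b0 where "b0 = \<beta> j"
  define D where "D \<eta> = odds_total J \<beta> \<eta> b0" for \<eta>
  define R where "R \<eta> = (\<Prod>i\<in>J. exp (a i * \<eta> i)) / (\<Prod>b\<in>B - {b0}. odds_total J \<beta> \<eta> b powr A b)" for \<eta>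
  have D: "0 < D \<eta>" for \<eta> by (simp add: D_def odds_total_pos)
  have R: "0 \<le> R \<eta>" for \<eta> by (simp add: R_def prod_nonneg)
  have old: "(\<Prod>i\<in>J. exp (a i * \<eta> i)) / (\<Prod>b\<in>B. odds_total J \<beta> \<eta> b powr (A(\<beta> j := A (\<beta> j) - a j)) b)
      = R \<eta> * D \<eta> powr (a j - A b0)" for \<eta>
    by (subst prod.remove[OF B(1), of b0])
       (use B D[of \<eta>] in \<open>auto simp: R_def D_def b0_def powr_diff intro!: arg_cong2[of _ _ _ _ "(/)"] prod.cong\<close>)
  have new: "(\<Prod>i\<in>insert j J. exp (a i * (\<eta>(j := u)) i)) / (\<Prod>b\<in>B. odds_total (insert j J) \<beta> (\<eta>(j := u)) b powr A b)
      = R \<eta> * (exp (a j * u) / (D \<eta> + exp u) powr A b0)" for \<eta> u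
  proof -
    have "(\<Prod>i\<in>insert j J. exp (a i * (\<eta>(j := u)) i)) = exp (a j * u) * (\<Prod>i\<in>J. exp (a i * \<eta> i))"
      using J by (simp add: prod.insert) (intro prod.cong, auto)
    moreover have "(\<Prod>b\<in>B. odds_total (insert j J) \<beta> (\<eta>(j := u)) b powr A b)
        = (D \<eta> + exp u) powr A b0 * (\<Prod>b\<in>B - {b0}. odds_total J \<beta> \<eta> b powr A b)"
      by (subst prod.remove[OF B(1), of b0])
         (use B in \<open>auto simp: odds_total_insert[OF J] D_def b0_def intro!: arg_cong2[of _ _ _ _ "(*)"] prod.cong split: if_splits\<close>)
    ultimately show ?thesis by (simp only: R_def) (simp add: mult_ac)
  qed
  have m: "(\<lambda>\<eta>. ennreal ((\<Prod>j\<in>J. exp (a j * \<eta> j)) / (\<Prod>b\<in>B. odds_total J \<beta> \<eta> b powr A b))) \<in> borel_measurable (Leb J)"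
    if "finite J" for J :: "'a set" and A
    by (intro measurable_compose[OF _ measurable_ennreal] borel_measurable_divide borel_measurable_prod
        measurable_compose[OF borel_measurable_times borel_measurable_exp] borel_measurable_const
        borel_measurable_component_Leb measurable_ident powr_real_measurable borel_measurable_odds_total that) auto
  have "block_dirichlet_integral (insert j J) \<beta> B a A
      = (\<integral>\<^sup>+\<eta>. \<integral>\<^sup>+u. ennreal (R \<eta>) * ennreal (exp (a j * u) / (D \<eta> + exp u) powr A b0) \<partial>lborel \<partial>Leb J)"
    unfolding block_dirichlet_integral_def
    by (subst Leb.product_nn_integral_insert[OF J m])
       (use J in \<open>simp_all only: new ennreal_mult'[OF R] finite_insert\<close>)
  also have "\<dots> = (\<integral>\<^sup>+\<eta>. ennreal (R \<eta>) * (ennreal (D \<eta> powr (a j - A b0)) * beta_odds (a j) (A b0 - a j)) \<partial>Leb J)"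
    by (intro nn_integral_cong) (simp add: nn_integral_cmult nn_integral_odds_scaled[OF D])
  also have "\<dots> = (\<integral>\<^sup>+\<eta>. beta_odds (a j) (A b0 - a j) * ennreal (R \<eta> * D \<eta> powr (a j - A b0)) \<partial>Leb J)"
    by (intro nn_integral_cong) (simp add: ennreal_mult'[OF R] mult_ac)
  also have "\<dots> = beta_odds (a j) (A b0 - a j) * block_dirichlet_integral J \<beta> B a (A(\<beta> j := A (\<beta> j) - a j))"
    unfolding block_dirichlet_integral_def
    by (subst nn_integral_cmult[symmetric]) (use m[OF J(1), of "A(\<beta> j := A (\<beta> j) - a j)"] in \<open>simp_all only: old\<close>)
  finally show ?thesis by (simp add: b0_def)
qed

lemma block_dirichlet_integral_nonzero:
  assumes "finite J" "finite B" "\<beta> ` J \<subseteq> B"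
  shows "block_dirichlet_integral J \<beta> B a A \<noteq> 0"
  using assms
  by (induction J arbitrary: A rule: finite_induct)
     (auto simp: block_dirichlet_integral_empty block_dirichlet_integral_insert beta_odds_nonzero)

lemma block_sum_insert:
  assumes "finite J" "j \<notin> J"
  shows "(\<Sum>i | i \<in> insert j J \<and> \<beta> i = b. f i) = (\<Sum>i | i \<in> J \<and> \<beta> i = b. f i) + (if \<beta> j = b then f j else (0::real))"
proof -
  have "{i. i \<in> insert j J \<and> \<beta> i = b} = (if \<beta> j = b then insert j {i. i \<in> J \<and> \<beta> i = b} else {i. i \<in> J \<and> \<beta> i = b})"
    by auto
  then show ?thesis using assms by simp
qed

text \<open>
  No factor in the recursion vanishes, so each of them has to be finite.  Blocks outside \<open>\<beta> ` J\<close> have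
  no coordinate to integrate and impose no condition.
\<close>
lemma block_dirichlet_integral_finiteD:
  assumes "finite J" "finite B" "\<beta> ` J \<subseteq> B" "block_dirichlet_integral J \<beta> B a A < \<infinity>"
  shows "(\<forall>j\<in>J. 0 < a j) \<and> (\<forall>b\<in>\<beta> ` J. 0 < A b - (\<Sum>j | j \<in> J \<and> \<beta> j = b. a j))"
  using assms
proof (induction J arbitrary: A rule: finite_induct)
  case (insert j J)
  let ?A = "A(\<beta> j := A (\<beta> j) - a j)"
  have "beta_odds (a j) (A (\<beta> j) - a j) * block_dirichlet_integral J \<beta> B a ?A < \<infinity>"
    using insert.prems insert.hyps by (simp add: block_dirichlet_integral_insert)
  then have fin: "beta_odds (a j) (A (\<beta> j) - a j) < \<infinity>" "block_dirichlet_integral J \<beta> B a ?A < \<infinity>"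
    using beta_odds_nonzero[of "a j" "A (\<beta> j) - a j"]
      block_dirichlet_integral_nonzero[OF insert.hyps(1) insert.prems(1), of \<beta> a ?A] insert.prems
    by (auto simp: ennreal_mult_less_top)
  have j: "0 < a j" "0 < A (\<beta> j) - a j"
    using fin(1) beta_odds_infinite[of "a j" "A (\<beta> j) - a j"] by (metis less_irrefl not_le)+
  have IH: "(\<forall>i\<in>J. 0 < a i) \<and> (\<forall>b\<in>\<beta> ` J. 0 < ?A b - (\<Sum>i | i \<in> J \<and> \<beta> i = b. a i))"
    using insert.IH[OF insert.prems(1) _ fin(2)] insert.prems by auto
  have "0 < A b - (\<Sum>i | i \<in> insert j J \<and> \<beta> i = b. a i)" if b: "b \<in> \<beta> ` insert j J" for b
  proof (cases "b \<in> \<beta> ` J")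
    case True
    then have "0 < ?A b - (\<Sum>i | i \<in> J \<and> \<beta> i = b. a i)" using IH by blast
    then show ?thesis unfolding block_sum_insert[OF insert.hyps] by (auto split: if_splits)
  next
    case False
    then have "{i. i \<in> J \<and> \<beta> i = b} = {}" by auto
    then have "(\<Sum>i | i \<in> J \<and> \<beta> i = b. a i) = 0" by (metis sum.empty)
    moreover have "b = \<beta> j" using False b by auto
    ultimately show ?thesis using j unfolding block_sum_insert[OF insert.hyps] by simp
  qed
  then show ?case using IH j by auto
qed simp

text \<open>
  The factor \<open>\<Gamma>(A b - a j)\<close> in the numerator of the Beta function cancels against the denominator that
  the induction hypothesis has for the lowered exponent.
\<close>
lemma block_dirichlet_integral_eq:
  assumes "finite J" "finite B" "\<beta> ` J \<subseteq> B" "\<And>j. j \<in> J \<Longrightarrow> 0 < a j"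
    "\<And>b. b \<in> B \<Longrightarrow> 0 < A b - (\<Sum>j | j \<in> J \<and> \<beta> j = b. a j)"
  shows "block_dirichlet_integral J \<beta> B a A
    = ennreal ((\<Prod>j\<in>J. Gamma (a j)) * (\<Prod>b\<in>B. Gamma (A b - (\<Sum>j | j \<in> J \<and> \<beta> j = b. a j)) / Gamma (A b)))"
  using assms
proof (induction J arbitrary: A rule: finite_induct)
  case empty
  then have "(\<Prod>b\<in>B. Gamma (A b) / Gamma (A b)) = 1"
    by (intro prod.neutral) (use Gamma_real_pos in \<open>fastforce intro!: divide_self\<close>)
  then show ?case by (simp add: block_dirichlet_integral_empty)
next
  case (insert j J)
  define b0 where "b0 = \<beta> j"
  let ?A = "A(\<beta> j := A (\<beta> j) - a j)"
  let ?s = "\<lambda>b. \<Sum>i | i \<in> J \<and> \<beta> i = b. a i"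
  have aj: "0 < a j" using insert.prems by auto
  have s0: "0 \<le> ?s b" for b using insert.prems by (intro sum_nonneg) (auto simp: less_imp_le)
  have b0B: "b0 \<in> B" using insert.prems by (auto simp: b0_def)
  have A': "0 < ?A b - ?s b" if "b \<in> B" for b
    using insert.prems(4)[OF that, unfolded block_sum_insert[OF insert.hyps]] unfolding block_sum_insert[OF insert.hyps] by (auto split: if_splits)
  have c: "0 < A b0 - a j" using A'[OF b0B] s0[of b0] by (simp add: b0_def)
  have eqs: "?A b - ?s b = A b - (\<Sum>i | i \<in> insert j J \<and> \<beta> i = b. a i)" for b
    unfolding block_sum_insert[OF insert.hyps] by auto
  have g: "0 < Gamma (A b0 - a j)" "0 < Gamma (A b0)" using c aj by (auto intro!: Gamma_real_pos)
  have "(\<Prod>b\<in>B. Gamma (?A b - ?s b) / Gamma (?A b)) * (Gamma (A b0 - a j) / Gamma (A b0))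
      = (\<Prod>b\<in>B. Gamma (?A b - ?s b) / Gamma (A b))"
    by (subst (1 2) prod.remove[OF \<open>finite B\<close> b0B]) (use g in \<open>simp add: b0_def\<close>)
  then have prodeq: "(\<Prod>b\<in>B. Gamma (?A b - ?s b) / Gamma (A b)) = (\<Prod>b\<in>B. Gamma (?A b - ?s b) / Gamma (?A b)) * (Gamma (A b0 - a j) / Gamma (A b0))" by simp
  have "block_dirichlet_integral (insert j J) \<beta> B a A
     = ennreal (Beta (a j) (A b0 - a j)) * ennreal ((\<Prod>j\<in>J. Gamma (a j)) * (\<Prod>b\<in>B. Gamma (?A b - ?s b) / Gamma (?A b)))"
  proof -
    have "block_dirichlet_integral J \<beta> B a ?A
        = ennreal ((\<Prod>j\<in>J. Gamma (a j)) * (\<Prod>b\<in>B. Gamma (?A b - ?s b) / Gamma (?A b)))"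
      by (rule insert.IH) (use insert.prems A' in auto)
    then show ?thesis
      by (simp only: block_dirichlet_integral_insert[where \<beta> = \<beta>, OF insert.hyps \<open>finite B\<close> b0B[unfolded b0_def]]
          beta_odds_eq_Beta[OF aj c, unfolded b0_def] b0_def)
  qed
  also have "\<dots> = ennreal ((\<Prod>j\<in>insert j J. Gamma (a j)) * (\<Prod>b\<in>B. Gamma (?A b - ?s b) / Gamma (A b)))"
    unfolding prodeq
    by (subst ennreal_mult'[symmetric]) (use insert.hyps aj c in \<open>auto simp: Beta_def mult_ac Gamma_real_pos less_imp_le\<close>)
  finally show ?case unfolding eqs .
qed

section \<open>Moebius inversion on tables\<close>

lemma alternating_sum_interval:
  assumes "finite E" "D \<subseteq> E"
  shows "(\<Sum>F | D \<subseteq> F \<and> F \<subseteq> E. (-1) ^ card (F - D)) = (if D = E then 1 else (0::real))"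
proof (cases "D = E")
  case True
  then have "{F. D \<subseteq> F \<and> F \<subseteq> E} = {E}" by auto
  then show ?thesis using True by simp
next
  case False
  let ?I = "{F. D \<subseteq> F \<and> F \<subseteq> E}"
  have "(-1::real) ^ card (F - D) = (-1) ^ card F * (-1) ^ card D" if F: "F \<in> ?I" for F
  proof -
    have "finite F" "finite D" using F assms finite_subset by auto
    then have "card F = card (F - D) + card D" using F by (simp add: card_Diff_subset card_mono)
    then show ?thesis by (simp add: power_add flip: power_mult_distrib)
  qed
  then have "(\<Sum>F\<in>?I. (-1::real) ^ card (F - D)) = (\<Sum>F\<in>?I. (-1) ^ card F) * (-1) ^ card D"
    by (simp add: sum_distrib_right)
  also have "(\<Sum>F\<in>?I. (-1::real) ^ card F) = 0"
    by (rule sum_alternating_cancels)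
      (use assms False card_subsupersets_even_odd[of E D] in \<open>auto simp: psubset_eq conj_ac\<close>)
  finally show ?thesis using False by simp
qed

lemma sum_fibres:
  assumes "finite S" "finite T"
  shows "(\<Sum>t\<in>T. \<Sum>x | x \<in> S \<and> g x = t. f x) = (\<Sum>x | x \<in> S \<and> g x \<in> T. (f x :: real))"
proof -
  have "(\<Sum>x | x \<in> S \<and> g x \<in> T. f x) = (\<Sum>t\<in>T. sum f {x \<in> {x \<in> S. g x \<in> T}. g x = t})"
    by (rule sum.group[symmetric]) (use assms in auto)
  also have "\<dots> = (\<Sum>t\<in>T. \<Sum>x | x \<in> S \<and> g x = t. f x)"
    by (intro sum.cong) auto
  finally show ?thesis by simp
qed

definition support :: "'v set \<Rightarrow> ('v \<Rightarrow> 'l::zero) \<Rightarrow> 'v set" where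
  "support A c = {\<gamma> \<in> A. c \<gamma> \<noteq> 0}"

text \<open>
  Unlike \<open>sub_coords\<close>, this includes the empty face, which stands for the all-zero cell; so the
  elements correspond to all the \<open>A\<close>-cells (\<open>bij_cells\<close>).
\<close>
definition full_coords :: "('v \<Rightarrow> 'l::zero set) \<Rightarrow> 'v set \<Rightarrow> ('v, 'l) coord set" where
  "full_coords L A = (SIGMA D:Pow A. cells_star L D)"

lemma support_subset: "support A c \<subseteq> A"
  by (auto simp: support_def)

lemma support_zero_fill:
  "D \<subseteq> A \<Longrightarrow> i \<in> cells_star L D \<Longrightarrow> support A (zero_fill A D i) = D"
  by (auto simp: support_def zero_fill_def cells_star_def PiE_def Pi_def)

lemma restrict_zero_fill: "D \<subseteq> A \<Longrightarrow> i \<in> cells_star L D \<Longrightarrow> restrict (zero_fill A D i) D = i"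
  by (auto simp: zero_fill_def cells_star_def PiE_def extensional_def fun_eq_iff restrict_def)

lemma zero_fill_restrict: "D \<subseteq> F \<Longrightarrow> zero_fill A D (restrict c F) = zero_fill A D c"
  by (auto simp: zero_fill_def fun_eq_iff restrict_def)

lemma restrict_restrict_subset: "F \<subseteq> D \<Longrightarrow> restrict (restrict c D) F = restrict c F"
  by (simp add: inf_absorb2)

lemma restrict_zero_fill_subset: "S \<subseteq> A \<Longrightarrow> restrict (zero_fill A D i) S = zero_fill S D i"
  by (auto simp: zero_fill_def fun_eq_iff restrict_def)

lemma zero_fill_support:
  "c \<in> extensional A \<Longrightarrow> zero_fill A (support A c) c = c"
  by (auto simp: zero_fill_def support_def fun_eq_iff restrict_def extensional_def)

lemma zero_fill_empty: "zero_fill A {} i = zero_cell A"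
  by (simp add: zero_fill_def zero_cell_def)

lemma support_zero_cell: "support A (zero_cell A) = {}"
  by (simp add: support_def zero_cell_def)

lemma cells_extensional: "c \<in> cells L A \<Longrightarrow> c \<in> extensional A"
  by (simp add: cells_def PiE_def)

lemma cells_star_extensional: "c \<in> cells_star L A \<Longrightarrow> c \<in> extensional A"
  by (simp add: cells_star_def PiE_def)

lemma restrict_cells: "c \<in> cells L A \<Longrightarrow> F \<subseteq> A \<Longrightarrow> restrict c F \<in> cells L F"
  by (auto simp: cells_def)

lemma restrict_cells_star: "j \<in> cells_star L F \<Longrightarrow> D \<subseteq> F \<Longrightarrow> restrict j D \<in> cells_star L D"
  by (auto simp: cells_star_def)

lemma restrict_mem_cells_star_iff:
  "c \<in> cells L A \<Longrightarrow> F \<subseteq> A \<Longrightarrow> restrict c F \<in> cells_star L F \<longleftrightarrow> F \<subseteq> support A c"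
  by (auto simp: cells_star_def cells_def support_def PiE_def Pi_def)

lemma support_restrict: "S \<subseteq> A \<Longrightarrow> support S (restrict c S) = support A c \<inter> S"
  by (auto simp: support_def)

lemma full_coords_eq: "full_coords L A = insert ({}, \<lambda>_. undefined) (sub_coords L A)"
  by (auto simp: full_coords_def sub_coords_def cells_star_def)

lemma empty_notin_sub_coords: "({}, i) \<notin> sub_coords L A"
  by (simp add: sub_coords_def)

lemma full_coordsI: "c \<in> cells L A \<Longrightarrow> (support A c, restrict c (support A c)) \<in> full_coords L A"
  using restrict_mem_cells_star_iff[of c L A "support A c"] support_subset[of A c]
  by (auto simp: full_coords_def)

lemma zero_fill_support_restrict: "c \<in> cells L A \<Longrightarrow> zero_fill A (support A c) (restrict c (support A c)) = c"
  by (simp add: zero_fill_restrict zero_fill_support cells_extensional)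

locale finite_levels =
  fixes V :: "'v set" and L :: "'v \<Rightarrow> 'l::zero set"
  assumes finite_V: "finite V" and levels: "\<And>\<gamma>. \<gamma> \<in> V \<Longrightarrow> finite (L \<gamma>) \<and> 0 \<in> L \<gamma>"
begin

lemma finite_sub: "A \<subseteq> V \<Longrightarrow> finite A"
  using finite_V finite_subset by blast

lemma finite_cells: "A \<subseteq> V \<Longrightarrow> finite (cells L A)"
  unfolding cells_def using levels by (intro finite_PiE finite_sub) auto

lemma finite_cells_star: "A \<subseteq> V \<Longrightarrow> finite (cells_star L A)"
  unfolding cells_star_def using levels by (intro finite_PiE finite_sub) auto

lemma finite_full_coords: "A \<subseteq> V \<Longrightarrow> finite (full_coords L A)"
  unfolding full_coords_def using finite_sub[of A] finite_cells_star by (intro finite_SigmaI) auto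

lemma finite_sub_coords: "A \<subseteq> V \<Longrightarrow> finite (sub_coords L A)"
  using finite_full_coords[of A] by (simp add: full_coords_eq)

lemma zero_fill_cells: "D \<subseteq> A \<Longrightarrow> A \<subseteq> V \<Longrightarrow> i \<in> cells L D \<Longrightarrow> zero_fill A D i \<in> cells L A"
  using levels by (auto simp: zero_fill_def cells_def PiE_def Pi_def)

lemma zero_fill_star: "D \<subseteq> A \<Longrightarrow> A \<subseteq> V \<Longrightarrow> i \<in> cells_star L D \<Longrightarrow> zero_fill A D i \<in> cells L A"
  using levels by (auto simp: zero_fill_def cells_def cells_star_def PiE_def Pi_def)

lemma zero_cell_cells: "A \<subseteq> V \<Longrightarrow> zero_cell A \<in> cells L A"
  using levels by (auto simp: zero_cell_def cells_def)

lemma bij_cells: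
  assumes "A \<subseteq> V"
  shows "bij_betw (\<lambda>(D, i). zero_fill A D i) (full_coords L A) (cells L A)"
proof (rule bij_betw_byWitness[where f' = "\<lambda>c. (support A c, restrict c (support A c))"])
  show "\<forall>x\<in>full_coords L A. (\<lambda>c. (support A c, restrict c (support A c))) ((\<lambda>(D, i). zero_fill A D i) x) = x"
    by (auto simp: full_coords_def support_zero_fill restrict_zero_fill)
  show "\<forall>c\<in>cells L A. (\<lambda>(D, i). zero_fill A D i) (support A c, restrict c (support A c)) = c"
    by (simp add: zero_fill_support_restrict)
  show "(\<lambda>(D, i). zero_fill A D i) ` full_coords L A \<subseteq> cells L A"
    using assms by (auto simp: full_coords_def intro: zero_fill_star)
  show "(\<lambda>c. (support A c, restrict c (support A c))) ` cells L A \<subseteq> full_coords L A"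
    by (auto intro: full_coordsI)
qed

lemma sum_cells:
  assumes "A \<subseteq> V"
  shows "(\<Sum>c\<in>cells L A. f c) = f (zero_cell A) + (\<Sum>(D, i)\<in>sub_coords L A. f (zero_fill A D i))"
  using sum.reindex_bij_betw[OF bij_cells[OF assms], of f] finite_sub_coords[OF assms]
  by (simp add: full_coords_eq empty_notin_sub_coords zero_fill_empty split_def)

lemma prod_cells:
  assumes "A \<subseteq> V"
  shows "(\<Prod>c\<in>cells L A. f c) = f (zero_cell A) * (\<Prod>(D, i)\<in>sub_coords L A. f (zero_fill A D i))"
  using prod.reindex_bij_betw[OF bij_cells[OF assms], of f] finite_sub_coords[OF assms]
  by (simp add: full_coords_eq empty_notin_sub_coords zero_fill_empty split_def)

text \<open>
  Inclusion-exclusion: \<open>m (F, j)\<close> is the mass of the cells with the nonzero levels \<open>j\<close> on \<open>F\<close>, whatever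
  they are elsewhere, and the alternating sum over \<open>F \<supseteq> D\<close> removes the cells that are nonzero
  somewhere outside \<open>D\<close>.  The formula for the hyperparameters is thus also the one that recovers cell
  probabilities from marginal probabilities.
\<close>
lemma induced_hyper_marginals:
  assumes A: "A \<subseteq> V" and D: "D \<subseteq> A" and i: "i \<in> cells_star L D"
    and m: "\<And>F j. D \<subseteq> F \<Longrightarrow> F \<subseteq> A \<Longrightarrow> j \<in> cells_star L F \<Longrightarrow> m (F, j) = (\<Sum>c | c \<in> cells L A \<and> restrict c F = j. u c)"
  shows "induced_hyper L m A (D, i) = u (zero_fill A D i)"
proof -
  let ?C = "cells L A"
  have finA: "finite A" and finC: "finite ?C" using A by (auto intro: finite_sub finite_cells)
  have finF: "finite {F. D \<subseteq> F \<and> F \<subseteq> A}" using finA by auto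
  have inner: "(\<Sum>j | j \<in> cells_star L F \<and> restrict j D = i. (-1) ^ card (F - D) * m (F, j))
     = (\<Sum>c\<in>?C. if F \<subseteq> support A c \<and> restrict c D = i then (-1) ^ card (F - D) * u c else 0)"
    if F: "D \<subseteq> F" "F \<subseteq> A" for F
  proof -
    let ?T = "{j. j \<in> cells_star L F \<and> restrict j D = i}"
    have fT: "finite ?T" using finite_cells_star[of F] F A by auto
    have "(\<Sum>j\<in>?T. (-1) ^ card (F - D) * m (F, j))
        = (\<Sum>j\<in>?T. \<Sum>c | c \<in> ?C \<and> restrict c F = j. (-1) ^ card (F - D) * u c)"
      using F by (intro sum.cong) (auto simp: m sum_distrib_left)
    also have "\<dots> = (\<Sum>c | c \<in> ?C \<and> restrict c F \<in> ?T. (-1) ^ card (F - D) * u c)"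
      by (rule sum_fibres[OF finC fT])
    also have "\<dots> = (\<Sum>c\<in>?C. if restrict c F \<in> ?T then (-1) ^ card (F - D) * u c else 0)"
      by (rule sum.inter_filter[OF finC])
    also have "\<dots> = (\<Sum>c\<in>?C. if F \<subseteq> support A c \<and> restrict c D = i then (-1) ^ card (F - D) * u c else 0)"
      using F restrict_mem_cells_star_iff[of _ L A F] by (intro sum.cong) (auto simp: inf_absorb2)
    finally show ?thesis .
  qed
  have outer: "(\<Sum>F | D \<subseteq> F \<and> F \<subseteq> A. if F \<subseteq> support A c \<and> restrict c D = i then (-1) ^ card (F - D) * u c else 0)
      = (if c = zero_fill A D i then u c else 0)" if c: "c \<in> ?C" for c
  proof -
    let ?E = "support A c"
    have finE: "finite ?E" by (rule finite_subset[OF support_subset finA])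
    have eqc: "c = zero_fill A D i \<longleftrightarrow> D = ?E \<and> restrict c D = i"
      using c zero_fill_support_restrict[OF c] support_zero_fill[OF D i] restrict_zero_fill[OF D i] by metis
    have "(\<Sum>F | D \<subseteq> F \<and> F \<subseteq> A. if F \<subseteq> ?E \<and> restrict c D = i then (-1) ^ card (F - D) * u c else 0)
       = (\<Sum>F | (D \<subseteq> F \<and> F \<subseteq> A) \<and> (F \<subseteq> ?E \<and> restrict c D = i). (-1) ^ card (F - D) * u c)"
      using sum.inter_filter[OF finF, of "\<lambda>F. (-1) ^ card (F - D) * u c" "\<lambda>F. F \<subseteq> ?E \<and> restrict c D = i"]
      by simp
    also have "\<dots> = (if restrict c D = i then (\<Sum>F | D \<subseteq> F \<and> F \<subseteq> ?E. (-1) ^ card (F - D)) * u c else 0)"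
      using support_subset[of A c] by (auto simp: sum_distrib_right intro!: sum.cong)
    also have "\<dots> = (if c = zero_fill A D i then u c else 0)"
    proof (cases "D \<subseteq> ?E")
      case True
      then show ?thesis using alternating_sum_interval[OF finE True] eqc by auto
    next
      case False
      then have "{F. D \<subseteq> F \<and> F \<subseteq> ?E} = {}" by auto
      moreover have "c \<noteq> zero_fill A D i" using False eqc by blast
      ultimately show ?thesis by (simp only: sum.empty if_False mult_zero_left if_cancel)
    qed
    finally show ?thesis .
  qed
  have "induced_hyper L m A (D, i) = (\<Sum>F | D \<subseteq> F \<and> F \<subseteq> A. \<Sum>c\<in>?C. if F \<subseteq> support A c \<and> restrict c D = i then (-1) ^ card (F - D) * u c else 0)"
    unfolding induced_hyper_def prod.case
  proof (rule sum.cong[OF refl])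
    fix F assume "F \<in> {F. D \<subseteq> F \<and> F \<subseteq> A}"
    then show "(\<Sum>j | j \<in> cells_star L F \<and> restrict j D = i. (-1) ^ card (F - D) * m (F, j))
     = (\<Sum>c\<in>?C. if F \<subseteq> support A c \<and> restrict c D = i then (-1) ^ card (F - D) * u c else 0)"
      by (intro inner) auto
  qed
  also have "\<dots> = (\<Sum>c\<in>?C. if c = zero_fill A D i then u c else 0)"
    by (subst sum.swap) (intro sum.cong refl outer)
  also have "\<dots> = u (zero_fill A D i)"
    using finC zero_fill_star[OF D A i] by simp
  finally show ?thesis .
qed

definition table_hyper :: "(('v, 'l) coord \<Rightarrow> real) \<Rightarrow> 'v set \<Rightarrow> ('v \<Rightarrow> 'l) \<Rightarrow> real" where
  "table_hyper s A c = induced_hyper L s A (support A c, restrict c (support A c))"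

lemma table_hyper_zero_fill:
  "D \<subseteq> A \<Longrightarrow> i \<in> cells_star L D \<Longrightarrow> table_hyper s A (zero_fill A D i) = induced_hyper L s A (D, i)"
  by (simp add: table_hyper_def support_zero_fill restrict_zero_fill)

text \<open>
  Taking the term \<open>F = D\<close> out shows that inclusion-exclusion is unitriangular with respect to the
  inclusion of faces.
\<close>
lemma induced_hyper_split:
  assumes A: "A \<subseteq> V" and D: "D \<subseteq> A" and i: "i \<in> cells_star L D"
  shows "induced_hyper L m A (D, i)
    = m (D, i) + (\<Sum>F | D \<subset> F \<and> F \<subseteq> A. \<Sum>j | j \<in> cells_star L F \<and> restrict j D = i. (-1) ^ card (F - D) * m (F, j))"
proof -
  have faces: "{F. D \<subseteq> F \<and> F \<subseteq> A} = insert D {F. D \<subset> F \<and> F \<subseteq> A}" using D by auto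
  have fin: "finite {F. D \<subset> F \<and> F \<subseteq> A}" by (rule finite_subset[of _ "Pow A"]) (use finite_sub[OF A] in auto)
  have "restrict j D = j" if "j \<in> cells_star L D" for j
    using cells_star_extensional[OF that] by (rule extensional_restrict)
  then have "{j. j \<in> cells_star L D \<and> restrict j D = i} = {i}" using i by auto
  then show ?thesis unfolding induced_hyper_def prod.case faces by (subst sum.insert[OF fin]) auto
qed

lemma induced_hyper_inject:
  assumes A: "A \<subseteq> V"
    and eq: "\<And>x. x \<in> full_coords L A \<Longrightarrow> induced_hyper L m A x = induced_hyper L m' A x"
  shows "x \<in> full_coords L A \<Longrightarrow> m x = m' x"
proof (induction "card (A - fst x)" arbitrary: x rule: less_induct)
  case less
  obtain D i where x: "x = (D, i)" and D: "D \<subseteq> A" and i: "i \<in> cells_star L D"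
    using less.prems by (auto simp: full_coords_def)
  have "m (F, j) = m' (F, j)" if F: "D \<subset> F" "F \<subseteq> A" and j: "j \<in> cells_star L F" for F j
  proof (rule less.hyps)
    have "A - F \<subset> A - D" using F by blast
    then show "card (A - fst (F, j)) < card (A - fst x)"
      using finite_sub[OF A] by (simp add: x psubset_card_mono)
  qed (use F j in \<open>simp add: full_coords_def\<close>)
  then have "(\<Sum>F | D \<subset> F \<and> F \<subseteq> A. \<Sum>j | j \<in> cells_star L F \<and> restrict j D = i. (-1) ^ card (F - D) * m (F, j))
      = (\<Sum>F | D \<subset> F \<and> F \<subseteq> A. \<Sum>j | j \<in> cells_star L F \<and> restrict j D = i. (-1) ^ card (F - D) * m' (F, j))"
    by (intro sum.cong refl) auto
  then show ?case using eq[OF less.prems] unfolding x induced_hyper_split[OF A D i] by simp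
qed

text \<open>
  The converse of \<open>induced_hyper_marginals\<close>.  The marginal sums on the left and \<open>s\<close> have the same
  image under inclusion-exclusion, which is injective.
\<close>
lemma sum_table_hyper:
  assumes A: "A \<subseteq> V" and F: "F \<subseteq> A" and j: "j \<in> cells_star L F"
  shows "(\<Sum>c | c \<in> cells L A \<and> restrict c F = j. table_hyper s A c) = s (F, j)"
proof -
  define m where "m = (\<lambda>(F, j). \<Sum>c | c \<in> cells L A \<and> restrict c F = j. table_hyper s A c)"
  have "m (F, j) = s (F, j)"
  proof (rule induced_hyper_inject[OF A])
    fix x assume "x \<in> full_coords L A"
    then obtain D i where x: "x = (D, i)" and D: "D \<subseteq> A" and i: "i \<in> cells_star L D" by (auto simp: full_coords_def)
    have "induced_hyper L m A (D, i) = table_hyper s A (zero_fill A D i)"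
      by (rule induced_hyper_marginals[OF A D i]) (simp add: m_def)
    also have "\<dots> = induced_hyper L s A (D, i)" by (rule table_hyper_zero_fill[OF D i])
    finally show "induced_hyper L m A x = induced_hyper L s A x" by (simp only: x)
  qed (use F j in \<open>simp add: full_coords_def\<close>)
  then show ?thesis by (simp add: m_def)
qed

text \<open>
  If the logarithm of the probability of a cell is a sum of \<open>\<phi>\<close> over the faces of its support, this
  expresses the linear form of an exponential family by cell probabilities; the hyperparameters are
  the exponents.
\<close>
lemma table_hyper_pairing:
  assumes A: "A \<subseteq> V"
  shows "(\<Sum>c\<in>cells L A. table_hyper s A c * (\<Sum>F | F \<subseteq> support A c. \<phi> (F, restrict c F)))
       = (\<Sum>x\<in>full_coords L A. \<phi> x * s x)"
proof -
  let ?C = "cells L A"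
  have finA: "finite A" and finC: "finite ?C" using A by (auto intro: finite_sub finite_cells)
  have "(\<Sum>c\<in>?C. table_hyper s A c * (\<Sum>F | F \<subseteq> support A c. \<phi> (F, restrict c F)))
      = (\<Sum>c\<in>?C. \<Sum>F\<in>Pow A. if F \<subseteq> support A c then \<phi> (F, restrict c F) * table_hyper s A c else 0)"
  proof (rule sum.cong[OF refl])
    fix c assume "c \<in> ?C"
    have "(\<Sum>F | F \<subseteq> support A c. \<phi> (F, restrict c F)) = (\<Sum>F | F \<in> Pow A \<and> F \<subseteq> support A c. \<phi> (F, restrict c F))"
      using support_subset[of A c] by (intro sum.cong) auto
    then show "table_hyper s A c * (\<Sum>F | F \<subseteq> support A c. \<phi> (F, restrict c F))
        = (\<Sum>F\<in>Pow A. if F \<subseteq> support A c then \<phi> (F, restrict c F) * table_hyper s A c else 0)"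
      using finA by (simp only: sum.inter_filter[symmetric] finite_Pow_iff sum_distrib_left mult.commute)
  qed
  also have "\<dots> = (\<Sum>F\<in>Pow A. \<Sum>c\<in>?C. if F \<subseteq> support A c then \<phi> (F, restrict c F) * table_hyper s A c else 0)"
    by (rule sum.swap)
  also have "\<dots> = (\<Sum>F\<in>Pow A. \<Sum>j\<in>cells_star L F. \<phi> (F, j) * s (F, j))"
  proof (rule sum.cong[OF refl])
    fix F assume F: "F \<in> Pow A"
    have finS: "finite (cells_star L F)" using F A by (intro finite_cells_star) auto
    have "(\<Sum>c\<in>?C. if F \<subseteq> support A c then \<phi> (F, restrict c F) * table_hyper s A c else 0)
        = (\<Sum>c | c \<in> ?C \<and> F \<subseteq> support A c. \<phi> (F, restrict c F) * table_hyper s A c)"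
      by (rule sum.inter_filter[OF finC, symmetric])
    also have "\<dots> = (\<Sum>c | c \<in> ?C \<and> restrict c F \<in> cells_star L F. \<phi> (F, restrict c F) * table_hyper s A c)"
      using F restrict_mem_cells_star_iff[of _ L A F] by (intro sum.cong) auto
    also have "\<dots> = (\<Sum>j\<in>cells_star L F. \<Sum>c | c \<in> ?C \<and> restrict c F = j. \<phi> (F, restrict c F) * table_hyper s A c)"
      by (rule sum_fibres[OF finC finS, symmetric])
    also have "\<dots> = (\<Sum>j\<in>cells_star L F. \<phi> (F, j) * (\<Sum>c | c \<in> ?C \<and> restrict c F = j. table_hyper s A c))"
      by (simp add: sum_distrib_left)
    also have "\<dots> = (\<Sum>j\<in>cells_star L F. \<phi> (F, j) * s (F, j))"
      using F by (intro sum.cong) (auto simp: sum_table_hyper[OF A])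
    finally show "(\<Sum>c\<in>?C. if F \<subseteq> support A c then \<phi> (F, restrict c F) * table_hyper s A c else 0)
        = (\<Sum>j\<in>cells_star L F. \<phi> (F, j) * s (F, j))" .
  qed
  also have "\<dots> = (\<Sum>x\<in>full_coords L A. \<phi> x * s x)"
    unfolding full_coords_def
    by (subst sum.Sigma) (use finA A in \<open>auto intro!: finite_cells_star sum.cong\<close>)
  finally show ?thesis .
qed

text \<open>
  Both sides are tables on \<open>S\<close> with the marginal sums \<open>s\<close>.  Consequently the hyperparameters of a
  subset do not depend on the table from which they are computed.
\<close>
lemma sum_table_hyper_fibre:
  assumes A: "A \<subseteq> V" and S: "S \<subseteq> A" and b: "b \<in> cells L S"
  shows "(\<Sum>c | c \<in> cells L A \<and> restrict c S = b. table_hyper s A c) = table_hyper s S b"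
proof -
  have SV: "S \<subseteq> V" using A S by auto
  let ?u = "\<lambda>b. \<Sum>c | c \<in> cells L A \<and> restrict c S = b. table_hyper s A c"
  have "induced_hyper L s S (support S b, restrict b (support S b)) = ?u (zero_fill S (support S b) (restrict b (support S b)))"
  proof (rule induced_hyper_marginals[OF SV support_subset])
    show "restrict b (support S b) \<in> cells_star L (support S b)"
      using restrict_mem_cells_star_iff[OF b support_subset[of S b]] by simp
    fix F j assume F: "support S b \<subseteq> F" "F \<subseteq> S" and j: "j \<in> cells_star L F"
    have "(\<Sum>b | b \<in> cells L S \<and> restrict b F = j. ?u b)
       = (\<Sum>c | c \<in> cells L A \<and> restrict c S \<in> {b. b \<in> cells L S \<and> restrict b F = j}. table_hyper s A c)"
      by (rule sum_fibres) (use finite_cells[OF A] finite_cells[OF SV] in auto)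
    also have "{c. c \<in> cells L A \<and> restrict c S \<in> {b. b \<in> cells L S \<and> restrict b F = j}} = {c. c \<in> cells L A \<and> restrict c F = j}"
      using F S by (auto simp: restrict_cells inf_absorb2)
    also have "(\<Sum>c\<in>\<dots>. table_hyper s A c) = s (F, j)"
      using sum_table_hyper[OF A _ j] F S by auto
    finally show "s (F, j) = (\<Sum>b | b \<in> cells L S \<and> restrict b F = j. ?u b)" by (rule sym)
  qed
  then show ?thesis by (simp add: table_hyper_def[symmetric] zero_fill_support_restrict[OF b])
qed

text \<open>
  The coefficients of the expansion of a function \<open>\<phi>\<close> of the \<open>S\<close>-cells over the faces of their
  supports (\<open>sum_interaction\<close>).
\<close>
definition interaction :: "'v set \<Rightarrow> (('v \<Rightarrow> 'l) \<Rightarrow> real) \<Rightarrow> ('v, 'l) coord \<Rightarrow> real" where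
  "interaction S \<phi> = (\<lambda>(D, i). \<Sum>F | F \<subseteq> D. (-1) ^ card (D - F) * \<phi> (zero_fill S F i))"

lemma interaction_empty: "interaction S \<phi> ({}, i) = \<phi> (zero_cell S)"
  by (simp add: interaction_def zero_fill_empty)

lemma sum_interaction:
  assumes S: "S \<subseteq> V" and b: "b \<in> cells L S"
  shows "(\<Sum>D | D \<subseteq> support S b. interaction S \<phi> (D, restrict b D)) = \<phi> b"
proof -
  let ?E = "support S b"
  have finE: "finite ?E" by (rule finite_sub[OF order_trans[OF support_subset S]])
  have "(\<Sum>D | D \<subseteq> ?E. interaction S \<phi> (D, restrict b D))
      = (\<Sum>D\<in>Pow ?E. \<Sum>F\<in>Pow ?E. if F \<subseteq> D then (-1) ^ card (D - F) * \<phi> (zero_fill S F b) else 0)"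
  proof (rule sum.cong)
    fix D assume D: "D \<in> Pow ?E"
    have "interaction S \<phi> (D, restrict b D) = (\<Sum>F | F \<in> Pow ?E \<and> F \<subseteq> D. (-1) ^ card (D - F) * \<phi> (zero_fill S F b))"
      unfolding interaction_def prod.case
    proof (rule sum.cong)
      show "{F. F \<subseteq> D} = {F \<in> Pow ?E. F \<subseteq> D}" using D by auto
    next
      fix F assume "F \<in> {F \<in> Pow ?E. F \<subseteq> D}"
      then have "zero_fill S F (restrict b D) = zero_fill S F b" by (intro zero_fill_restrict) simp
      then show "(-1) ^ card (D - F) * \<phi> (zero_fill S F (restrict b D)) = (-1) ^ card (D - F) * \<phi> (zero_fill S F b)"
        by (simp only:)
    qed
    also have "\<dots> = (\<Sum>F\<in>Pow ?E. if F \<subseteq> D then (-1) ^ card (D - F) * \<phi> (zero_fill S F b) else 0)"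
      by (rule sum.inter_filter) (simp add: finE)
    finally show "interaction S \<phi> (D, restrict b D) = (\<Sum>F\<in>Pow ?E. if F \<subseteq> D then (-1) ^ card (D - F) * \<phi> (zero_fill S F b) else 0)" .
  qed auto
  also have "\<dots> = (\<Sum>F\<in>Pow ?E. \<Sum>D\<in>Pow ?E. if F \<subseteq> D then (-1) ^ card (D - F) * \<phi> (zero_fill S F b) else 0)"
    by (rule sum.swap)
  also have "\<dots> = (\<Sum>F\<in>Pow ?E. (\<Sum>D | F \<subseteq> D \<and> D \<subseteq> ?E. (-1) ^ card (D - F)) * \<phi> (zero_fill S F b))"
  proof (rule sum.cong[OF refl])
    fix F assume "F \<in> Pow ?E"
    have "(\<Sum>D\<in>Pow ?E. if F \<subseteq> D then (-1) ^ card (D - F) * \<phi> (zero_fill S F b) else 0)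
       = (\<Sum>D | D \<in> Pow ?E \<and> F \<subseteq> D. (-1) ^ card (D - F) * \<phi> (zero_fill S F b))"
      by (rule sum.inter_filter[symmetric]) (simp add: finE)
    also have "\<dots> = (\<Sum>D | F \<subseteq> D \<and> D \<subseteq> ?E. (-1) ^ card (D - F)) * \<phi> (zero_fill S F b)"
      by (auto simp: sum_distrib_right intro!: sum.cong)
    finally show "(\<Sum>D\<in>Pow ?E. if F \<subseteq> D then (-1) ^ card (D - F) * \<phi> (zero_fill S F b) else 0)
       = (\<Sum>D | F \<subseteq> D \<and> D \<subseteq> ?E. (-1) ^ card (D - F)) * \<phi> (zero_fill S F b)" .
  qed
  also have "\<dots> = (\<Sum>F\<in>Pow ?E. if F = ?E then \<phi> (zero_fill S F b) else 0)"
  proof (rule sum.cong[OF refl])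
    fix F assume "F \<in> Pow ?E"
    then show "(\<Sum>D | F \<subseteq> D \<and> D \<subseteq> ?E. (-1) ^ card (D - F)) * \<phi> (zero_fill S F b)
       = (if F = ?E then \<phi> (zero_fill S F b) else 0)"
      using alternating_sum_interval[OF finE, of F] by (simp only: Pow_iff) simp
  qed
  also have "\<dots> = \<phi> b"
    using finE by (simp add: zero_fill_support cells_extensional[OF b])
  finally show ?thesis .
qed

end

section \<open>Adding a clique to a log-linear model\<close>

text \<open>
  The log-linear model on the vertex set \<open>U\<close> generated by the faces \<open>\<D>\<close>.  Vertex set and faces are
  parameters because the models of the initial segments of a perfect order have to be compared.
\<close>
definition weight :: "'v set set \<Rightarrow> 'v set \<Rightarrow> (('v, 'l::zero) coord \<Rightarrow> real) \<Rightarrow> ('v \<Rightarrow> 'l) \<Rightarrow> real" where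
  "weight \<D> U \<theta> j = exp (\<Sum>F | F \<in> \<D> \<and> F \<subseteq> support U j. \<theta> (F, restrict j F))"

definition normalizer ::
  "('v \<Rightarrow> 'l::zero set) \<Rightarrow> 'v set set \<Rightarrow> 'v set \<Rightarrow> (('v, 'l) coord \<Rightarrow> real) \<Rightarrow> real" where
  "normalizer L \<D> U \<theta> = (\<Sum>j\<in>cells L U. weight \<D> U \<theta> j)"

definition marginal ::
  "('v \<Rightarrow> 'l::zero set) \<Rightarrow> 'v set set \<Rightarrow> 'v set \<Rightarrow> (('v, 'l) coord \<Rightarrow> real) \<Rightarrow> 'v set \<Rightarrow> ('v \<Rightarrow> 'l) \<Rightarrow> real" where
  "marginal L \<D> U \<theta> A a = (\<Sum>j | j \<in> cells L U \<and> restrict j A = a. weight \<D> U \<theta> j) / normalizer L \<D> U \<theta>"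

definition star_coords :: "('v \<Rightarrow> 'l::zero set) \<Rightarrow> 'v set set \<Rightarrow> ('v, 'l) coord set" where
  "star_coords L \<D> = (SIGMA F:\<D>. cells_star L F)"

definition model_kernel ::
  "('v \<Rightarrow> 'l::zero set) \<Rightarrow> 'v set set \<Rightarrow> 'v set \<Rightarrow> (('v, 'l) coord \<Rightarrow> real) \<Rightarrow> real \<Rightarrow> (('v, 'l) coord \<Rightarrow> real) \<Rightarrow> real" where
  "model_kernel L \<D> U s \<alpha> \<theta> = exp ((\<Sum>x\<in>star_coords L \<D>. \<theta> x * s x) - \<alpha> * ln (normalizer L \<D> U \<theta>))"

text \<open>
  With \<open>\<alpha>\<close> at the empty face the hyperparameter of the all-zero cell is no exception to the formula
  for the others.
\<close>
definition extend_hyper :: "(('v, 'l) coord \<Rightarrow> real) \<Rightarrow> real \<Rightarrow> ('v, 'l) coord \<Rightarrow> real" where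
  "extend_hyper s \<alpha> = (\<lambda>(D, i). if D = {} then \<alpha> else s (D, i))"

lemma weight_pos: "0 < weight \<D> U \<theta> j"
  by (simp add: weight_def)

text \<open>
  A cell over the union of two sets is a pair of cells that agree on the intersection.
\<close>
lemma bij_glue:
  assumes a: "a \<in> cells L X"
  shows "bij_betw (\<lambda>j. restrict j Y) {j \<in> cells L (X \<union> Y). restrict j X = a}
           {c \<in> cells L Y. restrict c (X \<inter> Y) = restrict a (X \<inter> Y)}"
proof (rule bij_betw_byWitness[where f' = "\<lambda>c. \<lambda>\<gamma>\<in>X \<union> Y. if \<gamma> \<in> X then a \<gamma> else c \<gamma>"])
  show "\<forall>j\<in>{j \<in> cells L (X \<union> Y). restrict j X = a}. (\<lambda>\<gamma>\<in>X \<union> Y. if \<gamma> \<in> X then a \<gamma> else restrict j Y \<gamma>) = j"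
    by (auto simp: fun_eq_iff cells_def PiE_def extensional_def restrict_def)
  show "\<forall>c\<in>{c \<in> cells L Y. restrict c (X \<inter> Y) = restrict a (X \<inter> Y)}.
     restrict (\<lambda>\<gamma>\<in>X \<union> Y. if \<gamma> \<in> X then a \<gamma> else c \<gamma>) Y = c"
    by (auto simp: fun_eq_iff cells_def PiE_def extensional_def restrict_def)
  show "(\<lambda>j. restrict j Y) ` {j \<in> cells L (X \<union> Y). restrict j X = a} \<subseteq> {c \<in> cells L Y. restrict c (X \<inter> Y) = restrict a (X \<inter> Y)}"
    by (auto simp: restrict_cells Int_commute)
  show "(\<lambda>c. \<lambda>\<gamma>\<in>X \<union> Y. if \<gamma> \<in> X then a \<gamma> else c \<gamma>) ` {c \<in> cells L Y. restrict c (X \<inter> Y) = restrict a (X \<inter> Y)}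
      \<subseteq> {j \<in> cells L (X \<union> Y). restrict j X = a}"
    using a by (auto simp: cells_def PiE_def Pi_def extensional_def fun_eq_iff restrict_def)
qed

context finite_levels
begin

lemma cells_nonempty: "A \<subseteq> V \<Longrightarrow> cells L A \<noteq> {}"
  using zero_cell_cells by blast

lemma normalizer_pos: "U \<subseteq> V \<Longrightarrow> 0 < normalizer L \<D> U \<theta>"
  unfolding normalizer_def by (intro sum_pos finite_cells cells_nonempty weight_pos)

lemma marginal_pos:
  assumes U: "U \<subseteq> V" and A: "A \<subseteq> U" and a: "a \<in> cells L A"
  shows "0 < marginal L \<D> U \<theta> A a"
proof -
  have "zero_fill U A a \<in> cells L U \<and> restrict (zero_fill U A a) A = a"
    using zero_fill_cells[OF A U a] cells_extensional[OF a] A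
    by (auto simp: zero_fill_def fun_eq_iff restrict_def extensional_def)
  then have "{j. j \<in> cells L U \<and> restrict j A = a} \<noteq> {}" by blast
  then show ?thesis
    unfolding marginal_def
    by (intro divide_pos_pos sum_pos normalizer_pos weight_pos U) (use finite_cells[OF U] in auto)
qed

end

text \<open>
  \<open>H\<close> is the set of the vertices covered so far and \<open>\<D>\<close> the set of faces of the model on \<open>H\<close>; the
  clique \<open>C\<close> is to be added.  The last assumption, which the running intersection property
  provides, is what allows the effect of \<open>C\<close> on the \<open>H\<close>-marginal to be absorbed.
\<close>
locale gluing = finite_levels V L for V :: "'v set" and L :: "'v \<Rightarrow> 'l::zero set" +
  fixes \<D> :: "'v set set" and H C :: "'v set"
  assumes H: "H \<subseteq> V" and C: "C \<subseteq> V"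
    and old_sets: "\<D> \<subseteq> Pow H - {{}}"
    and sep_sets: "\<And>F. F \<subseteq> C \<inter> H \<Longrightarrow> F \<noteq> {} \<Longrightarrow> F \<in> \<D>"
begin

abbreviation S :: "'v set" where "S \<equiv> C \<inter> H"

abbreviation new_sets :: "'v set set" where "new_sets \<equiv> {F. F \<subseteq> C \<and> \<not> F \<subseteq> H}"

abbreviation old :: "('v, 'l) coord set" where "old \<equiv> star_coords L \<D>"

abbreviation new :: "('v, 'l) coord set" where "new \<equiv> star_coords L new_sets"

text \<open>
  A new coordinate \<open>x\<close> stands for the \<open>C\<close>-cell \<open>fill x\<close>; its block is the restriction \<open>sep x\<close> of this
  cell to \<open>S\<close>.  The reference member of the block \<open>b\<close> is the cell \<open>zero_fill C S b\<close>.
\<close>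
definition fill :: "('v, 'l) coord \<Rightarrow> 'v \<Rightarrow> 'l" where
  "fill = (\<lambda>(F, j). zero_fill C F j)"

definition sep :: "('v, 'l) coord \<Rightarrow> 'v \<Rightarrow> 'l" where
  "sep = (\<lambda>(F, j). zero_fill S F j)"

definition log_odds :: "(('v, 'l) coord \<Rightarrow> real) \<Rightarrow> ('v, 'l) coord \<Rightarrow> real" where
  "log_odds \<theta> = (\<lambda>(F, j). \<Sum>F' | F' \<subseteq> F \<and> \<not> F' \<subseteq> H. \<theta> (F', restrict j F'))"

abbreviation total :: "(('v, 'l) coord \<Rightarrow> real) \<Rightarrow> ('v \<Rightarrow> 'l) \<Rightarrow> real" where
  "total \<theta> \<equiv> odds_total new sep (log_odds \<theta>)"

text \<open>
  The old parameter modified by the effect of summing out \<open>C - H\<close>, which is the factor \<open>total \<theta>\<close> on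
  the \<open>S\<close>-cells.
\<close>
definition absorb :: "(('v, 'l) coord \<Rightarrow> real) \<Rightarrow> ('v, 'l) coord \<Rightarrow> real" where
  "absorb \<theta> x = \<theta> x + (if fst x \<subseteq> S then interaction S (\<lambda>b. ln (total \<theta> b)) x else 0)"

text \<open>
  The odds of a \<open>C\<close>-cell within its block: the part of its weight that is due to the new faces.
\<close>
definition clique_factor :: "(('v, 'l) coord \<Rightarrow> real) \<Rightarrow> ('v \<Rightarrow> 'l) \<Rightarrow> real" where
  "clique_factor \<theta> c = exp (\<Sum>F | F \<subseteq> support C c \<and> \<not> F \<subseteq> H. \<theta> (F, restrict c F))"

lemma S_subsets: "S \<subseteq> V" "S \<subseteq> C" "S \<subseteq> H" using C by auto

lemma U: "H \<union> C \<subseteq> V" using H C by auto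

lemma finite_new_sets: "finite new_sets" "finite \<D>"
proof -
  have "new_sets \<subseteq> Pow C" "\<D> \<subseteq> Pow H" using old_sets by auto
  then show "finite new_sets" "finite \<D>"
    using finite_sub[OF C] finite_sub[OF H] by (metis finite_Pow_iff finite_subset)+
qed

lemma finite_old: "finite old" and finite_new: "finite new"
  unfolding star_coords_def using finite_new_sets old_sets H C
  by (auto intro!: finite_SigmaI finite_cells_star)

lemma old_new_disjoint: "old \<inter> new = {}" "\<D> \<inter> new_sets = {}"
  using old_sets by (auto simp: star_coords_def)

lemma star_coords_Un: "star_coords L (\<D> \<union> new_sets) = old \<union> new"
  by (auto simp: star_coords_def)

lemma full_coords_split: "full_coords L C = new \<union> full_coords L S" "new \<inter> full_coords L S = {}"
  by (auto simp: full_coords_def star_coords_def)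

lemma cells_split:
  "cells L C = fill ` new \<union> zero_fill C S ` cells L S" "fill ` new \<inter> zero_fill C S ` cells L S = {}"
  "inj_on fill new" "inj_on (zero_fill C S) (cells L S)"
proof -
  have bij: "bij_betw fill (full_coords L C) (cells L C)" using bij_cells[OF C] by (simp add: fill_def)
  have fill_sep: "fill ` full_coords L S = zero_fill C S ` cells L S"
  proof -
    have "fill x = zero_fill C S ((\<lambda>(D, i). zero_fill S D i) x)" if "x \<in> full_coords L S" for x
      using that by (auto simp: fill_def full_coords_def zero_fill_def fun_eq_iff restrict_def)
    then have "fill ` full_coords L S = zero_fill C S ` (\<lambda>(D, i). zero_fill S D i) ` full_coords L S"
      by (simp add: image_image)
    then show ?thesis using bij_cells[OF S_subsets(1)] by (simp add: bij_betw_def)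
  qed
  show "cells L C = fill ` new \<union> zero_fill C S ` cells L S"
    using bij by (simp add: bij_betw_def full_coords_split(1) image_Un fill_sep)
  show "inj_on fill new" using bij unfolding bij_betw_def full_coords_split(1) by (simp add: inj_on_Un)
  have "inj_on fill (new \<union> full_coords L S)" using bij by (simp only: bij_betw_def full_coords_split(1))
  then have "fill ` new \<inter> fill ` full_coords L S = fill ` (new \<inter> full_coords L S)"
    by (rule inj_on_image_Int[symmetric]) simp_all
  then show "fill ` new \<inter> zero_fill C S ` cells L S = {}"
    by (simp only: fill_sep full_coords_split(2) image_empty)
  show "inj_on (zero_fill C S) (cells L S)"
    by (rule inj_on_inverseI[of _ "\<lambda>c. restrict c S"])
      (auto simp: zero_fill_def fun_eq_iff restrict_def cells_def PiE_def extensional_def)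
qed

lemma sum_cells_split:
  "(\<Sum>c\<in>cells L C. f c) = (\<Sum>b\<in>cells L S. f (zero_fill C S b)) + (\<Sum>x\<in>new. (f (fill x) :: real))"
  unfolding cells_split(1)
  by (subst sum.union_disjoint[OF _ _ cells_split(2)])
    (simp_all add: finite_new finite_cells[OF S_subsets(1)] sum.reindex cells_split(3,4) add.commute)

lemma prod_cells_split:
  "(\<Prod>c\<in>cells L C. f c) = (\<Prod>b\<in>cells L S. f (zero_fill C S b)) * (\<Prod>x\<in>new. (f (fill x) :: real))"
  unfolding cells_split(1)
  by (subst prod.union_disjoint[OF _ _ cells_split(2)])
    (simp_all add: finite_new finite_cells[OF S_subsets(1)] prod.reindex cells_split(3,4) mult.commute)

lemma restrict_fill: "x \<in> new \<Longrightarrow> restrict (fill x) S = sep x"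
  by (auto simp: fill_def sep_def split_def restrict_zero_fill_subset)

lemma restrict_ext: "b \<in> cells L S \<Longrightarrow> restrict (zero_fill C S b) S = b"
  by (auto simp: zero_fill_def fun_eq_iff restrict_def cells_def PiE_def extensional_def)

lemma sum_fibre_split:
  assumes b: "b \<in> cells L S"
  shows "(\<Sum>c | c \<in> cells L C \<and> restrict c S = b. f c) = f (zero_fill C S b) + (\<Sum>x | x \<in> new \<and> sep x = b. (f (fill x) :: real))"
proof -
  have finC: "finite (cells L C)" and finS: "finite (cells L S)" using finite_cells[OF C] finite_cells[OF S_subsets(1)] by auto
  have "(\<Sum>c | c \<in> cells L C \<and> restrict c S = b. f c) = (\<Sum>c\<in>cells L C. if restrict c S = b then f c else 0)"
    by (rule sum.inter_filter[OF finC])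
  also have "\<dots> = (\<Sum>b'\<in>cells L S. if b' = b then f (zero_fill C S b') else 0) + (\<Sum>x\<in>new. if sep x = b then f (fill x) else 0)"
    unfolding sum_cells_split by (intro arg_cong2[of _ _ _ _ "(+)"] sum.cong refl) (simp_all only: restrict_ext restrict_fill)
  also have "(\<Sum>b'\<in>cells L S. if b' = b then f (zero_fill C S b') else 0) = f (zero_fill C S b)"
    using finS b by simp
  also have "(\<Sum>x\<in>new. if sep x = b then f (fill x) else 0) = (\<Sum>x | x \<in> new \<and> sep x = b. f (fill x))"
    by (rule sum.inter_filter[OF finite_new, symmetric])
  finally show ?thesis .
qed

lemma sep_cells: "x \<in> new \<Longrightarrow> sep x \<in> cells L S"
proof -
  assume x: "x \<in> new"
  then have "fill x \<in> cells L C" using zero_fill_star[OF _ C] by (auto simp: fill_def star_coords_def)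
  from restrict_cells[OF this S_subsets(2)] show "sep x \<in> cells L S" by (simp only: restrict_fill[OF x])
qed

lemma fill_cells: "x \<in> new \<Longrightarrow> fill x \<in> cells L C"
  using zero_fill_star[OF _ C] by (auto simp: fill_def star_coords_def)

lemma ext_cells: "b \<in> cells L S \<Longrightarrow> zero_fill C S b \<in> cells L C"
  by (rule zero_fill_cells[OF S_subsets(2) C])

lemma clique_factor_fill: "x \<in> new \<Longrightarrow> clique_factor \<theta> (fill x) = exp (log_odds \<theta> x)"
proof -
  assume "x \<in> new"
  then obtain F j where x: "x = (F, j)" and F: "F \<subseteq> C" and j: "j \<in> cells_star L F" by (auto simp: star_coords_def)
  have "restrict (zero_fill C F j) F' = restrict j F'" if "F' \<subseteq> F" for F'
    using restrict_restrict_subset[OF that, of "zero_fill C F j"] restrict_zero_fill[OF F j] by simp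
  then show ?thesis
    by (simp add: clique_factor_def x fill_def log_odds_def support_zero_fill[OF F j] cong: conj_cong)
qed

lemma clique_factor_ext: "clique_factor \<theta> (zero_fill C S b) = 1"
proof -
  have "support C (zero_fill C S b) \<subseteq> S" by (auto simp: support_def zero_fill_def)
  then have "{F. F \<subseteq> support C (zero_fill C S b) \<and> \<not> F \<subseteq> H} = {}" by auto
  then show ?thesis unfolding clique_factor_def by (simp only: sum.empty exp_zero)
qed

lemma sum_clique_factor:
  assumes b: "b \<in> cells L S"
  shows "(\<Sum>c | c \<in> cells L C \<and> restrict c S = b. clique_factor \<theta> c) = total \<theta> b"
  unfolding sum_fibre_split[OF b] odds_total_def clique_factor_ext
  by (intro arg_cong2[of _ _ _ _ "(+)"] refl sum.cong) (simp add: clique_factor_fill)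

lemma weight_glue:
  assumes j: "j \<in> cells L (H \<union> C)"
  shows "weight (\<D> \<union> new_sets) (H \<union> C) \<theta> j = weight \<D> H \<theta> (restrict j H) * clique_factor \<theta> (restrict j C)"
proof -
  let ?E = "support (H \<union> C) j"
  have eq: "{F. F \<in> \<D> \<union> new_sets \<and> F \<subseteq> ?E} = {F. F \<in> \<D> \<and> F \<subseteq> ?E} \<union> {F. F \<in> new_sets \<and> F \<subseteq> ?E}" by auto
  have "(\<Sum>F | F \<in> \<D> \<union> new_sets \<and> F \<subseteq> ?E. \<theta> (F, restrict j F))
     = (\<Sum>F | F \<in> \<D> \<and> F \<subseteq> ?E. \<theta> (F, restrict j F)) + (\<Sum>F | F \<in> new_sets \<and> F \<subseteq> ?E. \<theta> (F, restrict j F))"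
    unfolding eq
  proof (rule sum.union_disjoint)
    show "finite {F. F \<in> \<D> \<and> F \<subseteq> ?E}" "finite {F. F \<in> new_sets \<and> F \<subseteq> ?E}"
      by (rule finite_subset[OF _ finite_new_sets(2)], blast) (rule finite_subset[OF _ finite_new_sets(1)], blast)
    show "{F. F \<in> \<D> \<and> F \<subseteq> ?E} \<inter> {F. F \<in> new_sets \<and> F \<subseteq> ?E} = {}"
      using old_new_disjoint(2) by blast
  qed
  also have "(\<Sum>F | F \<in> \<D> \<and> F \<subseteq> ?E. \<theta> (F, restrict j F)) = (\<Sum>F | F \<in> \<D> \<and> F \<subseteq> support H (restrict j H). \<theta> (F, restrict (restrict j H) F))"
  proof (rule sum.cong)
    show "{F. F \<in> \<D> \<and> F \<subseteq> ?E} = {F. F \<in> \<D> \<and> F \<subseteq> support H (restrict j H)}"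
      using old_sets by (auto simp: support_def)
    fix F assume "F \<in> {F. F \<in> \<D> \<and> F \<subseteq> support H (restrict j H)}"
    then have "F \<subseteq> H" using old_sets by auto
    then show "\<theta> (F, restrict j F) = \<theta> (F, restrict (restrict j H) F)" by (simp only: restrict_restrict_subset)
  qed
  also have "(\<Sum>F | F \<in> new_sets \<and> F \<subseteq> ?E. \<theta> (F, restrict j F)) = (\<Sum>F | F \<subseteq> support C (restrict j C) \<and> \<not> F \<subseteq> H. \<theta> (F, restrict (restrict j C) F))"
  proof (rule sum.cong)
    show "{F. F \<in> new_sets \<and> F \<subseteq> ?E} = {F. F \<subseteq> support C (restrict j C) \<and> \<not> F \<subseteq> H}"
      by (auto simp: support_def)
    fix F assume "F \<in> {F. F \<subseteq> support C (restrict j C) \<and> \<not> F \<subseteq> H}"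
    then have "F \<subseteq> support C (restrict j C)" by simp
    then have "F \<subseteq> C" by (rule order_trans[OF _ support_subset])
    then show "\<theta> (F, restrict j F) = \<theta> (F, restrict (restrict j C) F)" by (simp only: restrict_restrict_subset)
  qed
  finally show ?thesis
    by (simp only: weight_def clique_factor_def exp_add)
qed

text \<open>
  The interactions of \<open>ln (total \<theta>)\<close> on the nonempty faces of a cell add up to the value of this
  function minus its value at the zero cell, which is the interaction of the empty face.
\<close>
lemma weight_absorb:
  assumes h: "h \<in> cells L H"
  shows "weight \<D> H (absorb \<theta>) h * total \<theta> (zero_cell S) = weight \<D> H \<theta> h * total \<theta> (restrict h S)"
proof -
  let ?E = "support H h" and ?b = "restrict h S" and ?I = "interaction S (\<lambda>b. ln (total \<theta> b))"
  have b: "?b \<in> cells L S" using restrict_cells[OF h] by auto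
  have finE: "finite {F. F \<in> \<D> \<and> F \<subseteq> ?E}" using finite_new_sets by auto
  have finS: "finite (support S ?b)" by (rule finite_sub[OF order_trans[OF support_subset S_subsets(1)]])
  have "(\<Sum>F | F \<in> \<D> \<and> F \<subseteq> ?E. absorb \<theta> (F, restrict h F))
      = (\<Sum>F | F \<in> \<D> \<and> F \<subseteq> ?E. \<theta> (F, restrict h F)) + (\<Sum>F | F \<in> \<D> \<and> F \<subseteq> ?E. if F \<subseteq> S then ?I (F, restrict h F) else 0)"
    by (simp add: absorb_def sum.distrib)
  also have "(\<Sum>F | F \<in> \<D> \<and> F \<subseteq> ?E. if F \<subseteq> S then ?I (F, restrict h F) else 0)
      = (\<Sum>F\<in>{F \<in> {F. F \<in> \<D> \<and> F \<subseteq> ?E}. F \<subseteq> S}. ?I (F, restrict h F))"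
    by (rule sum.inter_filter[OF finE, symmetric])
  also have "\<dots> = (\<Sum>F\<in>Pow (support S ?b) - {{}}. ?I (F, restrict ?b F))"
  proof (rule sum.cong)
    show "{F \<in> {F. F \<in> \<D> \<and> F \<subseteq> ?E}. F \<subseteq> S} = Pow (support S ?b) - {{}}"
      unfolding support_restrict[OF S_subsets(3)] using old_sets sep_sets by auto
    fix F assume "F \<in> Pow (support S ?b) - {{}}"
    then have "F \<subseteq> S" using support_subset[of S ?b] by blast
    then show "?I (F, restrict h F) = ?I (F, restrict ?b F)" by (simp only: restrict_restrict_subset)
  qed
  also have "\<dots> = (\<Sum>F\<in>Pow (support S ?b). ?I (F, restrict ?b F)) - ?I ({}, restrict ?b {})"
    using finS by (subst sum_diff1) auto
  also have "(\<Sum>F\<in>Pow (support S ?b). ?I (F, restrict ?b F)) = ln (total \<theta> ?b)"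
    using sum_interaction[OF S_subsets(1) b, of "\<lambda>b. ln (total \<theta> b)"] by (simp only: Pow_def)
  also have "?I ({}, restrict ?b {}) = ln (total \<theta> (zero_cell S))" by (rule interaction_empty)
  finally have "weight \<D> H (absorb \<theta>) h = weight \<D> H \<theta> h * (total \<theta> ?b / total \<theta> (zero_cell S))"
    by (simp only: weight_def exp_add exp_diff exp_ln[OF odds_total_pos])
  then show ?thesis using odds_total_pos[of new sep "log_odds \<theta>" "zero_cell S"] by simp
qed

lemma sum_weight_old:
  assumes h: "h \<in> cells L H"
  shows "(\<Sum>j | j \<in> cells L (H \<union> C) \<and> restrict j H = h. weight (\<D> \<union> new_sets) (H \<union> C) \<theta> j)
       = total \<theta> (zero_cell S) * weight \<D> H (absorb \<theta>) h"
proof -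
  have "(\<Sum>j\<in>{j \<in> cells L (H \<union> C). restrict j H = h}. weight (\<D> \<union> new_sets) (H \<union> C) \<theta> j)
      = (\<Sum>j\<in>{j \<in> cells L (H \<union> C). restrict j H = h}. weight \<D> H \<theta> h * clique_factor \<theta> (restrict j C))"
    by (rule sum.cong[OF refl]) (auto simp: weight_glue)
  also have "\<dots> = (\<Sum>c\<in>{c \<in> cells L C. restrict c (H \<inter> C) = restrict h (H \<inter> C)}. weight \<D> H \<theta> h * clique_factor \<theta> c)"
    by (rule sum.reindex_bij_betw[OF bij_glue[OF h]])
  also have "\<dots> = weight \<D> H \<theta> h * (\<Sum>c | c \<in> cells L C \<and> restrict c S = restrict h S. clique_factor \<theta> c)"
    by (simp only: sum_distrib_left Int_commute[of H C])
  also have "\<dots> = weight \<D> H \<theta> h * total \<theta> (restrict h S)"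
    by (subst sum_clique_factor) (use restrict_cells[OF h] in auto)
  finally show ?thesis by (simp only: weight_absorb[OF h, symmetric] mult.commute)
qed

lemma normalizer_glue: "normalizer L (\<D> \<union> new_sets) (H \<union> C) \<theta> = total \<theta> (zero_cell S) * normalizer L \<D> H (absorb \<theta>)"
proof -
  have "normalizer L (\<D> \<union> new_sets) (H \<union> C) \<theta>
      = (\<Sum>h\<in>cells L H. \<Sum>j | j \<in> cells L (H \<union> C) \<and> restrict j H = h. weight (\<D> \<union> new_sets) (H \<union> C) \<theta> j)"
    unfolding normalizer_def
    by (subst sum_fibres[OF finite_cells[OF U] finite_cells[OF H]]) (auto intro!: sum.cong restrict_cells)
  also have "\<dots> = (\<Sum>h\<in>cells L H. total \<theta> (zero_cell S) * weight \<D> H (absorb \<theta>) h)"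
    by (intro sum.cong refl sum_weight_old)
  finally show ?thesis by (simp only: normalizer_def sum_distrib_left)
qed

text \<open>
  The factor \<open>total \<theta> (zero_cell S)\<close> by which the weights differ is the same for all cells and cancels
  in the normalization.
\<close>
lemma marginal_old:
  assumes A: "A \<subseteq> H"
  shows "marginal L (\<D> \<union> new_sets) (H \<union> C) \<theta> A a = marginal L \<D> H (absorb \<theta>) A a"
proof -
  let ?T = "{h. h \<in> cells L H \<and> restrict h A = a}"
  have "(\<Sum>j | j \<in> cells L (H \<union> C) \<and> restrict j A = a. weight (\<D> \<union> new_sets) (H \<union> C) \<theta> j)
      = (\<Sum>j | j \<in> cells L (H \<union> C) \<and> restrict j H \<in> ?T. weight (\<D> \<union> new_sets) (H \<union> C) \<theta> j)"
    using A by (intro sum.cong) (auto simp: restrict_cells inf_absorb2)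
  also have "\<dots> = (\<Sum>h\<in>?T. \<Sum>j | j \<in> cells L (H \<union> C) \<and> restrict j H = h. weight (\<D> \<union> new_sets) (H \<union> C) \<theta> j)"
    by (rule sum_fibres[symmetric]) (use finite_cells[OF U] finite_cells[OF H] in auto)
  also have "\<dots> = (\<Sum>h\<in>?T. total \<theta> (zero_cell S) * weight \<D> H (absorb \<theta>) h)"
    by (intro sum.cong refl sum_weight_old) auto
  finally show ?thesis
    using odds_total_pos[of new sep "log_odds \<theta>" "zero_cell S"]
    by (simp add: marginal_def normalizer_glue flip: sum_distrib_left)
qed

text \<open>
  Given the restriction \<open>b\<close> to \<open>S\<close>, the levels on \<open>C - H\<close> and those on \<open>H - C\<close> are independent, and the
  conditional probability of \<open>c\<close> is its share of the odds of the block \<open>b\<close>.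
\<close>
lemma marginal_clique:
  assumes c: "c \<in> cells L C"
  shows "marginal L (\<D> \<union> new_sets) (H \<union> C) \<theta> C c
       = marginal L \<D> H (absorb \<theta>) S (restrict c S) * clique_factor \<theta> c / total \<theta> (restrict c S)"
proof -
  let ?b = "restrict c S" and ?t0 = "total \<theta> (zero_cell S)"
  have CH: "H \<union> C = C \<union> H" by auto
  have t: "0 < total \<theta> ?b" "0 < ?t0" by (rule odds_total_pos)+
  have w: "weight \<D> H \<theta> h = weight \<D> H (absorb \<theta>) h * ?t0 / total \<theta> ?b" if "h \<in> cells L H" "restrict h S = ?b" for h
    using weight_absorb[OF that(1), of \<theta>] t that(2) by (simp add: field_simps)
  have "(\<Sum>j\<in>{j \<in> cells L (C \<union> H). restrict j C = c}. weight (\<D> \<union> new_sets) (H \<union> C) \<theta> j)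
      = (\<Sum>j\<in>{j \<in> cells L (C \<union> H). restrict j C = c}. weight \<D> H \<theta> (restrict j H) * clique_factor \<theta> c)"
    by (rule sum.cong[OF refl]) (auto simp: weight_glue[unfolded CH] CH)
  also have "\<dots> = (\<Sum>h\<in>{h \<in> cells L H. restrict h S = ?b}. weight \<D> H \<theta> h * clique_factor \<theta> c)"
    by (rule sum.reindex_bij_betw[OF bij_glue[OF c]])
  also have "\<dots> = (\<Sum>h\<in>{h \<in> cells L H. restrict h S = ?b}. weight \<D> H (absorb \<theta>) h * (clique_factor \<theta> c * ?t0 / total \<theta> ?b))"
    by (rule sum.cong[OF refl]) (auto simp: w)
  also have "\<dots> = (\<Sum>h\<in>{h \<in> cells L H. restrict h S = ?b}. weight \<D> H (absorb \<theta>) h) * (clique_factor \<theta> c * ?t0 / total \<theta> ?b)"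
    by (simp only: sum_distrib_right)
  finally show ?thesis
    using t by (simp add: marginal_def normalizer_glue[unfolded CH] CH)
qed

lemma marginal_fill:
  assumes x: "x \<in> new"
  shows "marginal L (\<D> \<union> new_sets) (H \<union> C) \<theta> C (fill x)
       = block_softmax new sep (marginal L \<D> H (absorb \<theta>) S) (log_odds \<theta>) x"
  using x by (simp add: marginal_clique fill_cells restrict_fill clique_factor_fill block_softmax_def)

lemma marginal_ext:
  assumes b: "b \<in> cells L S"
  shows "marginal L (\<D> \<union> new_sets) (H \<union> C) \<theta> C (zero_fill C S b)
       = marginal L \<D> H (absorb \<theta>) S b / total \<theta> b"
  using b by (simp add: marginal_clique ext_cells restrict_ext clique_factor_ext)

text \<open>
  The linear form is split by \<open>table_hyper_pairing\<close>.  Applied on \<open>C\<close> to the new coordinates, it yields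
  the exponents of the odds; applied on \<open>S\<close> to the interactions of \<open>ln (total \<theta>)\<close>, it compensates for
  the difference between \<open>\<theta>\<close> and \<open>absorb \<theta>\<close>.  There the empty face, with the hyperparameter \<open>\<alpha>\<close>,
  accounts for the ratio of the normalizers.
\<close>
lemma model_kernel_glue:
  "model_kernel L (\<D> \<union> new_sets) (H \<union> C) s \<alpha> \<theta>
     = model_kernel L \<D> H s \<alpha> (absorb \<theta>)
       * ((\<Prod>x\<in>new. exp (table_hyper (extend_hyper s \<alpha>) C (fill x) * log_odds \<theta> x))
           / (\<Prod>b\<in>cells L S. total \<theta> b powr table_hyper (extend_hyper s \<alpha>) S b))"
proof -
  let ?s = "extend_hyper s \<alpha>" and ?I = "interaction S (\<lambda>b. ln (total \<theta> b))"
  have ne: "fst x \<noteq> {}" if "x \<in> new \<or> x \<in> old \<or> x \<in> sub_coords L S" for x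
    using that old_sets by (auto simp: star_coords_def sub_coords_def)
  have s_eq: "?s x = s x" if "x \<in> new \<or> x \<in> old \<or> x \<in> sub_coords L S" for x
    using ne[OF that] by (simp add: extend_hyper_def split_def)
  have finsub: "finite (sub_coords L S)" by (rule finite_sub_coords[OF S_subsets(1)])
  have new_part: "(\<Sum>x\<in>new. \<theta> x * s x) = (\<Sum>x\<in>new. table_hyper ?s C (fill x) * log_odds \<theta> x)"
  proof -
    \<comment> \<open>only the new coordinates: then the sum over the faces of a cell is its log-odds\<close>
    define \<phi> where "\<phi> x = (if fst x \<subseteq> H then 0 else \<theta> x)" for x
    have lin: "(\<Sum>F | F \<subseteq> support C c. \<phi> (F, restrict c F)) = (\<Sum>F | F \<subseteq> support C c \<and> \<not> F \<subseteq> H. \<theta> (F, restrict c F))" for c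
    proof -
      have fin: "finite {F. F \<subseteq> support C c}" using finite_sub[OF order_trans[OF support_subset C]] by auto
      have "(\<Sum>F | F \<subseteq> support C c. \<phi> (F, restrict c F)) = (\<Sum>F | F \<subseteq> support C c. if \<not> F \<subseteq> H then \<theta> (F, restrict c F) else 0)"
        by (rule sum.cong[OF refl]) (simp add: \<phi>_def)
      also have "\<dots> = (\<Sum>F\<in>{F \<in> {F. F \<subseteq> support C c}. \<not> F \<subseteq> H}. \<theta> (F, restrict c F))"
        by (rule sum.inter_filter[OF fin, symmetric])
      finally show ?thesis by (simp only: mem_Collect_eq)
    qed
    have lf: "(\<Sum>F | F \<subseteq> support C (fill x). \<phi> (F, restrict (fill x) F)) = log_odds \<theta> x" if "x \<in> new" for x
      using clique_factor_fill[OF that, of \<theta>] unfolding clique_factor_def lin by (simp only: exp_inj_iff)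
    have le: "(\<Sum>F | F \<subseteq> support C (zero_fill C S b). \<phi> (F, restrict (zero_fill C S b) F)) = 0" for b
      using clique_factor_ext[of \<theta> b] unfolding clique_factor_def lin by (simp only: exp_eq_one_iff)
    have "(\<Sum>x\<in>new. table_hyper ?s C (fill x) * log_odds \<theta> x)
        = (\<Sum>c\<in>cells L C. table_hyper ?s C c * (\<Sum>F | F \<subseteq> support C c. \<phi> (F, restrict c F)))"
      unfolding sum_cells_split le by (simp add: lf)
    also have "\<dots> = (\<Sum>x\<in>full_coords L C. \<phi> x * ?s x)" by (rule table_hyper_pairing[OF C])
    also have "\<dots> = (\<Sum>x\<in>new. \<phi> x * ?s x) + (\<Sum>x\<in>full_coords L S. \<phi> x * ?s x)"
      unfolding full_coords_split(1)
      by (rule sum.union_disjoint[OF finite_new finite_full_coords[OF S_subsets(1)] full_coords_split(2)])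
    also have "(\<Sum>x\<in>full_coords L S. \<phi> x * ?s x) = 0"
      by (rule sum.neutral) (auto simp: \<phi>_def full_coords_def)
    also have "(\<Sum>x\<in>new. \<phi> x * ?s x) = (\<Sum>x\<in>new. \<theta> x * s x)"
    proof (rule sum.cong[OF refl])
      fix x assume x: "x \<in> new"
      then have "\<not> fst x \<subseteq> H" by (auto simp: star_coords_def)
      then show "\<phi> x * ?s x = \<theta> x * s x" using x by (simp add: \<phi>_def s_eq)
    qed
    finally show ?thesis by simp
  qed
  have sub_old: "{x \<in> old. fst x \<subseteq> S} = sub_coords L S"
    using old_sets sep_sets by (auto simp: star_coords_def sub_coords_def)
  have "(\<Sum>x\<in>old. (if fst x \<subseteq> S then ?I x * s x else 0)) = (\<Sum>x\<in>{x \<in> old. fst x \<subseteq> S}. ?I x * s x)"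
    by (rule sum.inter_filter[OF finite_old, symmetric])
  then have "(\<Sum>x\<in>old. (if fst x \<subseteq> S then ?I x * s x else 0)) = (\<Sum>x\<in>sub_coords L S. ?I x * s x)"
    unfolding sub_old .
  moreover have "(\<Sum>x\<in>old. absorb \<theta> x * s x) = (\<Sum>x\<in>old. \<theta> x * s x) + (\<Sum>x\<in>old. (if fst x \<subseteq> S then ?I x * s x else 0))"
    unfolding sum.distrib[symmetric] by (rule sum.cong[OF refl]) (simp add: absorb_def algebra_simps)
  ultimately have old_part: "(\<Sum>x\<in>old. \<theta> x * s x) = (\<Sum>x\<in>old. absorb \<theta> x * s x) - (\<Sum>x\<in>sub_coords L S. ?I x * s x)"
    by simp
  have sep_part: "(\<Sum>b\<in>cells L S. table_hyper ?s S b * ln (total \<theta> b)) = \<alpha> * ln (total \<theta> (zero_cell S)) + (\<Sum>x\<in>sub_coords L S. ?I x * s x)"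
  proof -
    have "(\<Sum>b\<in>cells L S. table_hyper ?s S b * ln (total \<theta> b))
        = (\<Sum>b\<in>cells L S. table_hyper ?s S b * (\<Sum>F | F \<subseteq> support S b. ?I (F, restrict b F)))"
      by (rule sum.cong[OF refl]) (simp only: sum_interaction[OF S_subsets(1)])
    also have "\<dots> = (\<Sum>x\<in>full_coords L S. ?I x * ?s x)" by (rule table_hyper_pairing[OF S_subsets(1)])
    also have "\<dots> = ?I ({}, \<lambda>_. undefined) * ?s ({}, \<lambda>_. undefined) + (\<Sum>x\<in>sub_coords L S. ?I x * ?s x)"
      unfolding full_coords_eq by (rule sum.insert[OF finsub empty_notin_sub_coords])
    also have "(\<Sum>x\<in>sub_coords L S. ?I x * ?s x) = (\<Sum>x\<in>sub_coords L S. ?I x * s x)"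
      by (rule sum.cong[OF refl]) (simp add: s_eq)
    finally show ?thesis by (simp add: interaction_empty extend_hyper_def)
  qed
  have "(\<Sum>x\<in>star_coords L (\<D> \<union> new_sets). \<theta> x * s x) = (\<Sum>x\<in>old. \<theta> x * s x) + (\<Sum>x\<in>new. \<theta> x * s x)"
    unfolding star_coords_Un by (rule sum.union_disjoint[OF finite_old finite_new old_new_disjoint(1)])
  moreover have "ln (normalizer L (\<D> \<union> new_sets) (H \<union> C) \<theta>) = ln (total \<theta> (zero_cell S)) + ln (normalizer L \<D> H (absorb \<theta>))"
    unfolding normalizer_glue by (rule ln_mult_pos[OF odds_total_pos normalizer_pos[OF H]])
  ultimately have "(\<Sum>x\<in>star_coords L (\<D> \<union> new_sets). \<theta> x * s x) - \<alpha> * ln (normalizer L (\<D> \<union> new_sets) (H \<union> C) \<theta>)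
     = ((\<Sum>x\<in>old. absorb \<theta> x * s x) - \<alpha> * ln (normalizer L \<D> H (absorb \<theta>)))
       + ((\<Sum>x\<in>new. table_hyper ?s C (fill x) * log_odds \<theta> x) - (\<Sum>b\<in>cells L S. table_hyper ?s S b * ln (total \<theta> b)))"
    unfolding sep_part old_part new_part by (simp add: algebra_simps)
  moreover have "(\<Prod>b\<in>cells L S. total \<theta> b powr table_hyper ?s S b) = exp (\<Sum>b\<in>cells L S. table_hyper ?s S b * ln (total \<theta> b))"
    unfolding exp_sum[OF finite_cells[OF S_subsets(1)]]
    by (rule prod.cong[OF refl]) (use odds_total_pos[of new sep "log_odds \<theta>"] in \<open>simp add: powr_def less_imp_neq[symmetric]\<close>)
  ultimately show ?thesis
    unfolding model_kernel_def by (simp only: exp_add exp_diff exp_sum[OF finite_new])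
qed

end

section \<open>Charts of Lebesgue measure\<close>

lemma log_linear_cong:
  assumes "\<And>x. x \<in> star_coords L \<D> \<Longrightarrow> \<theta> x = \<theta>' x"
  shows "j \<in> cells L U \<Longrightarrow> weight \<D> U \<theta> j = weight \<D> U \<theta>' j"
    and "normalizer L \<D> U \<theta> = normalizer L \<D> U \<theta>'"
    and "marginal L \<D> U \<theta> = marginal L \<D> U \<theta>'"
    and "model_kernel L \<D> U s \<alpha> \<theta> = model_kernel L \<D> U s \<alpha> \<theta>'"
proof -
  have w: "weight \<D> U \<theta> j = weight \<D> U \<theta>' j" if j: "j \<in> cells L U" for j
  proof -
    have "\<theta> (F, restrict j F) = \<theta>' (F, restrict j F)" if "F \<in> \<D>" "F \<subseteq> support U j" for F
    proof (rule assms)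
      have "F \<subseteq> U" by (rule order_trans[OF that(2) support_subset])
      then show "(F, restrict j F) \<in> star_coords L \<D>"
        using restrict_mem_cells_star_iff[OF j \<open>F \<subseteq> U\<close>] that by (simp add: star_coords_def)
    qed
    then show ?thesis unfolding weight_def by (intro arg_cong[of _ _ exp] sum.cong) auto
  qed
  then show "j \<in> cells L U \<Longrightarrow> weight \<D> U \<theta> j = weight \<D> U \<theta>' j" .
  show n: "normalizer L \<D> U \<theta> = normalizer L \<D> U \<theta>'"
    unfolding normalizer_def by (intro sum.cong refl w)
  show "marginal L \<D> U \<theta> = marginal L \<D> U \<theta>'"
    unfolding marginal_def n by (intro ext arg_cong2[of _ _ _ _ "(/)"] refl sum.cong w) auto
  show "model_kernel L \<D> U s \<alpha> \<theta> = model_kernel L \<D> U s \<alpha> \<theta>'"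
    unfolding model_kernel_def n using assms by (simp cong: sum.cong)
qed

lemma (in finite_levels) log_linear_measurable:
  assumes U: "U \<subseteq> V"
  shows "j \<in> cells L U \<Longrightarrow> (\<lambda>\<theta>. weight \<D> U \<theta> j) \<in> borel_measurable (Leb (star_coords L \<D>))"
    and "(\<lambda>\<theta>. normalizer L \<D> U \<theta>) \<in> borel_measurable (Leb (star_coords L \<D>))"
    and "(\<lambda>\<theta>. marginal L \<D> U \<theta> A a) \<in> borel_measurable (Leb (star_coords L \<D>))"
    and "(\<lambda>\<theta>. model_kernel L \<D> U s \<alpha> \<theta>) \<in> borel_measurable (Leb (star_coords L \<D>))"
proof -
  have w: "(\<lambda>\<theta>. weight \<D> U \<theta> j) \<in> borel_measurable (Leb (star_coords L \<D>))" if j: "j \<in> cells L U" for j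
    unfolding weight_def
  proof (intro measurable_compose[OF _ borel_measurable_exp] borel_measurable_sum measurable_Leb_component)
    fix F assume F: "F \<in> {F. F \<in> \<D> \<and> F \<subseteq> support U j}"
    then have "F \<subseteq> support U j" by simp
    then have "F \<subseteq> U" by (rule order_trans[OF _ support_subset])
    then show "(F, restrict j F) \<in> star_coords L \<D>"
      using restrict_mem_cells_star_iff[OF j \<open>F \<subseteq> U\<close>] F by (simp add: star_coords_def)
  qed
  then show "j \<in> cells L U \<Longrightarrow> (\<lambda>\<theta>. weight \<D> U \<theta> j) \<in> borel_measurable (Leb (star_coords L \<D>))" .
  show n: "(\<lambda>\<theta>. normalizer L \<D> U \<theta>) \<in> borel_measurable (Leb (star_coords L \<D>))"
    unfolding normalizer_def by (intro borel_measurable_sum w)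
  show "(\<lambda>\<theta>. marginal L \<D> U \<theta> A a) \<in> borel_measurable (Leb (star_coords L \<D>))"
    unfolding marginal_def by (intro borel_measurable_divide n borel_measurable_sum w) simp
  show "(\<lambda>\<theta>. model_kernel L \<D> U s \<alpha> \<theta>) \<in> borel_measurable (Leb (star_coords L \<D>))"
    unfolding model_kernel_def
    by (intro measurable_compose[OF _ borel_measurable_exp] borel_measurable_diff borel_measurable_sum
        borel_measurable_times borel_measurable_const measurable_Leb_component
        borel_measurable_ln n)
qed

lemma odds_total_cong: "(\<And>j. j \<in> J \<Longrightarrow> \<eta> j = \<eta>' j) \<Longrightarrow> odds_total J \<beta> \<eta> b = odds_total J \<beta> \<eta>' b"
  by (simp add: odds_total_def)

lemma block_softmax_cong: "(\<And>j. j \<in> J \<Longrightarrow> \<eta> j = \<eta>' j) \<Longrightarrow> block_softmax J \<beta> t \<eta> = block_softmax J \<beta> t \<eta>'"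
  using odds_total_cong[of J \<eta> \<eta>' \<beta>] by (auto simp: block_softmax_def fun_eq_iff)

text \<open>
  \<open>h D\<close> is the vertex set of the marginal table that supplies the coordinates of the face \<open>D\<close>.
\<close>
definition host_marginals ::
  "('v \<Rightarrow> 'l::zero set) \<Rightarrow> 'v set set \<Rightarrow> 'v set \<Rightarrow> ('v set \<Rightarrow> 'v set)
     \<Rightarrow> (('v, 'l) coord \<Rightarrow> real) \<Rightarrow> ('v, 'l) coord \<Rightarrow> real" where
  "host_marginals L \<D> U h \<theta> =
     (\<lambda>x\<in>star_coords L \<D>. marginal L \<D> U \<theta> (h (fst x)) (zero_fill (h (fst x)) (fst x) (snd x)))"

lemma (in finite_levels) measurable_host_marginals:
  assumes "U \<subseteq> V"
  shows "host_marginals L \<D> U h \<in> measurable (Leb (star_coords L \<D>)) (Leb (star_coords L \<D>))"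
  unfolding host_marginals_def by (intro measurable_Leb_restrict log_linear_measurable assms)

text \<open>
  \<open>X\<close> is an injective change of variables with the Jacobian \<open>D\<close>, in integrated form.  The region \<open>W\<close>
  only has to contain the image of \<open>X\<close>: that it exceeds the image by a null set follows from the
  integral formula, and in an induction it is easier to describe than the image.
\<close>
definition lebesgue_chart ::
  "'i set \<Rightarrow> (('i \<Rightarrow> real) \<Rightarrow> 'i \<Rightarrow> real) \<Rightarrow> (('i \<Rightarrow> real) \<Rightarrow> real) \<Rightarrow> bool" where
  "lebesgue_chart J X D \<longleftrightarrow>
     (\<exists>\<Psi>\<in>measurable (Leb J) (Leb J). \<forall>\<theta>\<in>space (Leb J). \<Psi> (X \<theta>) = \<theta>) \<and>
     (\<exists>W\<in>sets (Leb J). (\<forall>\<theta>\<in>space (Leb J). X \<theta> \<in> W) \<and>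
        (\<forall>f\<in>borel_measurable (Leb J).
           (\<integral>\<^sup>+\<theta>. f (X \<theta>) * ennreal (D \<theta>) \<partial>Leb J) = (\<integral>\<^sup>+x. f x * indicator W x \<partial>Leb J)))"

context gluing
begin

lemma fst_old: "x \<in> old \<Longrightarrow> fst x \<in> \<D>" and fst_new: "x \<in> new \<Longrightarrow> fst x \<subseteq> C \<and> \<not> fst x \<subseteq> H"
  by (auto simp: star_coords_def)

lemma new_coordI: "(F, j) \<in> new \<Longrightarrow> F' \<subseteq> F \<Longrightarrow> \<not> F' \<subseteq> H \<Longrightarrow> (F', restrict j F') \<in> new"
  by (auto simp: star_coords_def intro: restrict_cells_star)

lemma log_odds_cong:
  assumes "\<And>y. y \<in> new \<Longrightarrow> fst y \<subseteq> fst x \<Longrightarrow> \<theta> y = \<theta>' y" "x \<in> new"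
  shows "log_odds \<theta> x = log_odds \<theta>' x"
proof -
  obtain F j where x: "x = (F, j)" by (cases x)
  show ?thesis unfolding x log_odds_def prod.case
  proof (rule sum.cong[OF refl])
    fix F' assume F': "F' \<in> {F'. F' \<subseteq> F \<and> \<not> F' \<subseteq> H}"
    then have "(F', restrict j F') \<in> new" using new_coordI[of F j F'] assms(2) x by auto
    then show "\<theta> (F', restrict j F') = \<theta>' (F', restrict j F')" using assms(1) F' x by simp
  qed
qed

text \<open>
  The log-odds of the new coordinates together with the parameter of the smaller model.
\<close>
definition reparam :: "(('v, 'l) coord \<Rightarrow> real) \<Rightarrow> ('v, 'l) coord \<Rightarrow> real" where
  "reparam \<theta> = (\<lambda>x\<in>old \<union> new. if x \<in> new then log_odds \<theta> x else absorb \<theta> x)"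

lemma measurable_log_odds: "x \<in> new \<Longrightarrow> (\<lambda>\<theta>. log_odds \<theta> x) \<in> borel_measurable (Leb (old \<union> new))"
proof -
  assume "x \<in> new"
  then obtain F j where x: "x = (F, j)" "(F, j) \<in> new" by (cases x) auto
  show ?thesis
    unfolding x(1) log_odds_def prod.case
    by (intro borel_measurable_sum measurable_Leb_component UnI2 new_coordI[OF x(2)]) auto
qed

lemma measurable_total: "(\<lambda>\<theta>. total \<theta> b) \<in> borel_measurable (Leb (old \<union> new))"
  unfolding odds_total_def
  by (intro borel_measurable_add borel_measurable_const borel_measurable_sum
      measurable_compose[OF measurable_log_odds borel_measurable_exp]) auto

text \<open>
  A log-odds is its coordinate plus coordinates of smaller new faces, and \<open>absorb\<close> adds to an old
  coordinate a function of the new ones.  The rank orders the new coordinates by the size of their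
  faces and puts the old ones after them.
\<close>
lemma reparam_shear:
  "\<exists>T. T \<in> measurable (Leb (old \<union> new)) (Leb (old \<union> new))
     \<and> (\<forall>\<theta>\<in>space (Leb (old \<union> new)). T (reparam \<theta>) = \<theta>)
     \<and> (\<forall>f\<in>borel_measurable (Leb (old \<union> new)).
          (\<integral>\<^sup>+\<theta>. f (reparam \<theta>) \<partial>Leb (old \<union> new)) = (\<integral>\<^sup>+z. f z \<partial>Leb (old \<union> new)))"
proof -
  let ?J = "old \<union> new"
  define g where "g x \<theta> = (if x \<in> new then \<Sum>F' | F' \<subset> fst x \<and> \<not> F' \<subseteq> H. \<theta> (F', restrict (snd x) F')
     else if fst x \<subseteq> S then interaction S (\<lambda>b. ln (total \<theta> b)) x else 0)" for x and \<theta> :: "('v, 'l) coord \<Rightarrow> real"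
  define r where "r x = (if x \<in> new then card (fst x) else Suc (card C))" for x :: "('v, 'l) coord"
  have fin: "finite ?J" using finite_old finite_new by simp
  have sh: "shear ?J g = reparam"
  proof (intro ext)
    fix \<theta> x
    show "shear ?J g \<theta> x = reparam \<theta> x"
    proof (cases "x \<in> new")
      case True
      obtain F j where x: "x = (F, j)" by (cases x)
      have F: "F \<subseteq> C" "\<not> F \<subseteq> H" "j \<in> cells_star L F" using True x by (auto simp: star_coords_def)
      have eq: "{F'. F' \<subseteq> F \<and> \<not> F' \<subseteq> H} = insert F {F'. F' \<subset> F \<and> \<not> F' \<subseteq> H}" using F by auto
      have "finite {F'. F' \<subset> F \<and> \<not> F' \<subseteq> H}"
        by (rule finite_subset[of _ "Pow C"]) (use F finite_sub[OF C] in auto)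
      then have "log_odds \<theta> x = \<theta> (F, restrict j F) + (\<Sum>F' | F' \<subset> F \<and> \<not> F' \<subseteq> H. \<theta> (F', restrict j F'))"
        unfolding x log_odds_def prod.case eq by (subst sum.insert) auto
      then show ?thesis
        using True cells_star_extensional[OF F(3)] by (simp add: shear_def reparam_def g_def x extensional_restrict)
    next
      case False
      then show ?thesis by (simp add: shear_def reparam_def g_def absorb_def)
    qed
  qed
  have "\<exists>T. T \<in> measurable (Leb ?J) (Leb ?J)
           \<and> (\<forall>x\<in>space (Leb ?J). T (shear ?J g x) = x \<and> shear ?J g (T x) = x)
           \<and> (\<forall>f\<in>borel_measurable (Leb ?J). (\<integral>\<^sup>+x. f (shear ?J g x) \<partial>Leb ?J) = (\<integral>\<^sup>+x. f x \<partial>Leb ?J))"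
  proof (rule triangular_shear[where r = r, OF fin])
    fix x assume x: "x \<in> ?J"
    show "g x \<in> borel_measurable (Leb ?J)"
    proof (cases "x \<in> new")
      case True
      then have "(fst x, snd x) \<in> new" by simp
      from new_coordI[OF this] show ?thesis
        unfolding g_def using True by (auto intro!: borel_measurable_sum measurable_Leb_component)
    next
      case False
      obtain D i where "x = (D, i)" by (cases x)
      moreover have "(\<lambda>\<theta>. interaction S (\<lambda>b. ln (total \<theta> b)) (D, i)) \<in> borel_measurable (Leb ?J)"
        unfolding interaction_def prod.case
        by (intro borel_measurable_sum borel_measurable_times borel_measurable_const borel_measurable_ln measurable_total)
      ultimately show ?thesis
        unfolding g_def using False by (cases "D \<subseteq> C"; cases "D \<subseteq> H"; simp)
    qed
  next
    fix x and \<theta> \<theta>' :: "('v, 'l) coord \<Rightarrow> real"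
    assume x: "x \<in> ?J" and eq: "\<And>y. y \<in> ?J \<Longrightarrow> r y < r x \<Longrightarrow> \<theta> y = \<theta>' y"
    show "g x \<theta> = g x \<theta>'"
    proof (cases "x \<in> new")
      case True
      then have xx: "(fst x, snd x) \<in> new" by simp
      have "\<theta> (F', restrict (snd x) F') = \<theta>' (F', restrict (snd x) F')" if F': "F' \<subset> fst x" "\<not> F' \<subseteq> H" for F'
      proof (rule eq)
        have n: "(F', restrict (snd x) F') \<in> new" using new_coordI[OF xx] F' by auto
        then show "(F', restrict (snd x) F') \<in> ?J" by simp
        have "fst x \<subseteq> C" using fst_new[OF True] by simp
        then have "card F' < card (fst x)"
          using F'(1) finite_sub[OF C] by (meson finite_subset psubset_card_mono)
        then show "r (F', restrict (snd x) F') < r x" using n True by (simp add: r_def)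
      qed
      then show ?thesis using True by (simp add: g_def)
    next
      case False
      have "\<theta> y = \<theta>' y" if y: "y \<in> new" for y
      proof (rule eq)
        have "card (fst y) \<le> card C" using fst_new[OF y] finite_sub[OF C] by (auto intro: card_mono)
        then show "r y < r x" using y False by (simp add: r_def)
      qed (use y in simp)
      then have "total \<theta> b = total \<theta>' b" for b by (intro odds_total_cong log_odds_cong) auto
      then show ?thesis using False by (simp add: g_def)
    qed
  qed
  then show ?thesis unfolding sh by blast
qed

lemma total_reparam: "odds_total new sep (restrict (reparam \<theta>) new) b = total \<theta> b"
  by (rule odds_total_cong) (simp add: reparam_def)

lemma softmax_reparam: "block_softmax new sep t (restrict (reparam \<theta>) new) = block_softmax new sep t (log_odds \<theta>)"
  by (rule block_softmax_cong) (simp add: reparam_def)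

lemma reparam_old: "x \<in> old \<Longrightarrow> restrict (reparam \<theta>) old x = absorb \<theta> x"
  using old_new_disjoint(1) by (auto simp: reparam_def)

lemma marginal_reparam: "marginal L \<D> H (restrict (reparam \<theta>) old) = marginal L \<D> H (absorb \<theta>)"
  by (rule log_linear_cong(3)) (rule reparam_old)

lemma model_kernel_reparam:
  "model_kernel L \<D> H s \<alpha> (restrict (reparam \<theta>) old) = model_kernel L \<D> H s \<alpha> (absorb \<theta>)"
  by (rule log_linear_cong(4)) (rule reparam_old)

lemma restrict_merge_Leb:
  assumes "u \<in> extensional old" "y \<in> extensional new"
  shows "restrict (merge old new (u, y)) old = u" "restrict (merge old new (u, y)) new = y"
  using assms old_new_disjoint(1) by (auto simp: merge_def extensional_def fun_eq_iff restrict_def)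

text \<open>
  In the coordinates \<open>reparam\<close> the integrand is a product of a function of the old coordinates and a
  function of the new ones.  The factor \<open>g\<close> is needed for the law of the \<open>H\<close>-marginals; with \<open>g = 1\<close>
  the formula is a recursion for the prior integral.
\<close>
lemma nn_integral_model_kernel_glue:
  assumes g: "g \<in> borel_measurable (Leb old)"
  shows "(\<integral>\<^sup>+\<theta>. g (restrict (reparam \<theta>) old) * ennreal (model_kernel L (\<D> \<union> new_sets) (H \<union> C) s \<alpha> \<theta>) \<partial>Leb (old \<union> new))
   = (\<integral>\<^sup>+u. g u * ennreal (model_kernel L \<D> H s \<alpha> u) \<partial>Leb old)
     * block_dirichlet_integral new sep (cells L S) (\<lambda>x. table_hyper (extend_hyper s \<alpha>) C (fill x))
         (table_hyper (extend_hyper s \<alpha>) S)"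
proof -
  let ?a = "\<lambda>x. table_hyper (extend_hyper s \<alpha>) C (fill x)" and ?A = "table_hyper (extend_hyper s \<alpha>) S"
  define q where "q \<eta> = (\<Prod>x\<in>new. exp (?a x * \<eta> x)) / (\<Prod>b\<in>cells L S. odds_total new sep \<eta> b powr ?A b)" for \<eta> :: "('v, 'l) coord \<Rightarrow> real"
  define K where "K u = g u * ennreal (model_kernel L \<D> H s \<alpha> u)" for u
  define f where "f z = K (restrict z old) * ennreal (q (restrict z new))" for z :: "('v, 'l) coord \<Rightarrow> real"
  have q0: "0 \<le> q \<eta>" for \<eta> by (simp add: q_def prod_nonneg)
  have qm: "q \<in> borel_measurable (Leb new)"
    unfolding q_def
    by (intro borel_measurable_divide borel_measurable_prod
        measurable_compose[OF borel_measurable_times borel_measurable_exp] borel_measurable_const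
        measurable_Leb_component powr_real_measurable borel_measurable_odds_total finite_new) auto
  have Km: "K \<in> borel_measurable (Leb old)"
    unfolding K_def
    by (intro borel_measurable_times_ennreal g measurable_compose[OF _ measurable_ennreal] log_linear_measurable H)
  have fm: "f \<in> borel_measurable (Leb (old \<union> new))"
    unfolding f_def
    by (intro borel_measurable_times_ennreal measurable_compose[OF measurable_Leb_subset Km]
        measurable_compose[OF measurable_compose[OF measurable_Leb_subset qm] measurable_ennreal]) auto
  have f_eq: "g (restrict (reparam \<theta>) old) * ennreal (model_kernel L (\<D> \<union> new_sets) (H \<union> C) s \<alpha> \<theta>) = f (reparam \<theta>)" for \<theta>
  proof -
    have q_eq: "q (restrict (reparam \<theta>) new) = (\<Prod>x\<in>new. exp (?a x * log_odds \<theta> x)) / (\<Prod>b\<in>cells L S. total \<theta> b powr ?A b)"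
      unfolding q_def total_reparam
      by (intro arg_cong2[of _ _ _ _ "(/)"] refl prod.cong) (simp add: reparam_def)
    have "ennreal (model_kernel L (\<D> \<union> new_sets) (H \<union> C) s \<alpha> \<theta>)
        = ennreal (model_kernel L \<D> H s \<alpha> (restrict (reparam \<theta>) old)) * ennreal (q (restrict (reparam \<theta>) new))"
      unfolding model_kernel_glue model_kernel_reparam q_eq[symmetric] by (rule ennreal_mult''[OF q0])
    then show ?thesis unfolding f_def K_def by (simp only: mult.assoc)
  qed
  have "(\<integral>\<^sup>+\<theta>. g (restrict (reparam \<theta>) old) * ennreal (model_kernel L (\<D> \<union> new_sets) (H \<union> C) s \<alpha> \<theta>) \<partial>Leb (old \<union> new)) = (\<integral>\<^sup>+z. f z \<partial>Leb (old \<union> new))"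
    unfolding f_eq using reparam_shear fm by blast
  also have "\<dots> = (\<integral>\<^sup>+u. \<integral>\<^sup>+y. f (merge old new (u, y)) \<partial>Leb new \<partial>Leb old)"
    by (rule Leb.product_nn_integral_fold[OF old_new_disjoint(1) finite_old finite_new fm])
  also have "\<dots> = (\<integral>\<^sup>+u. \<integral>\<^sup>+y. K u * ennreal (q y) \<partial>Leb new \<partial>Leb old)"
    by (intro nn_integral_cong) (simp add: f_def restrict_merge_Leb space_Leb)
  also have "\<dots> = (\<integral>\<^sup>+u. K u * (\<integral>\<^sup>+y. ennreal (q y) \<partial>Leb new) \<partial>Leb old)"
    using qm by (intro nn_integral_cong nn_integral_cmult) auto
  also have "\<dots> = (\<integral>\<^sup>+u. K u \<partial>Leb old) * (\<integral>\<^sup>+y. ennreal (q y) \<partial>Leb new)"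
    by (rule nn_integral_multc[OF Km])
  finally show ?thesis by (simp only: block_dirichlet_integral_def q_def K_def)
qed

text \<open>
  In the coordinates \<open>reparam\<close> the map is fibred: its old components are the given chart of the smaller
  model, and for a fixed old part the new components are the block softmax of the log-odds whose masses
  are the \<open>S\<close>-marginal of the old part.  Tonelli's theorem combines the change of variables in the
  fibres with that of the base.  The \<open>S\<close>-marginal is recovered from the old components by the left
  inverse \<open>\<Psi>\<close>, which is why a chart has to have one.
\<close>
lemma lebesgue_chart_glue:
  assumes chart: "lebesgue_chart old (host_marginals L \<D> H h) jac"
    and h_old: "\<And>D. D \<in> \<D> \<Longrightarrow> h D \<subseteq> H" and h_new: "\<And>F. F \<in> new_sets \<Longrightarrow> h F = C"
    and jac_m: "jac \<in> borel_measurable (Leb old)" and jac_0: "\<And>\<theta>. 0 \<le> jac \<theta>"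
    and jac_cong: "\<And>\<theta> \<theta>'. (\<And>x. x \<in> old \<Longrightarrow> \<theta> x = \<theta>' x) \<Longrightarrow> jac \<theta> = jac \<theta>'"
    and jac': "\<And>\<theta>. jac' \<theta> = jac (absorb \<theta>)
        * ((\<Prod>x\<in>new. marginal L (\<D> \<union> new_sets) (H \<union> C) \<theta> C (fill x)) * (\<Prod>b\<in>cells L S. 1 / total \<theta> b))"
  shows "lebesgue_chart (old \<union> new) (host_marginals L (\<D> \<union> new_sets) (H \<union> C) h) jac'"
proof -
  let ?J = "old \<union> new" and ?\<D> = "\<D> \<union> new_sets" and ?U = "H \<union> C" and ?B = "cells L S"
  let ?X = "host_marginals L \<D> H h" and ?X' = "host_marginals L ?\<D> ?U h"
  define t where "t u b = marginal L \<D> H u S b" for u b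
  obtain \<Psi> W where \<Psi>m: "\<Psi> \<in> measurable (Leb old) (Leb old)" and \<Psi>: "\<And>u. u \<in> space (Leb old) \<Longrightarrow> \<Psi> (?X u) = u"
    and Wm: "W \<in> sets (Leb old)" and XW: "\<And>u. u \<in> space (Leb old) \<Longrightarrow> ?X u \<in> W"
    and int: "\<And>f. f \<in> borel_measurable (Leb old) \<Longrightarrow>
       (\<integral>\<^sup>+u. f (?X u) * ennreal (jac u) \<partial>Leb old) = (\<integral>\<^sup>+x. f x * indicator W x \<partial>Leb old)"
    using chart unfolding lebesgue_chart_def by blast
  obtain T where Tm: "T \<in> measurable (Leb ?J) (Leb ?J)" and T: "\<And>\<theta>. \<theta> \<in> space (Leb ?J) \<Longrightarrow> T (reparam \<theta>) = \<theta>"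
    and int_T: "\<And>f. f \<in> borel_measurable (Leb ?J) \<Longrightarrow> (\<integral>\<^sup>+\<theta>. f (reparam \<theta>) \<partial>Leb ?J) = (\<integral>\<^sup>+z. f z \<partial>Leb ?J)"
    using reparam_shear by blast
  have finB: "finite ?B" by (rule finite_cells[OF S_subsets(1)])
  have sepB: "sep ` new \<subseteq> ?B" using sep_cells by auto
  have tm: "(\<lambda>u. t u b) \<in> borel_measurable (Leb old)" for b
    unfolding t_def by (rule log_linear_measurable(3)[OF H])
  have tpos: "0 < t u b" if "b \<in> ?B" for u b
    unfolding t_def by (rule marginal_pos[OF H S_subsets(3) that])
  have Xm: "?X \<in> measurable (Leb old) (Leb old)" by (rule measurable_host_marginals[OF H])
  have X'_old: "restrict (?X' \<theta>) old = ?X (restrict (reparam \<theta>) old)" for \<theta>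
  proof
    fix x
    show "restrict (?X' \<theta>) old x = ?X (restrict (reparam \<theta>) old) x"
      using h_old[OF fst_old, of x]
      by (cases "x \<in> old") (simp_all add: host_marginals_def star_coords_Un marginal_reparam marginal_old)
  qed
  have X'_new: "restrict (?X' \<theta>) new = block_softmax new sep (t (restrict (reparam \<theta>) old)) (restrict (reparam \<theta>) new)" for \<theta>
  proof
    fix x
    show "restrict (?X' \<theta>) new x = block_softmax new sep (t (restrict (reparam \<theta>) old)) (restrict (reparam \<theta>) new) x"
    proof (cases "x \<in> new")
      case True
      then have "h (fst x) = C" using fst_new[of x] h_new by auto
      then have "?X' \<theta> x = marginal L ?\<D> ?U \<theta> C (fill x)"
        using True by (simp add: host_marginals_def star_coords_Un fill_def split_def)
      then show ?thesis
        using True by (simp add: softmax_reparam marginal_fill t_def[abs_def] marginal_reparam)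
    next
      case False
      then show ?thesis by (simp add: block_softmax_def)
    qed
  qed
  define \<Phi> where "\<Phi> z = merge old new (?X (restrict z old), block_softmax new sep (t (restrict z old)) (restrict z new))" for z
  have X'_ext: "?X' \<theta> \<in> extensional ?J" for \<theta> by (simp add: host_marginals_def star_coords_Un)
  have X'_eq: "?X' \<theta> = \<Phi> (reparam \<theta>)" for \<theta>
  proof -
    have "?X' \<theta> = merge old new (restrict (?X' \<theta>) old, restrict (?X' \<theta>) new)"
      using X'_ext[of \<theta>] by (auto simp: merge_def fun_eq_iff extensional_def restrict_def)
    then show ?thesis by (simp only: \<Phi>_def X'_old X'_new)
  qed
  define K where "K u y = (\<Prod>x\<in>new. block_softmax new sep (t u) y x) * (\<Prod>b\<in>?B. 1 / odds_total new sep y b)" for u y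
  have K0: "0 \<le> K u y" for u y
    unfolding K_def
    by (intro mult_nonneg_nonneg prod_nonneg ballI)
       (use sepB in \<open>auto simp: block_softmax_def less_imp_le odds_total_pos tpos intro!: divide_nonneg_pos mult_nonneg_nonneg\<close>)
  have jac'_eq: "jac' \<theta> = jac (restrict (reparam \<theta>) old) * K (restrict (reparam \<theta>) old) (restrict (reparam \<theta>) new)" for \<theta>
  proof -
    have "jac (absorb \<theta>) = jac (restrict (reparam \<theta>) old)" by (rule jac_cong) (rule reparam_old[symmetric])
    moreover have "(\<Prod>x\<in>new. marginal L ?\<D> ?U \<theta> C (fill x)) = (\<Prod>x\<in>new. block_softmax new sep (t (restrict (reparam \<theta>) old)) (restrict (reparam \<theta>) new) x)"
      by (rule prod.cong) (simp_all add: softmax_reparam marginal_fill t_def[abs_def] marginal_reparam)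
    ultimately show ?thesis by (simp only: jac' K_def total_reparam)
  qed
  have r_old: "(\<lambda>z. restrict z old) \<in> measurable (Leb ?J) (Leb old)" and r_new: "(\<lambda>z. restrict z new) \<in> measurable (Leb ?J) (Leb new)"
    by (rule measurable_Leb_subset, simp)+
  have sm: "(\<lambda>z. block_softmax new sep (t (restrict z old)) (restrict z new) x) \<in> borel_measurable (Leb ?J)" if "x \<in> new" for x
    using that unfolding block_softmax_def restrict_apply'[OF that]
    by (intro borel_measurable_divide borel_measurable_times measurable_compose[OF r_old tm]
        measurable_compose[OF r_new borel_measurable_odds_total[OF finite_new]]
        measurable_compose[OF measurable_Leb_component borel_measurable_exp] UnI2)
  have \<Phi>m: "\<Phi> \<in> measurable (Leb ?J) (Leb ?J)"
  proof -
    have "(\<lambda>z. \<lambda>x\<in>new. block_softmax new sep (t (restrict z old)) (restrict z new) x) \<in> measurable (Leb ?J) (Leb new)"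
      by (rule measurable_Leb_restrict) (rule sm)
    moreover have "(\<lambda>x\<in>new. block_softmax new sep (t u) y x) = block_softmax new sep (t u) y" for u y
      by (simp add: block_softmax_def restrict_def fun_eq_iff)
    ultimately have "(\<lambda>z. block_softmax new sep (t (restrict z old)) (restrict z new)) \<in> measurable (Leb ?J) (Leb new)" by simp
    then show ?thesis unfolding \<Phi>_def
      by (intro measurable_compose[OF _ measurable_merge] measurable_Pair measurable_compose[OF r_old Xm])
  qed
  have Km: "(\<lambda>z. K (restrict z old) (restrict z new)) \<in> borel_measurable (Leb ?J)"
    unfolding K_def
    by (intro borel_measurable_times borel_measurable_prod sm borel_measurable_divide borel_measurable_const
        measurable_compose[OF r_new borel_measurable_odds_total[OF finite_new]])
  \<comment> \<open>the region over which the new coordinates range, given the old ones\<close>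
  define R where "R = {z \<in> space (Leb ?J). z \<in> block_simplex new sep ?B (t (\<Psi> (restrict z old)))}"
  have Rm: "R \<in> sets (Leb ?J)"
    unfolding R_def
    by (rule measurable_block_simplex[OF finite_new finB])
       (auto intro!: measurable_Leb_component measurable_compose[OF measurable_compose[OF r_old \<Psi>m] tm])
  define W' where "W' = {z \<in> space (Leb ?J). restrict z old \<in> W} \<inter> R"
  have W'm: "W' \<in> sets (Leb ?J)"
    unfolding W'_def by (intro sets.Int Rm measurable_sets_Collect[OF r_old] Wm) (use Wm in simp)
  have u_space: "restrict z old \<in> space (Leb old)" for z :: "('v, 'l) coord \<Rightarrow> real" by (simp add: space_Leb)
  have block_sum: "(\<Sum>x | x \<in> new \<and> sep x = b. ?X' \<theta> x) = t (restrict (reparam \<theta>) old) b - t (restrict (reparam \<theta>) old) b / total \<theta> b" for \<theta> b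
  proof -
    have "(\<Sum>x | x \<in> new \<and> sep x = b. ?X' \<theta> x) = (\<Sum>x | x \<in> new \<and> sep x = b. restrict (?X' \<theta>) new x)"
      by (rule sum.cong) auto
    then show ?thesis unfolding X'_new block_softmax_total[OF finite_new] total_reparam .
  qed
  have X'_pos: "0 < ?X' \<theta> x" if "x \<in> new" for \<theta> x
  proof -
    have "?X' \<theta> x = restrict (?X' \<theta>) new x" using that by simp
    also have "\<dots> > 0" unfolding X'_new using that tpos[OF sep_cells[OF that]]
      by (simp add: block_softmax_def odds_total_pos)
    finally show ?thesis .
  qed
  have X'_W': "?X' \<theta> \<in> W'" for \<theta>
  proof -
    have "(\<Sum>x | x \<in> new \<and> sep x = b. ?X' \<theta> x) < t (restrict (reparam \<theta>) old) b" if "b \<in> ?B" for b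
      unfolding block_sum using tpos[OF that] by (simp add: odds_total_pos)
    then show ?thesis
      using X'_ext[of \<theta>] X'_pos[of _ \<theta>] XW[OF u_space] \<Psi>[OF u_space]
      by (simp add: W'_def R_def space_Leb X'_old block_simplex_def)
  qed
  have int': "(\<integral>\<^sup>+\<theta>. f (?X' \<theta>) * ennreal (jac' \<theta>) \<partial>Leb ?J) = (\<integral>\<^sup>+x. f x * indicator W' x \<partial>Leb ?J)"
    if f: "f \<in> borel_measurable (Leb ?J)" for f
  proof -
    define F where "F z = f (\<Phi> z) * ennreal (jac (restrict z old) * K (restrict z old) (restrict z new))" for z
    have Fm: "F \<in> borel_measurable (Leb ?J)"
      unfolding F_def
      by (intro borel_measurable_times_ennreal measurable_compose[OF \<Phi>m f] measurable_compose[OF _ measurable_ennreal]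
          borel_measurable_times Km measurable_compose[OF r_old jac_m])
    define G where "G x = (\<integral>\<^sup>+y. f (merge old new (x, y)) * indicator R (merge old new (x, y)) \<partial>Leb new)" for x
    have fR: "(\<lambda>z. f z * indicator R z) \<in> borel_measurable (Leb ?J)" using f Rm by simp
    have Gm: "G \<in> borel_measurable (Leb old)"
    proof -
      interpret sigma_finite_measure "Leb new" by (rule sigma_finite_Leb[OF finite_new])
      have "(\<lambda>p. f (merge old new p) * indicator R (merge old new p)) \<in> borel_measurable (Leb old \<Otimes>\<^sub>M Leb new)"
        by (rule measurable_compose[OF measurable_merge fR])
      then show ?thesis unfolding G_def by (intro borel_measurable_nn_integral) (simp add: split_beta')
    qed
    have inner: "(\<integral>\<^sup>+y. F (merge old new (u, y)) \<partial>Leb new) = G (?X u) * ennreal (jac u)" if u: "u \<in> space (Leb old)" for u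
    proof -
      have Xe: "?X u \<in> extensional old" by (simp add: host_marginals_def)
      have fu: "(\<lambda>y. f (merge old new (?X u, y))) \<in> borel_measurable (Leb new)"
        by (rule measurable_compose[OF measurable_compose[OF measurable_Pair1' measurable_merge] f])
           (use Xe in \<open>simp add: space_Leb\<close>)
      have "(\<integral>\<^sup>+y. F (merge old new (u, y)) \<partial>Leb new)
          = (\<integral>\<^sup>+y. ennreal (jac u) * (f (merge old new (?X u, block_softmax new sep (t u) y)) * ennreal (K u y)) \<partial>Leb new)"
        using u by (intro nn_integral_cong)
          (simp add: F_def \<Phi>_def restrict_merge_Leb space_Leb ennreal_mult'' K0 mult_ac)
      also have "\<dots> = ennreal (jac u) * (\<integral>\<^sup>+y. f (merge old new (?X u, block_softmax new sep (t u) y)) * ennreal (K u y) \<partial>Leb new)"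
      proof (rule nn_integral_cmult)
        have "(\<lambda>y. K u y) \<in> borel_measurable (Leb new)"
          unfolding K_def
          by (intro borel_measurable_times borel_measurable_prod borel_measurable_divide borel_measurable_const
              borel_measurable_odds_total borel_measurable_component_Leb[OF measurable_block_softmax] finite_new)
        then show "(\<lambda>y. f (merge old new (?X u, block_softmax new sep (t u) y)) * ennreal (K u y)) \<in> borel_measurable (Leb new)"
          by (intro borel_measurable_times_ennreal measurable_compose[OF measurable_block_softmax[OF finite_new] fu]
              measurable_compose[OF _ measurable_ennreal])
      qed
      also have "(\<integral>\<^sup>+y. f (merge old new (?X u, block_softmax new sep (t u) y)) * ennreal (K u y) \<partial>Leb new)
          = (\<integral>\<^sup>+y. f (merge old new (?X u, y)) * indicator (block_simplex new sep ?B (t u)) y \<partial>Leb new)"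
        unfolding K_def
        by (rule nn_integral_block_softmax[OF finite_new finB sepB tpos fu])
      also have "\<dots> = G (?X u)"
        unfolding G_def
      proof (rule nn_integral_cong)
        fix y assume "y \<in> space (Leb new)"
        then have y: "y \<in> extensional new" by (simp add: space_Leb)
        have m: "merge old new (?X u, y) x = y x" if "x \<in> new" for x
          using that old_new_disjoint(1) by (auto simp: merge_def)
        have ms: "sum (merge old new (?X u, y)) {x \<in> new. sep x = b} = sum y {x \<in> new. sep x = b}" for b
          by (rule sum.cong) (auto simp: m)
        have "merge old new (?X u, y) \<in> extensional ?J" by (auto simp: merge_def extensional_def)
        then have "merge old new (?X u, y) \<in> R \<longleftrightarrow> y \<in> block_simplex new sep ?B (t u)"
          unfolding R_def using restrict_merge_Leb(1)[OF Xe y] \<Psi>[OF u]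
          by (simp add: space_Leb block_simplex_def m ms)
        then show "f (merge old new (?X u, y)) * indicator (block_simplex new sep ?B (t u)) y
            = f (merge old new (?X u, y)) * indicator R (merge old new (?X u, y))"
          by (simp add: indicator_def)
      qed
      finally show ?thesis by (simp only: mult.commute)
    qed
    have "(\<integral>\<^sup>+\<theta>. f (?X' \<theta>) * ennreal (jac' \<theta>) \<partial>Leb ?J) = (\<integral>\<^sup>+\<theta>. F (reparam \<theta>) \<partial>Leb ?J)"
      unfolding F_def X'_eq jac'_eq ..
    also have "\<dots> = (\<integral>\<^sup>+z. F z \<partial>Leb ?J)" by (rule int_T[OF Fm])
    also have "\<dots> = (\<integral>\<^sup>+u. \<integral>\<^sup>+y. F (merge old new (u, y)) \<partial>Leb new \<partial>Leb old)"
      by (rule Leb.product_nn_integral_fold[OF old_new_disjoint(1) finite_old finite_new Fm])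
    also have "\<dots> = (\<integral>\<^sup>+u. G (?X u) * ennreal (jac u) \<partial>Leb old)"
      by (rule nn_integral_cong) (rule inner)
    also have "\<dots> = (\<integral>\<^sup>+x. G x * indicator W x \<partial>Leb old)" by (rule int[OF Gm])
    also have "\<dots> = (\<integral>\<^sup>+x. \<integral>\<^sup>+y. f (merge old new (x, y)) * indicator W' (merge old new (x, y)) \<partial>Leb new \<partial>Leb old)"
    proof (rule nn_integral_cong)
      fix x assume "x \<in> space (Leb old)"
      then have x: "x \<in> extensional old" by (simp add: space_Leb)
      have fx: "(\<lambda>y. f (merge old new (x, y)) * indicator R (merge old new (x, y))) \<in> borel_measurable (Leb new)"
        by (rule measurable_compose[OF measurable_compose[OF measurable_Pair1' measurable_merge] fR])
           (use x in \<open>simp add: space_Leb\<close>)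
      have "G x * indicator W x = (\<integral>\<^sup>+y. f (merge old new (x, y)) * indicator R (merge old new (x, y)) * indicator W x \<partial>Leb new)"
        unfolding G_def by (rule nn_integral_multc[OF fx, symmetric])
      also have "\<dots> = (\<integral>\<^sup>+y. f (merge old new (x, y)) * indicator W' (merge old new (x, y)) \<partial>Leb new)"
      proof (rule nn_integral_cong)
        fix y assume "y \<in> space (Leb new)"
        then have y: "y \<in> extensional new" by (simp add: space_Leb)
        have "merge old new (x, y) \<in> extensional ?J" by (auto simp: merge_def extensional_def)
        then have "merge old new (x, y) \<in> W' \<longleftrightarrow> x \<in> W \<and> merge old new (x, y) \<in> R"
          unfolding W'_def using restrict_merge_Leb(1)[OF x y] by (simp add: space_Leb)
        then show "f (merge old new (x, y)) * indicator R (merge old new (x, y)) * indicator W x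
            = f (merge old new (x, y)) * indicator W' (merge old new (x, y))"
          by (auto simp: indicator_def)
      qed
      finally show "G x * indicator W x = (\<integral>\<^sup>+y. f (merge old new (x, y)) * indicator W' (merge old new (x, y)) \<partial>Leb new)" .
    qed
    also have "\<dots> = (\<integral>\<^sup>+x. f x * indicator W' x \<partial>Leb ?J)"
      by (rule Leb.product_nn_integral_fold[OF old_new_disjoint(1) finite_old finite_new, symmetric]) (use f W'm in simp)
    finally show ?thesis .
  qed
  \<comment> \<open>a log-odds is the logarithm of the share divided by the share of the reference member\<close>
  define \<Psi>' where "\<Psi>' z = T (\<lambda>x\<in>?J. if x \<in> new then ln (z x / (t (\<Psi> (restrict z old)) (sep x) - (\<Sum>y | y \<in> new \<and> sep y = sep x. z y)))
      else \<Psi> (restrict z old) x)" for z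
  have \<Psi>'m: "\<Psi>' \<in> measurable (Leb ?J) (Leb ?J)"
    unfolding \<Psi>'_def
  proof (rule measurable_compose[OF measurable_Leb_restrict Tm])
    fix x assume x: "x \<in> ?J"
    show "(\<lambda>z. if x \<in> new then ln (z x / (t (\<Psi> (restrict z old)) (sep x) - (\<Sum>y | y \<in> new \<and> sep y = sep x. z y)))
      else \<Psi> (restrict z old) x) \<in> borel_measurable (Leb ?J)"
    proof (cases "x \<in> new")
      case True
      have "(\<lambda>z. ln (z x / (t (\<Psi> (restrict z old)) (sep x) - (\<Sum>y | y \<in> new \<and> sep y = sep x. z y)))) \<in> borel_measurable (Leb ?J)"
        by (intro borel_measurable_ln borel_measurable_divide borel_measurable_diff borel_measurable_sum
            measurable_Leb_component measurable_compose[OF measurable_compose[OF r_old \<Psi>m] tm]) (use True in auto)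
      then show ?thesis using True by simp
    next
      case False
      then have "x \<in> old" using x by simp
      then show ?thesis using False borel_measurable_component_Leb[OF measurable_compose[OF r_old \<Psi>m]] by simp
    qed
  qed
  have \<Psi>'_inv: "\<Psi>' (?X' \<theta>) = \<theta>" if \<theta>: "\<theta> \<in> space (Leb ?J)" for \<theta>
  proof -
    let ?u = "restrict (reparam \<theta>) old"
    have \<Psi>u: "\<Psi> (restrict (?X' \<theta>) old) = ?u" unfolding X'_old by (rule \<Psi>[OF u_space])
    have "(\<lambda>x\<in>?J. if x \<in> new then ln (?X' \<theta> x / (t (\<Psi> (restrict (?X' \<theta>) old)) (sep x) - (\<Sum>y | y \<in> new \<and> sep y = sep x. ?X' \<theta> y)))
      else \<Psi> (restrict (?X' \<theta>) old) x) = reparam \<theta>"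
    proof
      fix x
      show "(\<lambda>x\<in>?J. if x \<in> new then ln (?X' \<theta> x / (t (\<Psi> (restrict (?X' \<theta>) old)) (sep x) - (\<Sum>y | y \<in> new \<and> sep y = sep x. ?X' \<theta> y)))
        else \<Psi> (restrict (?X' \<theta>) old) x) x = reparam \<theta> x"
      proof (cases "x \<in> new")
        case True
        have "?X' \<theta> x = restrict (?X' \<theta>) new x" using True by simp
        also have "\<dots> = t ?u (sep x) * exp (log_odds \<theta> x) / total \<theta> (sep x)"
          unfolding X'_new softmax_reparam using True by (simp add: block_softmax_def)
        finally have "?X' \<theta> x / (t ?u (sep x) - (\<Sum>y | y \<in> new \<and> sep y = sep x. ?X' \<theta> y)) = exp (log_odds \<theta> x)"
          unfolding block_sum using tpos[OF sep_cells[OF True], of ?u] odds_total_pos[of new sep "log_odds \<theta>" "sep x"] by simp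
        then show ?thesis using True by (simp add: \<Psi>u reparam_def)
      next
        case False
        then show ?thesis by (simp add: \<Psi>u) (simp add: reparam_def)
      qed
    qed
    then show ?thesis unfolding \<Psi>'_def using T[OF \<theta>] by (simp only:)
  qed
  show ?thesis
    unfolding lebesgue_chart_def star_coords_Un[symmetric]
    unfolding star_coords_Un
    using \<Psi>'m \<Psi>'_inv W'm X'_W' int' by blast
qed

end

section \<open>Kernel, Jacobian and integral of an added clique\<close>

context gluing
begin

text \<open>
  The logarithm of a \<open>C\<close>-probability is that of its \<open>S\<close>-marginal, minus \<open>ln (total \<theta>)\<close>, plus the
  log-odds.  The first two depend on the restriction to \<open>S\<close> only, so the hyperparameters of \<open>C\<close> may be
  summed over the blocks, where they give those of \<open>S\<close>.
\<close>
lemma clique_kernel: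
  "(\<Prod>x\<in>new. exp (table_hyper s C (fill x) * log_odds \<theta> x)) / (\<Prod>b\<in>cells L S. total \<theta> b powr table_hyper s S b)
   = (\<Prod>c\<in>cells L C. marginal L (\<D> \<union> new_sets) (H \<union> C) \<theta> C c powr table_hyper s C c)
     / (\<Prod>b\<in>cells L S. marginal L (\<D> \<union> new_sets) (H \<union> C) \<theta> S b powr table_hyper s S b)"
proof -
  let ?P = "marginal L (\<D> \<union> new_sets) (H \<union> C) \<theta>" and ?h = "table_hyper s"
  have finS: "finite (cells L S)" and finC: "finite (cells L C)" using finite_cells[OF S_subsets(1)] finite_cells[OF C] by auto
  define r where "r b = ln (?P S b) - ln (total \<theta> b)" for b
  have PS: "0 < ?P S b" if "b \<in> cells L S" for b by (rule marginal_pos[OF U _ that]) auto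
  have PC: "0 < ?P C c" if "c \<in> cells L C" for c by (rule marginal_pos[OF U _ that]) auto
  have tot: "0 < total \<theta> b" for b by (rule odds_total_pos)
  have PS_eq: "marginal L \<D> H (absorb \<theta>) S b = ?P S b" for b by (rule marginal_old[symmetric]) auto
  have ext: "ln (?P C (zero_fill C S b)) = r b" if "b \<in> cells L S" for b
    using PS[OF that] tot[of b] by (simp add: marginal_ext[OF that] PS_eq r_def ln_div)
  have new: "ln (?P C (fill x)) = r (sep x) + log_odds \<theta> x" if "x \<in> new" for x
  proof -
    have "?P C (fill x) = ?P S (sep x) * exp (log_odds \<theta> x) / total \<theta> (sep x)"
      using that by (simp add: marginal_clique fill_cells restrict_fill clique_factor_fill PS_eq)
    then show ?thesis
      using PS[OF sep_cells[OF that]] tot[of "sep x"] by (simp add: r_def ln_div ln_mult_pos)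
  qed
  have "(\<Sum>c\<in>cells L C. ?h C c * ln (?P C c))
      = (\<Sum>b\<in>cells L S. ?h C (zero_fill C S b) * r b) + (\<Sum>x\<in>new. ?h C (fill x) * (r (sep x) + log_odds \<theta> x))"
    unfolding sum_cells_split by (intro arg_cong2[of _ _ _ _ "(+)"] sum.cong refl) (simp_all only: ext new)
  also have "\<dots> = (\<Sum>c\<in>cells L C. ?h C c * r (restrict c S)) + (\<Sum>x\<in>new. ?h C (fill x) * log_odds \<theta> x)"
  proof -
    have "(\<Sum>c\<in>cells L C. ?h C c * r (restrict c S)) = (\<Sum>b\<in>cells L S. ?h C (zero_fill C S b) * r b) + (\<Sum>x\<in>new. ?h C (fill x) * r (sep x))"
      unfolding sum_cells_split by (intro arg_cong2[of _ _ _ _ "(+)"] sum.cong refl) (simp_all only: restrict_ext restrict_fill)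
    then show ?thesis by (simp add: distrib_left sum.distrib)
  qed
  also have "(\<Sum>c\<in>cells L C. ?h C c * r (restrict c S)) = (\<Sum>b\<in>cells L S. ?h S b * r b)"
  proof -
    have "(\<Sum>c\<in>cells L C. ?h C c * r (restrict c S)) = (\<Sum>c | c \<in> cells L C \<and> restrict c S \<in> cells L S. ?h C c * r (restrict c S))"
      by (rule sum.cong) (auto intro: restrict_cells[OF _ S_subsets(2)])
    also have "\<dots> = (\<Sum>b\<in>cells L S. \<Sum>c | c \<in> cells L C \<and> restrict c S = b. ?h C c * r (restrict c S))"
      by (rule sum_fibres[OF finC finS, symmetric])
    also have "\<dots> = (\<Sum>b\<in>cells L S. (\<Sum>c | c \<in> cells L C \<and> restrict c S = b. ?h C c) * r b)"
      unfolding sum_distrib_right by (intro sum.cong refl) auto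
    also have "\<dots> = (\<Sum>b\<in>cells L S. ?h S b * r b)"
      by (rule sum.cong[OF refl]) (simp only: sum_table_hyper_fibre[OF C S_subsets(2)])
    finally show ?thesis .
  qed
  finally have "(\<Sum>c\<in>cells L C. ?h C c * ln (?P C c)) - (\<Sum>b\<in>cells L S. ?h S b * ln (?P S b))
      = (\<Sum>x\<in>new. ?h C (fill x) * log_odds \<theta> x) - (\<Sum>b\<in>cells L S. ?h S b * ln (total \<theta> b))"
    by (simp add: r_def right_diff_distrib sum_subtractf)
  moreover have "(\<Prod>b\<in>B. f b powr g b) = exp (\<Sum>b\<in>B. g b * ln (f b))" if "finite B" "\<And>b. b \<in> B \<Longrightarrow> 0 < f b"
    for B and f g :: "('v \<Rightarrow> 'l) \<Rightarrow> real"
    unfolding exp_sum[OF that(1)] by (rule prod.cong[OF refl]) (use that(2) in \<open>force simp: powr_def\<close>)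
  ultimately show ?thesis
    using finS finC PS PC tot by (simp add: exp_sum[OF finite_new, symmetric] exp_diff[symmetric])
qed

lemma clique_jacobian:
  "(\<Prod>c\<in>cells L C. marginal L (\<D> \<union> new_sets) (H \<union> C) \<theta> C c) / (\<Prod>b\<in>cells L S. marginal L (\<D> \<union> new_sets) (H \<union> C) \<theta> S b)
   = (\<Prod>x\<in>new. marginal L (\<D> \<union> new_sets) (H \<union> C) \<theta> C (fill x)) * (\<Prod>b\<in>cells L S. 1 / total \<theta> b)"
proof -
  let ?P = "marginal L (\<D> \<union> new_sets) (H \<union> C) \<theta>"
  have PS: "0 < ?P S b" if "b \<in> cells L S" for b by (rule marginal_pos[OF U _ that]) auto
  then have nz: "(\<Prod>b\<in>cells L S. ?P S b) \<noteq> 0" using finite_cells[OF S_subsets(1)] by (auto simp: less_imp_neq[symmetric])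
  have "(\<Prod>b\<in>cells L S. ?P C (zero_fill C S b)) = (\<Prod>b\<in>cells L S. ?P S b * (1 / total \<theta> b))"
    by (rule prod.cong[OF refl]) (simp add: marginal_ext marginal_old)
  then show ?thesis
    unfolding prod_cells_split prod.distrib using nz by simp
qed

text \<open>
  Setting the level of a vertex outside \<open>H\<close> to a nonzero value gives a member of the block of \<open>b\<close> other
  than the reference member.
\<close>
lemma fibre_nonempty:
  assumes \<gamma>: "\<gamma> \<in> C" "\<gamma> \<notin> H" and \<nu>: "\<nu> \<in> L \<gamma>" "\<nu> \<noteq> 0" and b: "b \<in> cells L S"
  shows "b \<in> sep ` new"
proof -
  define c where "c = (zero_fill C S b)(\<gamma> := \<nu>)"
  have c: "c \<in> cells L C"
    using ext_cells[OF b] \<gamma> \<nu> by (auto simp: c_def cells_def PiE_def Pi_def extensional_def)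
  define x where "x = (support C c, restrict c (support C c))"
  have "\<gamma> \<in> support C c" using \<gamma> \<nu> by (simp add: support_def c_def)
  then have x: "x \<in> new"
    using full_coordsI[OF c] \<gamma> by (auto simp: x_def star_coords_def full_coords_def)
  have "fill x = c" using zero_fill_support_restrict[OF c] by (simp add: fill_def x_def)
  then have "sep x = restrict c S" using restrict_fill[OF x] by simp
  also have "\<dots> = restrict (zero_fill C S b) S" using \<gamma> by (auto simp: c_def fun_eq_iff restrict_def)
  also have "\<dots> = b" by (rule restrict_ext[OF b])
  finally show ?thesis using x by blast
qed

text \<open>
  The parameter of the reference member of a block is again a hyperparameter of \<open>C\<close>.
\<close>
lemma hyper_block:
  assumes b: "b \<in> cells L S"
  shows "table_hyper s S b - (\<Sum>x | x \<in> new \<and> sep x = b. table_hyper s C (fill x)) = table_hyper s C (zero_fill C S b)"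
  using sum_table_hyper_fibre[OF C S_subsets(2) b, of s] sum_fibre_split[OF b, of "table_hyper s C"] by simp

text \<open>
  A cell is either a new coordinate or the reference member of a block, and no block consists of its
  reference member alone.
\<close>
lemma clique_hyper_pos:
  assumes fin: "block_dirichlet_integral new sep (cells L S) (\<lambda>x. table_hyper s C (fill x)) (table_hyper s S) < \<infinity>"
    and \<gamma>: "\<gamma> \<in> C" "\<gamma> \<notin> H" and \<nu>: "\<nu> \<in> L \<gamma>" "\<nu> \<noteq> 0" and c: "c \<in> cells L C"
  shows "0 < table_hyper s C c"
proof -
  let ?D = "support C c"
  note fin_cells = finite_cells[OF S_subsets(1)]
  have sepB: "sep ` new \<subseteq> cells L S" using sep_cells by auto
  note pos = block_dirichlet_integral_finiteD[OF finite_new fin_cells sepB fin]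
  have x: "(?D, restrict c ?D) \<in> full_coords L C" by (rule full_coordsI[OF c])
  have fc: "fill (?D, restrict c ?D) = c" using zero_fill_support_restrict[OF c] by (simp add: fill_def)
  show ?thesis
  proof (cases "?D \<subseteq> H")
    case False
    then have "(?D, restrict c ?D) \<in> new" using x by (auto simp: star_coords_def full_coords_def)
    then show ?thesis using pos fc by (metis (no_types, lifting))
  next
    case True
    then have D: "?D \<subseteq> S" using support_subset[of C c] by blast
    have b: "restrict c S \<in> cells L S" by (rule restrict_cells[OF c S_subsets(2)])
    have "zero_fill C S (restrict c S) = c"
    proof
      fix \<delta>
      show "zero_fill C S (restrict c S) \<delta> = c \<delta>"
        using D cells_extensional[OF c] by (auto simp: zero_fill_def support_def extensional_def restrict_def)
    qed
    moreover have "0 < table_hyper s S (restrict c S) - (\<Sum>x | x \<in> new \<and> sep x = restrict c S. table_hyper s C (fill x))"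
      using pos fibre_nonempty[OF \<gamma> \<nu> b] by blast
    ultimately show ?thesis by (simp only: hyper_block[OF b])
  qed
qed

lemma sep_hyper_pos:
  assumes "\<And>c. c \<in> cells L C \<Longrightarrow> 0 < table_hyper s C c" and b: "b \<in> cells L S"
  shows "0 < table_hyper s S b"
  using hyper_block[OF b, of s] assms(1)[OF ext_cells[OF b]]
    sum_nonneg[of "{x. x \<in> new \<and> sep x = b}" "\<lambda>x. table_hyper s C (fill x)"] assms(1)[OF fill_cells]
  by (smt (verit, best) mem_Collect_eq)

lemma clique_integral:
  assumes pos: "\<And>c. c \<in> cells L C \<Longrightarrow> 0 < table_hyper s C c"
  shows "block_dirichlet_integral new sep (cells L S) (\<lambda>x. table_hyper s C (fill x)) (table_hyper s S)
    = ennreal ((\<Prod>c\<in>cells L C. Gamma (table_hyper s C c)) / (\<Prod>b\<in>cells L S. Gamma (table_hyper s S b)))"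
proof -
  have sepB: "sep ` new \<subseteq> cells L S" using sep_cells by auto
  have "block_dirichlet_integral new sep (cells L S) (\<lambda>x. table_hyper s C (fill x)) (table_hyper s S)
    = ennreal ((\<Prod>x\<in>new. Gamma (table_hyper s C (fill x))) * (\<Prod>b\<in>cells L S. Gamma (table_hyper s S b - (\<Sum>x | x \<in> new \<and> sep x = b. table_hyper s C (fill x))) / Gamma (table_hyper s S b)))"
    by (rule block_dirichlet_integral_eq[OF finite_new finite_cells[OF S_subsets(1)] sepB])
       (simp_all only: hyper_block pos fill_cells ext_cells)
  also have "(\<Prod>b\<in>cells L S. Gamma (table_hyper s S b - (\<Sum>x | x \<in> new \<and> sep x = b. table_hyper s C (fill x))) / Gamma (table_hyper s S b))
     = (\<Prod>b\<in>cells L S. Gamma (table_hyper s C (zero_fill C S b)) / Gamma (table_hyper s S b))"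
    by (rule prod.cong[OF refl]) (simp only: hyper_block)
  finally show ?thesis unfolding prod_cells_split by (simp add: prod_dividef mult.commute)
qed

end

section \<open>Perfect orders\<close>

text \<open>
  The running intersection property by itself, without a graph: the saturated model on a single set of
  vertices is an instance as well.
\<close>
locale clique_tower = finite_levels V L for V :: "'v set" and L :: "'v \<Rightarrow> 'l::zero set" +
  fixes C :: "nat \<Rightarrow> 'v set" and k :: nat
  assumes clique_sub: "\<And>l. l \<in> {1..k} \<Longrightarrow> C l \<subseteq> V"
    and running: "\<And>l. l \<in> {2..k} \<Longrightarrow> \<exists>i\<in>{1..<l}. separator C l \<subseteq> C i"
begin

definition covered :: "nat \<Rightarrow> 'v set" where "covered n = (\<Union>l\<in>{1..n}. C l)"

definition faces :: "nat \<Rightarrow> 'v set set" where "faces n = {D. D \<noteq> {} \<and> (\<exists>l\<in>{1..n}. D \<subseteq> C l)}"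

definition first_clique :: "'v set \<Rightarrow> 'v set" where "first_clique F = C (LEAST l. 1 \<le> l \<and> F \<subseteq> C l)"

abbreviation P :: "nat \<Rightarrow> (('v, 'l) coord \<Rightarrow> real) \<Rightarrow> 'v set \<Rightarrow> ('v \<Rightarrow> 'l) \<Rightarrow> real" where
  "P n \<equiv> marginal L (faces n) (covered n)"

text \<open>
  The first separator is empty, and its factor is the total probability 1.
\<close>
definition jac :: "nat \<Rightarrow> (('v, 'l) coord \<Rightarrow> real) \<Rightarrow> real" where
  "jac n \<theta> = (\<Prod>l\<in>{1..n}. (\<Prod>c\<in>cells L (C l). P n \<theta> (C l) c) / (\<Prod>b\<in>cells L (separator C l). P n \<theta> (separator C l) b))"

lemma covered_Suc: "covered (Suc n) = covered n \<union> C (Suc n)"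
  by (auto simp: covered_def atLeastAtMostSuc_conv)

lemma separator_Suc: "separator C (Suc n) = C (Suc n) \<inter> covered n"
  by (auto simp: separator_def covered_def atLeastLessThanSuc_atLeastAtMost)

lemma covered_sub: "n \<le> k \<Longrightarrow> covered n \<subseteq> V"
  unfolding covered_def using clique_sub by (intro UN_least) auto

text \<open>
  This is where the running intersection property enters: a nonempty subset of the separator lies in one
  of the earlier cliques.
\<close>
lemma separator_face:
  assumes n: "Suc n \<le> k" and F: "F \<subseteq> C (Suc n) \<inter> covered n" "F \<noteq> {}"
  shows "F \<in> faces n"
proof -
  have "n \<noteq> 0" using F by (auto simp: covered_def)
  then have "Suc n \<in> {2..k}" using n by auto
  from running[OF this] obtain i where i: "i \<in> {1..<Suc n}" "separator C (Suc n) \<subseteq> C i" by blast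
  have "F \<subseteq> C i" using F(1) i(2) unfolding separator_Suc by (rule order_trans)
  moreover have "i \<in> {1..n}" using i(1) by auto
  ultimately show ?thesis using F(2) by (auto simp: faces_def)
qed

lemma faces_Suc:
  assumes n: "Suc n \<le> k"
  shows "faces (Suc n) = faces n \<union> {F. F \<subseteq> C (Suc n) \<and> \<not> F \<subseteq> covered n}"
proof
  show "faces (Suc n) \<subseteq> faces n \<union> {F. F \<subseteq> C (Suc n) \<and> \<not> F \<subseteq> covered n}"
  proof
    fix F assume "F \<in> faces (Suc n)"
    then have F: "F \<noteq> {}" "(\<exists>l\<in>{1..n}. F \<subseteq> C l) \<or> F \<subseteq> C (Suc n)" by (auto simp: faces_def atLeastAtMostSuc_conv)
    show "F \<in> faces n \<union> {F. F \<subseteq> C (Suc n) \<and> \<not> F \<subseteq> covered n}"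
    proof (cases "\<exists>l\<in>{1..n}. F \<subseteq> C l")
      case True
      then show ?thesis using F(1) by (simp add: faces_def)
    next
      case False
      then have FC: "F \<subseteq> C (Suc n)" using F(2) by blast
      show ?thesis
      proof (cases "F \<subseteq> covered n")
        case True
        then show ?thesis using separator_face[OF n _ F(1)] FC by blast
      qed (use FC in simp)
    qed
  qed
  show "faces n \<union> {F. F \<subseteq> C (Suc n) \<and> \<not> F \<subseteq> covered n} \<subseteq> faces (Suc n)"
    by (auto simp: faces_def atLeastAtMostSuc_conv)
qed

lemma faces_sub: "D \<in> faces n \<Longrightarrow> D \<subseteq> covered n \<and> D \<noteq> {}"
  by (auto simp: faces_def covered_def)

lemma gluing_step: "Suc n \<le> k \<Longrightarrow> gluing V L (faces n) (covered n) (C (Suc n))"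
  using covered_sub[of n] clique_sub[of "Suc n"] faces_sub[of _ n]
  by unfold_locales (auto intro: separator_face)

lemma first_clique_is_clique:
  assumes "D \<in> faces n"
  shows "\<exists>l\<in>{1..n}. first_clique D = C l \<and> D \<subseteq> C l"
proof -
  obtain l where l: "1 \<le> l" "l \<le> n" "D \<subseteq> C l" using assms by (auto simp: faces_def)
  let ?m = "LEAST l. 1 \<le> l \<and> D \<subseteq> C l"
  have "1 \<le> ?m \<and> D \<subseteq> C ?m" using l by (intro LeastI[of "\<lambda>l. 1 \<le> l \<and> D \<subseteq> C l" l]) simp
  moreover have "?m \<le> l" using l by (intro Least_le) simp
  ultimately have "?m \<in> {1..n}" "D \<subseteq> C ?m" using l by auto
  then show ?thesis unfolding first_clique_def by blast
qed

lemma first_clique_sub: "D \<in> faces n \<Longrightarrow> first_clique D \<subseteq> covered n \<and> D \<subseteq> first_clique D"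
  using first_clique_is_clique[of D n] unfolding covered_def by blast

lemma first_clique_new:
  assumes "F \<subseteq> C (Suc n)" "\<not> F \<subseteq> covered n"
  shows "first_clique F = C (Suc n)"
proof -
  have "(LEAST l. 1 \<le> l \<and> F \<subseteq> C l) = Suc n"
  proof (rule Least_equality)
    fix l assume "1 \<le> l \<and> F \<subseteq> C l"
    then show "Suc n \<le> l" using assms(2) by (auto simp: covered_def not_less_eq_eq)
  qed (use assms in simp)
  then show ?thesis by (simp add: first_clique_def)
qed

lemma clique_in_covered: "l \<in> {1..n} \<Longrightarrow> C l \<subseteq> covered n" "l \<in> {1..n} \<Longrightarrow> separator C l \<subseteq> covered n"
  unfolding covered_def separator_def by blast+

lemma jac_pos: "n \<le> k \<Longrightarrow> 0 < jac n \<theta>"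
  unfolding jac_def by (intro prod_pos ballI divide_pos_pos marginal_pos covered_sub clique_in_covered) auto

lemma jac_cong: "(\<And>x. x \<in> star_coords L (faces n) \<Longrightarrow> \<theta> x = \<theta>' x) \<Longrightarrow> jac n \<theta> = jac n \<theta>'"
  unfolding jac_def using log_linear_cong(3)[of L "faces n" \<theta> \<theta>' "covered n"] by simp

lemma jac_measurable: "n \<le> k \<Longrightarrow> jac n \<in> borel_measurable (Leb (star_coords L (faces n)))"
  unfolding jac_def by (intro borel_measurable_prod borel_measurable_divide log_linear_measurable covered_sub)

lemma empty_model: "faces 0 = {}" "covered 0 = {}"
  by (simp_all add: faces_def covered_def)

lemma tower_chart:
  "n \<le> k \<Longrightarrow> lebesgue_chart (star_coords L (faces n)) (host_marginals L (faces n) (covered n) first_clique) (jac n)"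
proof (induction n)
  case 0
  have J: "star_coords L (faces 0) = {}" by (simp add: empty_model star_coords_def)
  have sp: "space (Leb {}) = {\<lambda>_::('v, 'l) coord. undefined}" by (auto simp: space_Leb extensional_def)
  have X: "host_marginals L (faces 0) (covered 0) first_clique = (\<lambda>\<theta> _. undefined)"
    by (simp add: host_marginals_def J fun_eq_iff)
  have jac0: "jac 0 = (\<lambda>_. 1)" by (simp add: jac_def fun_eq_iff)
  have id: "(\<lambda>x. x) \<in> measurable (Leb {}) (Leb ({} :: ('v, 'l) coord set))" by simp
  have "(\<integral>\<^sup>+\<theta>. f (\<lambda>_. undefined) * ennreal 1 \<partial>Leb ({} :: ('v, 'l) coord set)) = (\<integral>\<^sup>+x. f x * indicator (space (Leb {})) x \<partial>Leb {})"
    for f :: "(('v, 'l) coord \<Rightarrow> real) \<Rightarrow> ennreal"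
    by (rule nn_integral_cong) (simp add: sp)
  moreover have "{\<lambda>_. undefined} \<in> sets (Leb ({} :: ('v, 'l) coord set))"
    using sets.top[of "Leb ({} :: ('v, 'l) coord set)"] by (simp only: sp)
  ultimately show ?case
    unfolding J X jac0 lebesgue_chart_def using id by (intro conjI bexI[of _ "\<lambda>x. x"] bexI[of _ "space (Leb {})"]) (auto simp: sp)
next
  case (Suc n)
  interpret gluing V L "faces n" "covered n" "C (Suc n)" by (rule gluing_step[OF Suc.prems])
  have n: "n \<le> k" using Suc.prems by simp
  have sep_eq: "C (Suc n) \<inter> covered n = separator C (Suc n)" by (rule separator_Suc[symmetric])
  have "lebesgue_chart (old \<union> new) (host_marginals L (faces n \<union> new_sets) (covered n \<union> C (Suc n)) first_clique) (jac (Suc n))"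
  proof (rule lebesgue_chart_glue[OF Suc.IH[OF n]])
    fix \<theta>
    have old: "P (Suc n) \<theta> A = P n (absorb \<theta>) A" if "A \<subseteq> covered n" for A
      using marginal_old[OF that] by (simp add: fun_eq_iff faces_Suc[OF Suc.prems] covered_Suc)
    have "jac (Suc n) \<theta> = (\<Prod>l\<in>{1..n}. (\<Prod>c\<in>cells L (C l). P (Suc n) \<theta> (C l) c) / (\<Prod>b\<in>cells L (separator C l). P (Suc n) \<theta> (separator C l) b))
       * ((\<Prod>c\<in>cells L (C (Suc n)). P (Suc n) \<theta> (C (Suc n)) c) / (\<Prod>b\<in>cells L (separator C (Suc n)). P (Suc n) \<theta> (separator C (Suc n)) b))"
      unfolding jac_def by (simp add: atLeastAtMostSuc_conv mult.commute)
    also have "(\<Prod>l\<in>{1..n}. (\<Prod>c\<in>cells L (C l). P (Suc n) \<theta> (C l) c) / (\<Prod>b\<in>cells L (separator C l). P (Suc n) \<theta> (separator C l) b)) = jac n (absorb \<theta>)"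
      unfolding jac_def by (rule prod.cong[OF refl]) (simp only: old clique_in_covered)
    also have "(\<Prod>c\<in>cells L (C (Suc n)). P (Suc n) \<theta> (C (Suc n)) c) / (\<Prod>b\<in>cells L (separator C (Suc n)). P (Suc n) \<theta> (separator C (Suc n)) b)
       = (\<Prod>x\<in>new. P (Suc n) \<theta> (C (Suc n)) (fill x)) * (\<Prod>b\<in>cells L S. 1 / total \<theta> b)"
      using clique_jacobian[of \<theta>] by (simp only: faces_Suc[OF Suc.prems] covered_Suc sep_eq)
    finally show "jac (Suc n) \<theta> = jac n (absorb \<theta>)
        * ((\<Prod>x\<in>new. marginal L (faces n \<union> new_sets) (covered n \<union> C (Suc n)) \<theta> (C (Suc n)) (fill x)) * (\<Prod>b\<in>cells L S. 1 / total \<theta> b))"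
      by (simp only: faces_Suc[OF Suc.prems] covered_Suc)
  qed (use first_clique_sub first_clique_new jac_measurable[OF n] jac_pos[OF n] in \<open>auto intro: jac_cong less_imp_le\<close>)
  then show ?case by (simp only: faces_Suc[OF Suc.prems] covered_Suc star_coords_Un)
qed

lemma tower_kernel:
  "n \<le> k \<Longrightarrow> model_kernel L (faces n) (covered n) s \<alpha> \<theta>
     = (\<Prod>l\<in>{1..n}. (\<Prod>c\<in>cells L (C l). P n \<theta> (C l) c powr table_hyper (extend_hyper s \<alpha>) (C l) c)
         / (\<Prod>b\<in>cells L (separator C l). P n \<theta> (separator C l) b powr table_hyper (extend_hyper s \<alpha>) (separator C l) b))"
proof (induction n arbitrary: \<theta>)
  case 0
  have "cells L {} = {\<lambda>_. undefined}" by (simp add: cells_def)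
  then show ?case by (simp add: empty_model model_kernel_def star_coords_def normalizer_def weight_def)
next
  case (Suc n)
  let ?h = "table_hyper (extend_hyper s \<alpha>)"
  interpret gluing V L "faces n" "covered n" "C (Suc n)" by (rule gluing_step[OF Suc.prems])
  have n: "n \<le> k" using Suc.prems by simp
  have sep_eq: "C (Suc n) \<inter> covered n = separator C (Suc n)" by (rule separator_Suc[symmetric])
  have old: "P (Suc n) \<theta> A = P n (absorb \<theta>) A" if "A \<subseteq> covered n" for A
    using marginal_old[OF that] by (simp add: fun_eq_iff faces_Suc[OF Suc.prems] covered_Suc)
  have "model_kernel L (faces (Suc n)) (covered (Suc n)) s \<alpha> \<theta>
      = model_kernel L (faces n) (covered n) s \<alpha> (absorb \<theta>)
        * ((\<Prod>c\<in>cells L (C (Suc n)). P (Suc n) \<theta> (C (Suc n)) c powr ?h (C (Suc n)) c)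
         / (\<Prod>b\<in>cells L (separator C (Suc n)). P (Suc n) \<theta> (separator C (Suc n)) b powr ?h (separator C (Suc n)) b))"
    using model_kernel_glue[of s \<alpha> \<theta>] unfolding clique_kernel by (simp only: faces_Suc[OF Suc.prems] covered_Suc sep_eq)
  also have "model_kernel L (faces n) (covered n) s \<alpha> (absorb \<theta>)
     = (\<Prod>l\<in>{1..n}. (\<Prod>c\<in>cells L (C l). P (Suc n) \<theta> (C l) c powr ?h (C l) c) / (\<Prod>b\<in>cells L (separator C l). P (Suc n) \<theta> (separator C l) b powr ?h (separator C l) b))"
    unfolding Suc.IH[OF n] by (rule prod.cong[OF refl]) (simp only: old clique_in_covered)
  finally show ?case by (simp add: atLeastAtMostSuc_conv mult.commute)
qed

text \<open>
  The integrals of the smaller model and of the added clique are both nonzero, so a finite product has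
  finite factors; for this reason the induction includes that the integral does not vanish.
\<close>
lemma tower_integral:
  fixes s :: "('v, 'l) coord \<Rightarrow> real" and \<alpha> :: real
  assumes new: "\<And>l. l \<in> {1..k} \<Longrightarrow> \<exists>\<gamma>\<in>C l. \<gamma> \<notin> (\<Union>j\<in>{1..<l}. C j) \<and> (\<exists>\<nu>\<in>L \<gamma>. \<nu> \<noteq> 0)"
  defines "I \<equiv> \<lambda>n. \<integral>\<^sup>+\<theta>. ennreal (model_kernel L (faces n) (covered n) s \<alpha> \<theta>) \<partial>Leb (star_coords L (faces n))"
  shows "n \<le> k \<Longrightarrow> I n \<noteq> 0 \<and> (I n < \<infinity> \<longrightarrow>
      (\<forall>l\<in>{1..n}. (\<forall>c\<in>cells L (C l). 0 < table_hyper (extend_hyper s \<alpha>) (C l) c)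
            \<and> (\<forall>b\<in>cells L (separator C l). 0 < table_hyper (extend_hyper s \<alpha>) (separator C l) b))
      \<and> I n = ennreal (\<Prod>l\<in>{1..n}. (\<Prod>c\<in>cells L (C l). Gamma (table_hyper (extend_hyper s \<alpha>) (C l) c))
             / (\<Prod>b\<in>cells L (separator C l). Gamma (table_hyper (extend_hyper s \<alpha>) (separator C l) b))))"
proof (induction n)
  case 0
  have "cells L {} = {\<lambda>_. undefined}" by (simp add: cells_def)
  then show ?case
    by (simp add: I_def empty_model model_kernel_def star_coords_def normalizer_def weight_def PiM_empty nn_integral_count_space_finite)
next
  case (Suc n)
  let ?h = "table_hyper (extend_hyper s \<alpha>)"
  interpret gluing V L "faces n" "covered n" "C (Suc n)" by (rule gluing_step[OF Suc.prems])
  have n: "n \<le> k" using Suc.prems by simp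
  have sep_eq: "C (Suc n) \<inter> covered n = separator C (Suc n)" by (rule separator_Suc[symmetric])
  let ?B = "block_dirichlet_integral new sep (cells L S) (\<lambda>x. ?h (C (Suc n)) (fill x)) (?h S)"
  have eq: "I (Suc n) = I n * ?B"
    using nn_integral_model_kernel_glue[of "\<lambda>_. 1" s \<alpha>] by (simp only: I_def mult_1 borel_measurable_const simp_thms faces_Suc[OF Suc.prems] covered_Suc star_coords_Un)
  have sepB: "sep ` new \<subseteq> cells L S" using sep_cells by auto
  have B0: "?B \<noteq> 0" by (rule block_dirichlet_integral_nonzero[OF finite_new finite_cells[OF S_subsets(1)] sepB])
  have I0: "I n \<noteq> 0" using Suc.IH[OF n] ..
  have nonzero: "I (Suc n) \<noteq> 0" using I0 B0 unfolding eq by simp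
  show ?case
  proof (rule conjI[OF nonzero], rule impI)
    assume fin: "I (Suc n) < \<infinity>"
    have "I n < \<infinity>" and B: "?B < \<infinity>"
      using fin I0 B0 unfolding eq by (auto simp: ennreal_mult_less_top)
    note IH = Suc.IH[OF n, THEN conjunct2, THEN mp, OF this(1)]
    obtain \<gamma> \<nu> where \<gamma>: "\<gamma> \<in> C (Suc n)" "\<gamma> \<notin> covered n" and \<nu>: "\<nu> \<in> L \<gamma>" "\<nu> \<noteq> 0"
      using new[of "Suc n"] Suc.prems by (auto simp: covered_def atLeastLessThanSuc_atLeastAtMost)
    have pos: "0 < ?h (C (Suc n)) c" if "c \<in> cells L (C (Suc n))" for c
      by (rule clique_hyper_pos[OF B \<gamma> \<nu> that])
    have posS: "0 < ?h (separator C (Suc n)) b" if "b \<in> cells L (separator C (Suc n))" for b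
      using sep_hyper_pos[OF pos, of b] that by (simp only: sep_eq)
    let ?g = "\<lambda>l. (\<Prod>c\<in>cells L (C l). Gamma (?h (C l) c)) / (\<Prod>b\<in>cells L (separator C l). Gamma (?h (separator C l) b))"
    have "?B = ennreal (?g (Suc n))"
      using clique_integral[of "extend_hyper s \<alpha>", OF pos] by (simp only: sep_eq)
    moreover have "0 \<le> ?g (Suc n)"
      using pos posS by (intro divide_nonneg_nonneg prod_nonneg ballI less_imp_le Gamma_real_pos) auto
    ultimately have "I (Suc n) = ennreal ((\<Prod>l\<in>{1..n}. ?g l) * ?g (Suc n))"
      using IH by (simp only: eq ennreal_mult'')
    then have "I (Suc n) = ennreal (\<Prod>l\<in>{1..Suc n}. ?g l)"
      by (simp add: atLeastAtMostSuc_conv mult.commute)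
    then show "(\<forall>l\<in>{1..Suc n}. (\<forall>c\<in>cells L (C l). 0 < ?h (C l) c) \<and> (\<forall>b\<in>cells L (separator C l). 0 < ?h (separator C l) b))
      \<and> I (Suc n) = ennreal (\<Prod>l\<in>{1..Suc n}. ?g l)"
      using IH pos posS by (simp add: atLeastAtMostSuc_conv)
  qed
qed

end

section \<open>Pushing densities through a chart\<close>

lemma lebesgue_chart_transform:
  assumes chart: "lebesgue_chart J X D"
    and Q: "Q \<in> measurable (Leb J) (Leb J)" and Q': "Q' \<in> measurable (Leb J) (Leb J)"
    and inv: "\<And>x. x \<in> space (Leb J) \<Longrightarrow> Q' (Q x) = x"
    and pres: "\<And>f. f \<in> borel_measurable (Leb J) \<Longrightarrow> (\<integral>\<^sup>+x. f (Q x) \<partial>Leb J) = (\<integral>\<^sup>+x. f x \<partial>Leb J)"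
    and X': "\<And>\<theta>. \<theta> \<in> space (Leb J) \<Longrightarrow> X' \<theta> = Q (X \<theta>)"
  shows "lebesgue_chart J X' D"
proof -
  obtain \<Psi> W where \<Psi>m: "\<Psi> \<in> measurable (Leb J) (Leb J)" and \<Psi>: "\<And>u. u \<in> space (Leb J) \<Longrightarrow> \<Psi> (X u) = u"
    and Wm: "W \<in> sets (Leb J)" and XW: "\<And>u. u \<in> space (Leb J) \<Longrightarrow> X u \<in> W"
    and int: "\<And>f. f \<in> borel_measurable (Leb J) \<Longrightarrow>
       (\<integral>\<^sup>+u. f (X u) * ennreal (D u) \<partial>Leb J) = (\<integral>\<^sup>+x. f x * indicator W x \<partial>Leb J)"
    using chart unfolding lebesgue_chart_def by blast
  have X_space: "X \<theta> \<in> space (Leb J)" if "\<theta> \<in> space (Leb J)" for \<theta>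
    using XW[OF that] sets.sets_into_space[OF Wm] by blast
  define W' where "W' = {x \<in> space (Leb J). Q' x \<in> W}"
  have W'm: "W' \<in> sets (Leb J)"
    unfolding W'_def by (rule measurable_sets_Collect[OF Q']) (use Wm in simp)
  have 1: "X' \<theta> \<in> W'" if "\<theta> \<in> space (Leb J)" for \<theta>
    using that XW X_space measurable_space[OF Q] by (simp add: W'_def X' inv)
  have 2: "(\<integral>\<^sup>+\<theta>. f (X' \<theta>) * ennreal (D \<theta>) \<partial>Leb J) = (\<integral>\<^sup>+x. f x * indicator W' x \<partial>Leb J)"
    if f: "f \<in> borel_measurable (Leb J)" for f
  proof -
    have "(\<integral>\<^sup>+\<theta>. f (X' \<theta>) * ennreal (D \<theta>) \<partial>Leb J) = (\<integral>\<^sup>+\<theta>. f (Q (X \<theta>)) * ennreal (D \<theta>) \<partial>Leb J)"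
      by (intro nn_integral_cong) (simp add: X')
    also have "\<dots> = (\<integral>\<^sup>+x. f (Q x) * indicator W x \<partial>Leb J)" by (rule int[OF measurable_compose[OF Q f]])
    also have "\<dots> = (\<integral>\<^sup>+x. f (Q x) * indicator W' (Q x) \<partial>Leb J)"
      by (intro nn_integral_cong) (use measurable_space[OF Q] in \<open>auto simp: W'_def inv indicator_def\<close>)
    also have "\<dots> = (\<integral>\<^sup>+x. f x * indicator W' x \<partial>Leb J)" by (rule pres) (use f W'm in simp)
    finally show ?thesis .
  qed
  have 3: "\<Psi> (Q' (X' \<theta>)) = \<theta>" if "\<theta> \<in> space (Leb J)" for \<theta>
    using that X_space by (simp add: X' inv \<Psi>)
  show ?thesis
    unfolding lebesgue_chart_def
    by (intro conjI bexI[OF _ measurable_compose[OF Q' \<Psi>m]] bexI[OF _ W'm] ballI 1 2 3)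
qed

text \<open>
  The image of \<open>X\<close> is measurable because it is the set where \<open>X \<circ> \<Psi>\<close> is the identity, and on it \<open>\<Psi>\<close> agrees
  with \<open>inv_into\<close>.
\<close>
lemma lebesgue_chart_density:
  assumes J: "finite J" and chart: "lebesgue_chart J X D" and Xm: "X \<in> measurable (Leb J) (Leb J)"
    and Dm: "D \<in> borel_measurable (Leb J)" and Km: "K \<in> borel_measurable (Leb J)"
  defines "g \<equiv> \<lambda>q. if q \<in> X ` space (Leb J) then K (inv_into (space (Leb J)) X q) else 0"
  shows "distr (density (Leb J) (\<lambda>\<theta>. K \<theta> * ennreal (D \<theta>))) (Leb J) X = density (Leb J) g"
    and "g \<in> borel_measurable (Leb J)"
proof -
  let ?O = "space (Leb J)"
  obtain \<Psi> W where \<Psi>m: "\<Psi> \<in> measurable (Leb J) (Leb J)" and \<Psi>: "\<And>u. u \<in> ?O \<Longrightarrow> \<Psi> (X u) = u"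
    and Wm: "W \<in> sets (Leb J)" and XW: "\<And>u. u \<in> ?O \<Longrightarrow> X u \<in> W"
    and int: "\<And>f. f \<in> borel_measurable (Leb J) \<Longrightarrow>
       (\<integral>\<^sup>+u. f (X u) * ennreal (D u) \<partial>Leb J) = (\<integral>\<^sup>+x. f x * indicator W x \<partial>Leb J)"
    using chart unfolding lebesgue_chart_def by blast
  define Im where "Im = X ` ?O"
  have im_iff: "q \<in> Im \<longleftrightarrow> X (\<Psi> q) = q" if "q \<in> ?O" for q
  proof
    assume "q \<in> Im"
    then obtain u where "u \<in> ?O" "q = X u" by (auto simp: Im_def)
    then show "X (\<Psi> q) = q" by (simp add: \<Psi>)
  next
    assume "X (\<Psi> q) = q"
    then show "q \<in> Im"
      using imageI[OF measurable_space[OF \<Psi>m that], of X] by (simp add: Im_def)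
  qed
  have Im_sub: "Im \<subseteq> W" "Im \<subseteq> ?O" using XW measurable_space[OF Xm] by (auto simp: Im_def)
  have "Im = {q \<in> ?O. \<forall>j\<in>J. X (\<Psi> q) j = q j}"
  proof -
    have "X (\<Psi> q) = q \<longleftrightarrow> (\<forall>j\<in>J. X (\<Psi> q) j = q j)" if q: "q \<in> ?O" for q
      using measurable_space[OF Xm measurable_space[OF \<Psi>m q]] q
      by (auto simp: space_Leb intro: extensionalityI[of _ J])
    then show ?thesis using im_iff Im_sub by auto
  qed
  also have "\<dots> \<in> sets (Leb J)"
    using J by (intro sets.sets_Collect_finite_All borel_measurable_eq
        borel_measurable_component_Leb[OF measurable_compose[OF \<Psi>m Xm]] measurable_Leb_component)
  finally have Imm: "Im \<in> sets (Leb J)" .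
  have g_eq: "g q = K (\<Psi> q) * indicator Im q" if q: "q \<in> ?O" for q
  proof (cases "q \<in> Im")
    case True
    have "X (inv_into ?O X q) = q" "inv_into ?O X q \<in> ?O"
      using True by (simp_all add: Im_def f_inv_into_f inv_into_into)
    then have "\<Psi> q = inv_into ?O X q" using \<Psi> by metis
    then show ?thesis using True by (simp add: g_def Im_def[symmetric])
  next
    case False
    then show ?thesis by (simp add: g_def Im_def[symmetric])
  qed
  have K\<Psi>: "(\<lambda>q. K (\<Psi> q)) \<in> borel_measurable (Leb J)" by (rule measurable_compose[OF \<Psi>m Km])
  have "(\<lambda>q. K (\<Psi> q) * indicator Im q) \<in> borel_measurable (Leb J)" using K\<Psi> Imm by simp
  then show gm: "g \<in> borel_measurable (Leb J)" by (subst measurable_cong[OF g_eq])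
  \<comment> \<open>\<open>W\<close> is not claimed to be the image, but the integral formula forces it to be so up to a null set\<close>
  have "(\<integral>\<^sup>+x. indicator (?O - Im) x * indicator W x \<partial>Leb J) = (\<integral>\<^sup>+\<theta>. indicator (?O - Im) (X \<theta>) * ennreal (D \<theta>) \<partial>Leb J)"
    by (rule int[symmetric]) (use Imm in simp)
  also have "\<dots> = (\<integral>\<^sup>+\<theta>. 0 \<partial>Leb J)" by (intro nn_integral_cong) (auto simp: Im_def)
  finally have "(\<integral>\<^sup>+x. indicator (?O - Im) x * indicator W x \<partial>Leb J) = 0" by simp
  then have ae0: "AE x in Leb J. indicator (?O - Im) x * indicator W x = (0::ennreal)"
    by (subst (asm) nn_integral_0_iff_AE) (use Imm Wm in auto)
  have ae: "AE x in Leb J. (indicator W x :: ennreal) = indicator Im x"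
    using ae0 AE_space by eventually_elim (use Im_sub in \<open>auto simp: indicator_def split: if_splits\<close>)
  show "distr (density (Leb J) (\<lambda>\<theta>. K \<theta> * ennreal (D \<theta>))) (Leb J) X = density (Leb J) g"
  proof (rule measure_eqI)
    fix A assume "A \<in> sets (distr (density (Leb J) (\<lambda>\<theta>. K \<theta> * ennreal (D \<theta>))) (Leb J) X)"
    then have A: "A \<in> sets (Leb J)" by simp
    have KD: "(\<lambda>\<theta>. K \<theta> * ennreal (D \<theta>)) \<in> borel_measurable (Leb J)" using Km Dm by simp
    have XA: "X -` A \<inter> ?O \<in> sets (Leb J)" by (rule measurable_sets[OF Xm A])
    have "emeasure (distr (density (Leb J) (\<lambda>\<theta>. K \<theta> * ennreal (D \<theta>))) (Leb J) X) A
        = emeasure (density (Leb J) (\<lambda>\<theta>. K \<theta> * ennreal (D \<theta>))) (X -` A \<inter> ?O)"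
      using Xm A by (subst emeasure_distr) auto
    also have "\<dots> = (\<integral>\<^sup>+\<theta>. K \<theta> * ennreal (D \<theta>) * indicator (X -` A \<inter> ?O) \<theta> \<partial>Leb J)"
      by (rule emeasure_density[OF KD XA])
    also have "\<dots> = (\<integral>\<^sup>+\<theta>. (K (\<Psi> (X \<theta>)) * indicator A (X \<theta>)) * ennreal (D \<theta>) \<partial>Leb J)"
      by (intro nn_integral_cong) (auto simp: \<Psi> indicator_def mult_ac)
    also have "\<dots> = (\<integral>\<^sup>+x. (K (\<Psi> x) * indicator A x) * indicator W x \<partial>Leb J)"
      by (rule int) (use K\<Psi> A in simp)
    also have "\<dots> = (\<integral>\<^sup>+x. g x * indicator A x \<partial>Leb J)"
      by (rule nn_integral_cong_AE, use ae AE_space in eventually_elim) (simp add: g_eq mult_ac)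
    also have "\<dots> = emeasure (density (Leb J) g) A"
      by (rule emeasure_density[OF gm A, symmetric])
    finally show "emeasure (distr (density (Leb J) (\<lambda>\<theta>. K \<theta> * ennreal (D \<theta>))) (Leb J) X) A = emeasure (density (Leb J) g) A" .
  qed simp
qed

section \<open>Change of hosts\<close>

context finite_levels
begin

text \<open>
  The last condition makes all the probabilities that enter the inclusion-exclusion formula for the
  coordinates of \<open>D\<close> belong to faces of the model.
\<close>
definition hosting :: "'v set set \<Rightarrow> 'v set \<Rightarrow> ('v set \<Rightarrow> 'v set) \<Rightarrow> bool" where
  "hosting \<D> U h \<longleftrightarrow> (\<forall>D\<in>\<D>. D \<subseteq> h D \<and> h D \<subseteq> U \<and> (\<forall>F. D \<subseteq> F \<and> F \<subseteq> h D \<longrightarrow> F \<in> \<D>))"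

lemma hostingD:
  assumes "hosting \<D> U h" "D \<in> \<D>"
  shows "D \<subseteq> h D" "h D \<subseteq> U" "D \<subseteq> F \<Longrightarrow> F \<subseteq> h D \<Longrightarrow> F \<in> \<D>"
  using assms unfolding hosting_def by blast+

lemma hosting_mono: "hosting \<D> U h \<Longrightarrow> U \<subseteq> U' \<Longrightarrow> hosting \<D> U' h"
  unfolding hosting_def by (meson order_trans)

definition host_transform :: "'v set set \<Rightarrow> ('v set \<Rightarrow> 'v set) \<Rightarrow> (('v, 'l) coord \<Rightarrow> real) \<Rightarrow> ('v, 'l) coord \<Rightarrow> real" where
  "host_transform \<D> h m = (\<lambda>x\<in>star_coords L \<D>. induced_hyper L m (h (fst x)) x)"

text \<open>
  The probabilities that a cell has the nonzero levels \<open>j\<close> on \<open>D\<close>.  They do not depend on hosts, and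
  the coordinates of every choice of hosts are alternating sums of them.
\<close>
definition moments :: "'v set set \<Rightarrow> 'v set \<Rightarrow> (('v, 'l) coord \<Rightarrow> real) \<Rightarrow> ('v, 'l) coord \<Rightarrow> real" where
  "moments \<D> U \<theta> = (\<lambda>x\<in>star_coords L \<D>. marginal L \<D> U \<theta> (fst x) (snd x))"

lemma marginal_marginal:
  assumes U: "U \<subseteq> V" and A: "A \<subseteq> U" and F: "F \<subseteq> A"
  shows "(\<Sum>c | c \<in> cells L A \<and> restrict c F = j. marginal L \<D> U \<theta> A c) = marginal L \<D> U \<theta> F j"
proof -
  have AV: "A \<subseteq> V" using A U by auto
  have "(\<Sum>c | c \<in> cells L A \<and> restrict c F = j. \<Sum>i | i \<in> cells L U \<and> restrict i A = c. weight \<D> U \<theta> i)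
      = (\<Sum>i | i \<in> cells L U \<and> restrict i A \<in> {c. c \<in> cells L A \<and> restrict c F = j}. weight \<D> U \<theta> i)"
    by (rule sum_fibres) (use finite_cells[OF U] finite_cells[OF AV] in auto)
  also have "\<dots> = (\<Sum>i | i \<in> cells L U \<and> restrict i F = j. weight \<D> U \<theta> i)"
    using A F by (intro sum.cong) (auto simp: restrict_cells inf_absorb2)
  finally show ?thesis by (simp only: marginal_def sum_divide_distrib[symmetric])
qed

lemma host_marginals_eq_transform:
  assumes U: "U \<subseteq> V" and h: "hosting \<D> U h"
  shows "host_marginals L \<D> U h \<theta> = host_transform \<D> h (moments \<D> U \<theta>)"
  unfolding host_marginals_def host_transform_def
proof (rule restrict_ext)
  fix x assume "x \<in> star_coords L \<D>"
  then obtain D i where x: "x = (D, i)" and D: "D \<in> \<D>" and i: "i \<in> cells_star L D" by (auto simp: star_coords_def)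
  have hU: "h D \<subseteq> U" and Dh: "D \<subseteq> h D" using hostingD[OF h D] by auto
  have "induced_hyper L (moments \<D> U \<theta>) (h D) (D, i) = marginal L \<D> U \<theta> (h D) (zero_fill (h D) D i)"
  proof (rule induced_hyper_marginals[OF _ Dh i])
    show "h D \<subseteq> V" using hU U by auto
    fix F j assume F: "D \<subseteq> F" "F \<subseteq> h D" and j: "j \<in> cells_star L F"
    have "F \<in> \<D>" by (rule hostingD(3)[OF h D F])
    then show "moments \<D> U \<theta> (F, j) = (\<Sum>c | c \<in> cells L (h D) \<and> restrict c F = j. marginal L \<D> U \<theta> (h D) c)"
      using j by (simp add: moments_def star_coords_def marginal_marginal[OF U hU F(2)])
  qed
  then show "marginal L \<D> U \<theta> (h (fst x)) (zero_fill (h (fst x)) (fst x) (snd x)) = induced_hyper L (moments \<D> U \<theta>) (h (fst x)) x"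
    by (simp add: x)
qed

text \<open>
  The coordinate of a face \<open>D\<close> changes by a function of the coordinates of larger faces, so the rank
  decreases with the size.
\<close>
lemma host_transform_bij:
  assumes \<D>: "\<D> \<subseteq> Pow V" and h: "hosting \<D> V h"
  shows "host_transform \<D> h \<in> measurable (Leb (star_coords L \<D>)) (Leb (star_coords L \<D>))"
    and "\<exists>T. T \<in> measurable (Leb (star_coords L \<D>)) (Leb (star_coords L \<D>))
     \<and> (\<forall>m\<in>space (Leb (star_coords L \<D>)). T (host_transform \<D> h m) = m \<and> host_transform \<D> h (T m) = m)
     \<and> (\<forall>f\<in>borel_measurable (Leb (star_coords L \<D>)).
          (\<integral>\<^sup>+m. f (host_transform \<D> h m) \<partial>Leb (star_coords L \<D>)) = (\<integral>\<^sup>+m. f m \<partial>Leb (star_coords L \<D>)))"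
proof -
  let ?J = "star_coords L \<D>"
  define r where "r x = card V - card (fst x)" for x :: "('v, 'l) coord"
  define g where "g = (\<lambda>(D, i) (m :: ('v, 'l) coord \<Rightarrow> real). \<Sum>F | D \<subset> F \<and> F \<subseteq> h D. \<Sum>j | j \<in> cells_star L F \<and> restrict j D = i. (-1) ^ card (F - D) * m (F, j))"
  have fin: "finite ?J"
  proof -
    have "finite \<D>" by (rule finite_subset[OF \<D>]) (simp add: finite_V)
    then show ?thesis unfolding star_coords_def using \<D> by (auto intro!: finite_SigmaI finite_cells_star)
  qed
  have eq: "host_transform \<D> h = shear ?J g"
  proof (intro ext)
    fix m x
    show "host_transform \<D> h m x = shear ?J g m x"
    proof (cases "x \<in> ?J")
      case True
      then obtain D i where x: "x = (D, i)" and D: "D \<in> \<D>" and i: "i \<in> cells_star L D" by (auto simp: star_coords_def)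
      have "h D \<subseteq> V" "D \<subseteq> h D" using hostingD[OF h D] by auto
      from induced_hyper_split[OF this i] have "induced_hyper L m (h D) (D, i) = m (D, i) + g (D, i) m"
        by (simp add: g_def)
      then show ?thesis using True by (simp add: host_transform_def shear_def x)
    next
      case False
      then show ?thesis by (simp add: host_transform_def shear_def)
    qed
  qed
  have mem: "(F, j) \<in> ?J" if "(D, i) \<in> ?J" "D \<subset> F" "F \<subseteq> h D" "j \<in> cells_star L F" for D i F j
    using that hostingD(3)[OF h, of D F] by (auto simp: star_coords_def)
  have gm: "g x \<in> borel_measurable (Leb ?J)" if "x \<in> ?J" for x
  proof -
    obtain D i where x: "x = (D, i)" by (cases x)
    have "(\<lambda>m. m (F, j)) \<in> borel_measurable (Leb ?J)" if "D \<subset> F" "F \<subseteq> h D" "j \<in> cells_star L F" for F j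
      by (rule measurable_Leb_component[OF mem[OF _ that]]) (use \<open>x \<in> ?J\<close> x in simp)
    then show ?thesis unfolding x g_def prod.case
      by (intro borel_measurable_sum borel_measurable_times borel_measurable_const) auto
  qed
  then show "host_transform \<D> h \<in> measurable (Leb ?J) (Leb ?J)" unfolding eq by (rule measurable_shear)
  show "\<exists>T. T \<in> measurable (Leb ?J) (Leb ?J)
     \<and> (\<forall>m\<in>space (Leb ?J). T (host_transform \<D> h m) = m \<and> host_transform \<D> h (T m) = m)
     \<and> (\<forall>f\<in>borel_measurable (Leb ?J). (\<integral>\<^sup>+m. f (host_transform \<D> h m) \<partial>Leb ?J) = (\<integral>\<^sup>+m. f m \<partial>Leb ?J))"
    unfolding eq
  proof (rule triangular_shear[where r = r, OF fin gm])
    fix x and m m' :: "('v, 'l) coord \<Rightarrow> real"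
    assume x: "x \<in> ?J" and same: "\<And>y. y \<in> ?J \<Longrightarrow> r y < r x \<Longrightarrow> m y = m' y"
    obtain D i where xx: "x = (D, i)" by (cases x)
    have D: "D \<in> \<D>" using x xx by (auto simp: star_coords_def)
    have "m (F, j) = m' (F, j)" if F: "D \<subset> F" "F \<subseteq> h D" and j: "j \<in> cells_star L F" for F j
    proof (rule same)
      show "(F, j) \<in> ?J" using mem[of D i F j] x xx F j by blast
      have "F \<subseteq> V" using F hostingD(2)[OF h D] by auto
      then have "card D < card F" "card F \<le> card V"
        using psubset_card_mono[OF finite_sub F(1)] card_mono[OF finite_V] by blast+
      then show "r (F, j) < r x" by (simp add: r_def xx)
    qed
    then show "g x m = g x m'" unfolding xx g_def prod.case by (intro sum.cong refl) auto
  qed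
qed

text \<open>
  Both charts differ from the moments by a shear that preserves Lebesgue measure.
\<close>
lemma lebesgue_chart_change_hosts:
  assumes U: "U \<subseteq> V" and \<D>: "\<D> \<subseteq> Pow V"
    and h: "hosting \<D> U h" and g: "hosting \<D> U g"
    and chart: "lebesgue_chart (star_coords L \<D>) (host_marginals L \<D> U h) D"
  shows "lebesgue_chart (star_coords L \<D>) (host_marginals L \<D> U g) D"
proof -
  let ?J = "star_coords L \<D>" and ?T = "host_transform \<D> h" and ?G = "host_transform \<D> g"
  have hV: "hosting \<D> V h" and gV: "hosting \<D> V g"
    by (rule hosting_mono[OF h U], rule hosting_mono[OF g U])
  note Tm = host_transform_bij(1)[OF \<D> hV] and Gm = host_transform_bij(1)[OF \<D> gV]
  obtain T' where T'm: "T' \<in> measurable (Leb ?J) (Leb ?J)"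
    and T': "\<And>m. m \<in> space (Leb ?J) \<Longrightarrow> T' (?T m) = m \<and> ?T (T' m) = m"
    and T_int: "\<And>f. f \<in> borel_measurable (Leb ?J) \<Longrightarrow> (\<integral>\<^sup>+m. f (?T m) \<partial>Leb ?J) = (\<integral>\<^sup>+m. f m \<partial>Leb ?J)"
    using host_transform_bij(2)[OF \<D> hV] by blast
  obtain G' where G'm: "G' \<in> measurable (Leb ?J) (Leb ?J)"
    and G': "\<And>m. m \<in> space (Leb ?J) \<Longrightarrow> G' (?G m) = m \<and> ?G (G' m) = m"
    and G_int: "\<And>f. f \<in> borel_measurable (Leb ?J) \<Longrightarrow> (\<integral>\<^sup>+m. f (?G m) \<partial>Leb ?J) = (\<integral>\<^sup>+m. f m \<partial>Leb ?J)"
    using host_transform_bij(2)[OF \<D> gV] by blast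
  show ?thesis
  proof (rule lebesgue_chart_transform[OF chart measurable_compose[OF T'm Gm] measurable_compose[OF G'm Tm]])
    fix x assume "x \<in> space (Leb ?J)"
    then show "?T (G' (?G (T' x))) = x" using G' T' measurable_space[OF T'm] by simp
  next
    fix f :: "(('v, 'l) coord \<Rightarrow> real) \<Rightarrow> ennreal" assume f: "f \<in> borel_measurable (Leb ?J)"
    have "(\<integral>\<^sup>+x. f (?G (T' x)) \<partial>Leb ?J) = (\<integral>\<^sup>+m. f (?G (T' (?T m))) \<partial>Leb ?J)"
      by (rule T_int[symmetric]) (rule measurable_compose[OF measurable_compose[OF T'm Gm] f])
    also have "\<dots> = (\<integral>\<^sup>+m. f (?G m) \<partial>Leb ?J)" by (intro nn_integral_cong) (simp add: T')
    also have "\<dots> = (\<integral>\<^sup>+m. f m \<partial>Leb ?J)" by (rule G_int[OF f])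
    finally show "(\<integral>\<^sup>+x. f (?G (T' x)) \<partial>Leb ?J) = (\<integral>\<^sup>+m. f m \<partial>Leb ?J)" .
  next
    fix \<theta>
    have "moments \<D> U \<theta> \<in> space (Leb ?J)" by (simp add: moments_def space_Leb)
    then show "host_marginals L \<D> U g \<theta> = ?G (T' (host_marginals L \<D> U h \<theta>))"
      by (simp add: host_marginals_eq_transform[OF U h] host_marginals_eq_transform[OF U g] T')
  qed
qed

end

section \<open>Dirichlet distributions as priors of saturated models\<close>

context finite_levels
begin

text \<open>
  The empty face contributes \<open>\<alpha>\<close> to the alternating sum.
\<close>
lemma hyper_zero:
  assumes A: "A \<subseteq> V"
  shows "table_hyper (extend_hyper s \<alpha>) A (zero_cell A) = induced_hyper_zero L s \<alpha> A"
proof -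
  have finA: "finite A" by (rule finite_sub[OF A])
  have c: "cells_star L {} = {\<lambda>_. undefined}" by (simp add: cells_star_def)
  have r: "restrict j {} = (\<lambda>_. undefined)" for j :: "'v \<Rightarrow> 'l" by (simp add: restrict_def)
  have set_eq: "{F. {} \<subseteq> F \<and> F \<subseteq> A} = insert {} {D. D \<noteq> {} \<and> D \<subseteq> A}" by auto
  have fin: "finite {D. D \<noteq> {} \<and> D \<subseteq> A}" by (rule finite_subset[of _ "Pow A"]) (use finA in auto)
  have "table_hyper (extend_hyper s \<alpha>) A (zero_cell A) = induced_hyper L (extend_hyper s \<alpha>) A ({}, \<lambda>_. undefined)"
    by (simp add: table_hyper_def support_zero_cell r)
  also have "\<dots> = (\<Sum>F\<in>insert {} {D. D \<noteq> {} \<and> D \<subseteq> A}. \<Sum>j\<in>cells_star L F. (-1) ^ card F * extend_hyper s \<alpha> (F, j))"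
    unfolding induced_hyper_def prod.case set_eq r by simp
  also have "\<dots> = \<alpha> + (\<Sum>D | D \<noteq> {} \<and> D \<subseteq> A. \<Sum>j\<in>cells_star L D. (-1) ^ card D * extend_hyper s \<alpha> (D, j))"
    by (subst sum.insert[OF fin]) (simp_all add: c extend_hyper_def)
  also have "(\<Sum>D | D \<noteq> {} \<and> D \<subseteq> A. \<Sum>j\<in>cells_star L D. (-1) ^ card D * extend_hyper s \<alpha> (D, j))
      = (\<Sum>D | D \<noteq> {} \<and> D \<subseteq> A. (-1) ^ card D * (\<Sum>j\<in>cells_star L D. s (D, j)))"
    by (rule sum.cong[OF refl]) (simp add: extend_hyper_def sum_distrib_left)
  finally show ?thesis by (simp only: induced_hyper_zero_def)
qed

lemma hyper_fill:
  assumes "(D, i) \<in> sub_coords L A"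
  shows "table_hyper (extend_hyper s \<alpha>) A (zero_fill A D i) = induced_hyper L s A (D, i)"
proof -
  have D: "D \<subseteq> A" "D \<noteq> {}" "i \<in> cells_star L D" using assms by (auto simp: sub_coords_def)
  have "induced_hyper L (extend_hyper s \<alpha>) A (D, i) = induced_hyper L s A (D, i)"
    unfolding induced_hyper_def prod.case using D(2) by (intro sum.cong refl) (auto simp: extend_hyper_def)
  then show ?thesis by (simp add: table_hyper_zero_fill[OF D(1,3)])
qed

text \<open>
  The sum of the hyperparameters is the marginal sum for the empty face.
\<close>
lemma sum_hyper:
  assumes A: "A \<subseteq> V"
  shows "(\<Sum>c\<in>cells L A. table_hyper (extend_hyper s \<alpha>) A c) = \<alpha>"
proof -
  have "(\<lambda>_. undefined) \<in> cells_star L {}" by (simp add: cells_star_def)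
  from sum_table_hyper[OF A empty_subsetI this, of "extend_hyper s \<alpha>"]
  show ?thesis by (simp add: restrict_def extend_hyper_def)
qed

lemma hyper_gamma_prod:
  assumes A: "A \<subseteq> V"
  shows "(\<Prod>c\<in>cells L A. Gamma (table_hyper (extend_hyper s \<alpha>) A c))
    = Gamma (induced_hyper_zero L s \<alpha> A) * (\<Prod>x\<in>sub_coords L A. Gamma (induced_hyper L s A x))"
  unfolding prod_cells[OF A] hyper_zero[OF A]
  by (intro arg_cong2[of _ _ _ _ "(*)"] refl prod.cong) (auto simp: hyper_fill)

lemma marginal_dirichlet:
  assumes U: "U \<subseteq> V" and A: "A \<subseteq> U"
  shows "dirichlet_fun L A (induced_hyper_zero L s \<alpha> A) (induced_hyper L s A)
      (marginal L \<D> U \<theta> A (zero_cell A)) (\<lambda>(D, i). marginal L \<D> U \<theta> A (zero_fill A D i))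
    = Gamma \<alpha> / (\<Prod>c\<in>cells L A. Gamma (table_hyper (extend_hyper s \<alpha>) A c))
      * ((\<Prod>c\<in>cells L A. marginal L \<D> U \<theta> A c powr table_hyper (extend_hyper s \<alpha>) A c)
         / (\<Prod>c\<in>cells L A. marginal L \<D> U \<theta> A c))"
proof -
  let ?h = "table_hyper (extend_hyper s \<alpha>) A" and ?P = "marginal L \<D> U \<theta> A" and ?a = "induced_hyper L s A"
  have AV: "A \<subseteq> V" using A U by auto
  have "(\<Sum>c\<in>cells L A. ?h c) = induced_hyper_zero L s \<alpha> A + (\<Sum>x\<in>sub_coords L A. ?a x)"
    unfolding sum_cells[OF AV] hyper_zero[OF AV]
    by (intro arg_cong2[of _ _ _ _ "(+)"] refl sum.cong) (auto simp: hyper_fill)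
  then have total: "induced_hyper_zero L s \<alpha> A + (\<Sum>x\<in>sub_coords L A. ?a x) = \<alpha>" by (simp only: sum_hyper[OF AV])
  have "(\<Prod>c\<in>cells L A. ?P c powr (?h c - 1))
      = ?P (zero_cell A) powr (induced_hyper_zero L s \<alpha> A - 1) * (\<Prod>(D, i)\<in>sub_coords L A. ?P (zero_fill A D i) powr (?a (D, i) - 1))"
    unfolding prod_cells[OF AV] hyper_zero[OF AV]
    by (intro arg_cong2[of _ _ _ _ "(*)"] refl prod.cong) (auto simp: hyper_fill)
  moreover have "(\<Prod>c\<in>cells L A. ?P c powr (?h c - 1)) = (\<Prod>c\<in>cells L A. ?P c powr ?h c) / (\<Prod>c\<in>cells L A. ?P c)"
    unfolding prod_dividef[symmetric]
    by (rule prod.cong[OF refl]) (use marginal_pos[OF U A] in \<open>simp add: powr_diff less_imp_le\<close>)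
  ultimately show ?thesis
    by (simp add: dirichlet_fun_def total hyper_gamma_prod[OF AV] split_def)
qed

abbreviation saturated :: "'v set \<Rightarrow> 'v set set" where "saturated A \<equiv> Pow A - {{}}"

abbreviation cell_probs :: "'v set \<Rightarrow> (('v, 'l) coord \<Rightarrow> real) \<Rightarrow> ('v, 'l) coord \<Rightarrow> real" where
  "cell_probs A \<equiv> host_marginals L (saturated A) A (\<lambda>_. A)"

lemma saturated_coords: "star_coords L (saturated A) = sub_coords L A"
  by (auto simp: star_coords_def sub_coords_def)

lemma cell_probs_eq:
  "x \<in> sub_coords L A \<Longrightarrow> cell_probs A \<theta> x = marginal L (saturated A) A \<theta> A (zero_fill A (fst x) (snd x))"
  by (simp add: host_marginals_def saturated_coords)

lemma sum_marginal:
  assumes U: "U \<subseteq> V" and A: "A \<subseteq> U"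
  shows "(\<Sum>c\<in>cells L A. marginal L \<D> U \<theta> A c) = 1"
proof -
  have AV: "A \<subseteq> V" using A U by auto
  have "(\<Sum>c\<in>cells L A. \<Sum>j | j \<in> cells L U \<and> restrict j A = c. weight \<D> U \<theta> j) = normalizer L \<D> U \<theta>"
    unfolding sum_fibres[OF finite_cells[OF U] finite_cells[OF AV]] normalizer_def
    by (rule sum.cong) (auto intro: restrict_cells[OF _ A])
  then show ?thesis
    using normalizer_pos[OF U, of \<D> \<theta>] by (simp only: marginal_def sum_divide_distrib[symmetric]) simp
qed

lemma cell_probs_zero:
  assumes A: "A \<subseteq> V"
  shows "1 - (\<Sum>x\<in>sub_coords L A. cell_probs A \<theta> x) = marginal L (saturated A) A \<theta> A (zero_cell A)"
proof -
  have "(\<Sum>x\<in>sub_coords L A. cell_probs A \<theta> x) = (\<Sum>(D, i)\<in>sub_coords L A. marginal L (saturated A) A \<theta> A (zero_fill A D i))"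
    by (rule sum.cong[OF refl]) (simp add: cell_probs_eq split_def)
  then show ?thesis
    using sum_marginal[OF A order_refl, of "saturated A" \<theta>] unfolding sum_cells[OF A] by simp
qed

text \<open>
  A positive table belongs to the saturated model: its parameter consists of the interactions of the
  logarithms of the probabilities.
\<close>
lemma cell_probs_surj:
  assumes A: "A \<subseteq> V" and q: "q \<in> extensional (sub_coords L A)"
    and pos: "\<And>x. x \<in> sub_coords L A \<Longrightarrow> 0 < q x" and lt: "(\<Sum>x\<in>sub_coords L A. q x) < 1"
  shows "\<exists>\<theta>\<in>extensional (sub_coords L A). cell_probs A \<theta> = q"
proof -
  define t where "t c = (if support A c = {} then 1 - (\<Sum>x\<in>sub_coords L A. q x) else q (support A c, restrict c (support A c)))" for c
  have t_zero: "t (zero_cell A) = 1 - (\<Sum>x\<in>sub_coords L A. q x)" by (simp add: t_def support_zero_cell)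
  have t_fill: "t (zero_fill A D i) = q (D, i)" if "(D, i) \<in> sub_coords L A" for D i
    using that by (auto simp: t_def sub_coords_def support_zero_fill restrict_zero_fill)
  have t_pos: "0 < t c" if "c \<in> cells L A" for c
    using full_coordsI[OF that] pos lt by (auto simp: t_def full_coords_eq)
  have t_sum: "(\<Sum>c\<in>cells L A. t c) = 1"
  proof -
    have "(\<Sum>(D, i)\<in>sub_coords L A. t (zero_fill A D i)) = (\<Sum>x\<in>sub_coords L A. q x)"
      by (rule sum.cong[OF refl]) (auto simp: t_fill)
    then show ?thesis unfolding sum_cells[OF A] t_zero by simp
  qed
  let ?I = "interaction A (\<lambda>c. ln (t c))"
  define \<theta> where "\<theta> = restrict ?I (sub_coords L A)"
  have w: "weight (saturated A) A \<theta> c = t c / t (zero_cell A)" if c: "c \<in> cells L A" for c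
  proof -
    have fin: "finite (support A c)" by (rule finite_sub[OF order_trans[OF support_subset A]])
    have sets: "{F. F \<in> saturated A \<and> F \<subseteq> support A c} = Pow (support A c) - {{}}"
      using support_subset[of A c] by blast
    have "\<theta> (F, restrict c F) = ?I (F, restrict c F)" if "F \<in> Pow (support A c) - {{}}" for F
    proof -
      have "F \<subseteq> A" using that support_subset[of A c] by blast
      then show ?thesis
        using that restrict_mem_cells_star_iff[OF c, of F] by (simp add: \<theta>_def sub_coords_def)
    qed
    then have "(\<Sum>F | F \<in> saturated A \<and> F \<subseteq> support A c. \<theta> (F, restrict c F)) = (\<Sum>F\<in>Pow (support A c) - {{}}. ?I (F, restrict c F))"
      unfolding sets by (rule sum.cong[OF refl])
    also have "\<dots> = (\<Sum>F\<in>Pow (support A c). ?I (F, restrict c F)) - ?I ({}, restrict c {})"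
      using fin by (subst sum_diff1) auto
    also have "\<dots> = ln (t c) - ln (t (zero_cell A))"
      using sum_interaction[OF A c, of "\<lambda>c. ln (t c)"] by (simp only: Pow_def interaction_empty)
    finally show ?thesis
      by (simp only: weight_def exp_diff exp_ln[OF t_pos[OF c]] exp_ln[OF t_pos[OF zero_cell_cells[OF A]]])
  qed
  have n: "normalizer L (saturated A) A \<theta> = 1 / t (zero_cell A)"
    unfolding normalizer_def by (simp add: w t_sum flip: sum_divide_distrib)
  have m: "marginal L (saturated A) A \<theta> A c = t c" if c: "c \<in> cells L A" for c
  proof -
    have "{j. j \<in> cells L A \<and> restrict j A = c} = {c}"
      using c cells_extensional[of _ L A] extensional_restrict by auto
    then show ?thesis
      unfolding marginal_def n using t_pos[OF zero_cell_cells[OF A]] by (simp add: w[OF c])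
  qed
  have "cell_probs A \<theta> = q"
  proof (rule extensionalityI[OF _ q])
    show "cell_probs A \<theta> \<in> extensional (sub_coords L A)" by (simp add: host_marginals_def saturated_coords)
    fix x assume x: "x \<in> sub_coords L A"
    then have "zero_fill A (fst x) (snd x) \<in> cells L A"
      using zero_fill_star[OF _ A] by (auto simp: sub_coords_def)
    then show "cell_probs A \<theta> x = q x"
      using t_fill[of "fst x" "snd x"] x by (simp add: cell_probs_eq m)
  qed
  moreover have "\<theta> \<in> extensional (sub_coords L A)" by (simp add: \<theta>_def)
  ultimately show ?thesis by blast
qed

lemma cell_probs_range:
  assumes A: "A \<subseteq> V" and q: "q \<in> extensional (sub_coords L A)"
  shows "q \<in> cell_probs A ` extensional (sub_coords L A)
     \<longleftrightarrow> (\<forall>x\<in>sub_coords L A. 0 < q x) \<and> (\<Sum>x\<in>sub_coords L A. q x) < 1"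
proof
  assume "q \<in> cell_probs A ` extensional (sub_coords L A)"
  then obtain \<theta> where q_eq: "q = cell_probs A \<theta>" by (rule imageE)
  have "0 < q x" if "x \<in> sub_coords L A" for x
    unfolding q_eq cell_probs_eq[OF that]
    by (rule marginal_pos[OF A order_refl zero_fill_star[OF _ A]]) (use that in \<open>auto simp: sub_coords_def\<close>)
  moreover have "0 < 1 - (\<Sum>x\<in>sub_coords L A. q x)"
    unfolding q_eq cell_probs_zero[OF A] by (rule marginal_pos[OF A order_refl zero_cell_cells[OF A]])
  ultimately show "(\<forall>x\<in>sub_coords L A. 0 < q x) \<and> (\<Sum>x\<in>sub_coords L A. q x) < 1" by simp
next
  assume "(\<forall>x\<in>sub_coords L A. 0 < q x) \<and> (\<Sum>x\<in>sub_coords L A. q x) < 1"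
  then show "q \<in> cell_probs A ` extensional (sub_coords L A)" using cell_probs_surj[OF A q] by blast
qed

definition saturated_integral :: "(('v, 'l) coord \<Rightarrow> real) \<Rightarrow> real \<Rightarrow> 'v set \<Rightarrow> real" where
  "saturated_integral s \<alpha> A = (\<Prod>c\<in>cells L A. Gamma (table_hyper (extend_hyper s \<alpha>) A c)) / Gamma \<alpha>"

lemma saturated_integral_pos:
  assumes A: "A \<subseteq> V" and pos: "\<And>c. c \<in> cells L A \<Longrightarrow> 0 < table_hyper (extend_hyper s \<alpha>) A c"
  shows "0 < saturated_integral s \<alpha> A"
proof -
  have "0 < (\<Sum>c\<in>cells L A. table_hyper (extend_hyper s \<alpha>) A c)"
    by (intro sum_pos finite_cells cells_nonempty A pos)
  then show ?thesis
    unfolding saturated_integral_def sum_hyper[OF A] by (intro divide_pos_pos prod_pos ballI Gamma_real_pos pos)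
qed

text \<open>
  The saturated model on \<open>A\<close> is a tower with one clique.  Its chart has the product of the cell
  probabilities as Jacobian and its kernel is the product of their powers, so the density of the cell
  probabilities has the exponents lowered by one.
\<close>
lemma dirichlet_eq_saturated_prior:
  assumes A: "A \<subseteq> V" and pos: "\<And>c. c \<in> cells L A \<Longrightarrow> 0 < table_hyper (extend_hyper s \<alpha>) A c"
  shows "dirichlet L A (induced_hyper_zero L s \<alpha> A) (induced_hyper L s A)
    = distr (density (Leb (sub_coords L A)) (\<lambda>\<theta>. ennreal (model_kernel L (saturated A) A s \<alpha> \<theta> / saturated_integral s \<alpha> A)))
        (Leb (sub_coords L A)) (cell_probs A)"
proof -
  interpret clique_tower V L "\<lambda>_. A" 1 by unfold_locales (use A in auto)
  let ?J = "sub_coords L A" and ?h = "table_hyper (extend_hyper s \<alpha>) A" and ?k = "model_kernel L (saturated A) A s \<alpha>"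
  let ?I = "saturated_integral s \<alpha> A"
  have f: "faces 1 = saturated A" "covered 1 = A" "first_clique = (\<lambda>_. A)"
    by (auto simp: faces_def covered_def first_clique_def)
  have I: "0 < ?I" by (rule saturated_integral_pos[OF A pos])
  have sep: "separator (\<lambda>_. A) (Suc 0) = {}" by (simp add: separator_def)
  have sep_one: "marginal L (saturated A) A \<theta> {} (\<lambda>_. undefined) = 1" for \<theta>
    using sum_marginal[OF A empty_subsetI, of "saturated A" \<theta>] by (simp add: cells_def)
  have jac_eq: "jac 1 \<theta> = (\<Prod>c\<in>cells L A. marginal L (saturated A) A \<theta> A c)" for \<theta>
    unfolding jac_def f by (simp add: sep sep_one cells_def[of L "{}"])
  have kernel_eq: "?k \<theta> = (\<Prod>c\<in>cells L A. marginal L (saturated A) A \<theta> A c powr ?h c)" for \<theta>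
    using tower_kernel[of 1 s \<alpha> \<theta>] unfolding f by (simp add: sep sep_one cells_def[of L "{}"])
  have chart: "lebesgue_chart ?J (cell_probs A) (jac 1)"
    using tower_chart[of 1] unfolding f saturated_coords by simp
  have Xm: "cell_probs A \<in> measurable (Leb ?J) (Leb ?J)"
    using measurable_host_marginals[OF A, of "saturated A" "\<lambda>_. A"] by (simp only: saturated_coords)
  have jm: "jac 1 \<in> borel_measurable (Leb ?J)" using jac_measurable[of 1] unfolding f saturated_coords by simp
  have jpos: "0 < jac 1 \<theta>" for \<theta> by (rule jac_pos) simp
  define K where "K \<theta> = ennreal (?k \<theta> / (?I * jac 1 \<theta>))" for \<theta>
  have Km: "K \<in> borel_measurable (Leb ?J)"
    unfolding K_def using log_linear_measurable(4)[OF A, of "saturated A"]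
    by (intro measurable_compose[OF _ measurable_ennreal] borel_measurable_divide borel_measurable_times
        borel_measurable_const jm) (simp only: saturated_coords)
  have KD: "K \<theta> * ennreal (jac 1 \<theta>) = ennreal (?k \<theta> / ?I)" for \<theta>
    using jpos[of \<theta>] unfolding K_def by (subst ennreal_mult''[symmetric]) simp_all
  let ?g = "\<lambda>q. if q \<in> cell_probs A ` space (Leb ?J) then K (inv_into (space (Leb ?J)) (cell_probs A) q) else 0"
  note density = lebesgue_chart_density[OF finite_sub_coords[OF A] chart Xm jm Km]
  have K_eq: "K \<theta> = ennreal (dirichlet_fun L A (induced_hyper_zero L s \<alpha> A) (induced_hyper L s A) (1 - (\<Sum>x\<in>?J. cell_probs A \<theta> x)) (cell_probs A \<theta>))" for \<theta>
  proof -
    have "dirichlet_fun L A (induced_hyper_zero L s \<alpha> A) (induced_hyper L s A) (1 - (\<Sum>x\<in>?J. cell_probs A \<theta> x)) (cell_probs A \<theta>)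
      = dirichlet_fun L A (induced_hyper_zero L s \<alpha> A) (induced_hyper L s A)
      (marginal L (saturated A) A \<theta> A (zero_cell A)) (\<lambda>(D, i). marginal L (saturated A) A \<theta> A (zero_fill A D i))"
      unfolding cell_probs_zero[OF A] dirichlet_fun_def by (simp add: cell_probs_eq split_def cong: prod.cong)
    also have "\<dots> = ?k \<theta> / (?I * jac 1 \<theta>)"
      unfolding marginal_dirichlet[OF A order_refl] jac_eq kernel_eq saturated_integral_def by simp
    finally show ?thesis by (simp only: K_def)
  qed
  have "dirichlet L A (induced_hyper_zero L s \<alpha> A) (induced_hyper L s A) = density (Leb ?J) ?g"
    unfolding dirichlet_def
  proof (rule density_cong)
    have eq: "(if (\<forall>x\<in>?J. 0 < q x) \<and> (\<Sum>x\<in>?J. q x) < 1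
        then ennreal (dirichlet_fun L A (induced_hyper_zero L s \<alpha> A) (induced_hyper L s A) (1 - (\<Sum>x\<in>?J. q x)) q) else 0) = ?g q"
      if q: "q \<in> space (Leb ?J)" for q
    proof (cases "q \<in> cell_probs A ` space (Leb ?J)")
      case True
      then have "cell_probs A (inv_into (space (Leb ?J)) (cell_probs A) q) = q" by (rule f_inv_into_f)
      then show ?thesis using True cell_probs_range[OF A, of q] q by (simp add: K_eq space_Leb)
    next
      case False
      then show ?thesis using cell_probs_range[OF A, of q] q by (simp only: space_Leb if_False)
    qed
    then show "AE q in Leb ?J. (if (\<forall>x\<in>?J. 0 < q x) \<and> (\<Sum>x\<in>?J. q x) < 1
        then ennreal (dirichlet_fun L A (induced_hyper_zero L s \<alpha> A) (induced_hyper L s A) (1 - (\<Sum>x\<in>?J. q x)) q) else 0) = ?g q"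
      by (intro AE_I2)
    show "(\<lambda>q. if (\<forall>x\<in>?J. 0 < q x) \<and> (\<Sum>x\<in>?J. q x) < 1
        then ennreal (dirichlet_fun L A (induced_hyper_zero L s \<alpha> A) (induced_hyper L s A) (1 - (\<Sum>x\<in>?J. q x)) q) else 0)
      \<in> borel_measurable (Leb ?J)"
      by (subst measurable_cong[OF eq], assumption) (rule density(2))
  qed (rule density(2))
  then show ?thesis using density(1) by (simp only: KD)
qed

text \<open>
  The saturated model on \<open>C\<close> is obtained from the one on \<open>H \<subseteq> C\<close> by adding \<open>C\<close>.  In the coordinates
  \<open>reparam\<close> the prior is a product, and its old part, on which the \<open>H\<close>-marginal depends, is the prior of
  the saturated model on \<open>H\<close>.
\<close>
lemma dirichlet_marginal:
  assumes HC: "H \<subseteq> C" and CV: "C \<subseteq> V" and pos: "\<And>c. c \<in> cells L C \<Longrightarrow> 0 < table_hyper (extend_hyper s \<alpha>) C c"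
  shows "distr (dirichlet L C (induced_hyper_zero L s \<alpha> C) (induced_hyper L s C)) (Leb (sub_coords L H)) (table_marginal L C H)
    = dirichlet L H (induced_hyper_zero L s \<alpha> H) (induced_hyper L s H)"
proof -
  interpret gluing V L "saturated H" H C by unfold_locales (use HC CV in auto)
  let ?h = "table_hyper (extend_hyper s \<alpha>)" and ?I = "saturated_integral s \<alpha>"
  let ?k = "\<lambda>A. model_kernel L (saturated A) A s \<alpha>"
  have HV: "H \<subseteq> V" using HC CV by auto
  have S: "C \<inter> H = H" using HC by auto
  have D: "saturated H \<union> new_sets = saturated C" "H \<union> C = C" using HC by auto
  have J: "old \<union> new = sub_coords L C" "old = sub_coords L H"
    unfolding star_coords_Un[symmetric] D unfolding saturated_coords by (rule refl)+
  have posH: "0 < ?h H b" if "b \<in> cells L H" for b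
    using sep_hyper_pos[of "extend_hyper s \<alpha>", OF pos] that by (simp only: S)
  have IC: "0 < ?I C" by (rule saturated_integral_pos[OF CV pos])
  have IH: "0 < ?I H" by (rule saturated_integral_pos[OF HV posH])
  have \<alpha>: "0 < Gamma \<alpha>"
  proof -
    have "0 < (\<Sum>c\<in>cells L C. ?h C c)" by (intro sum_pos finite_cells cells_nonempty CV pos)
    then show ?thesis by (simp add: sum_hyper[OF CV] Gamma_real_pos)
  qed
  have block: "block_dirichlet_integral new sep (cells L S) (\<lambda>x. ?h C (fill x)) (?h S) = ennreal (?I C / ?I H)"
    using clique_integral[OF pos] \<alpha> by (simp add: S saturated_integral_def)
  have XC: "cell_probs C \<in> measurable (Leb (sub_coords L C)) (Leb (sub_coords L C))"
    using measurable_host_marginals[OF CV, of "saturated C" "\<lambda>_. C"] by (simp only: saturated_coords)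
  have XH: "cell_probs H \<in> measurable (Leb (sub_coords L H)) (Leb (sub_coords L H))"
    using measurable_host_marginals[OF HV, of "saturated H" "\<lambda>_. H"] by (simp only: saturated_coords)
  have tm: "table_marginal L C H \<in> measurable (Leb (sub_coords L C)) (Leb (sub_coords L H))"
    unfolding table_marginal_def split_def
    by (intro measurable_Leb_restrict borel_measurable_sum measurable_Leb_component) simp
  have marg: "table_marginal L C H (cell_probs C \<theta>) = cell_probs H (restrict (reparam \<theta>) old)" for \<theta>
  proof (rule extensionalityI[of _ "sub_coords L H"])
    show "table_marginal L C H (cell_probs C \<theta>) \<in> extensional (sub_coords L H)" by (simp add: table_marginal_def)
    show "cell_probs H (restrict (reparam \<theta>) old) \<in> extensional (sub_coords L H)" by (simp add: host_marginals_def saturated_coords)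
    fix x assume x: "x \<in> sub_coords L H"
    obtain D i where xD: "x = (D, i)" by (cases x)
    have Di: "D \<subseteq> H" "D \<noteq> {}" "i \<in> cells_star L D" using x xD by (auto simp: sub_coords_def)
    let ?b = "zero_fill H D i" and ?P = "marginal L (saturated C) C \<theta> C"
    have "restrict (zero_cell C) H \<noteq> ?b"
    proof
      assume "restrict (zero_cell C) H = ?b"
      moreover have "restrict (zero_cell C) H = (zero_cell H :: 'v \<Rightarrow> 'l)" using HC by (auto simp: zero_cell_def restrict_def fun_eq_iff)
      ultimately show False using support_zero_fill[OF Di(1,3)] support_zero_cell[of H] Di(2) by metis
    qed
    then have "(\<Sum>c | c \<in> cells L C \<and> restrict c H = ?b. ?P c) = (\<Sum>y\<in>sub_coords L C. if restrict (zero_fill C (fst y) (snd y)) H = ?b then ?P (zero_fill C (fst y) (snd y)) else 0)"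
      unfolding sum.inter_filter[OF finite_cells[OF CV]] sum_cells[OF CV] by (simp add: split_def)
    also have "\<dots> = (\<Sum>y | y \<in> sub_coords L C \<and> restrict (zero_fill C (fst y) (snd y)) H = ?b. ?P (zero_fill C (fst y) (snd y)))"
      by (rule sum.inter_filter[OF finite_sub_coords[OF CV], symmetric])
    also have "\<dots> = (\<Sum>y | y \<in> sub_coords L C \<and> restrict (zero_fill C (fst y) (snd y)) H = ?b. cell_probs C \<theta> y)"
      by (rule sum.cong[OF refl]) (simp add: cell_probs_eq)
    finally have "table_marginal L C H (cell_probs C \<theta>) x = marginal L (saturated C) C \<theta> H ?b"
      using x unfolding marginal_marginal[OF CV order_refl HC] by (simp add: table_marginal_def xD split_def)
    also have "\<dots> = marginal L (saturated H) H (restrict (reparam \<theta>) old) H ?b"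
      using marginal_old[of H \<theta> ?b] by (simp only: D marginal_reparam order_refl simp_thms)
    also have "\<dots> = cell_probs H (restrict (reparam \<theta>) old) x" using x by (simp add: cell_probs_eq xD)
    finally show "table_marginal L C H (cell_probs C \<theta>) x = cell_probs H (restrict (reparam \<theta>) old) x" .
  qed
  have km: "(\<lambda>\<theta>. ennreal (?k A \<theta>)) \<in> borel_measurable (Leb (sub_coords L A))" if "A \<subseteq> V" for A
    using log_linear_measurable(4)[OF that, of "saturated A"]
    by (intro measurable_compose[OF _ measurable_ennreal]) (simp only: saturated_coords)
  have k_div: "ennreal (?k A \<theta> / ?I A) = ennreal (1 / ?I A) * ennreal (?k A \<theta>)" for A \<theta>
    by (subst ennreal_mult''[symmetric]) (simp_all add: model_kernel_def)
  have law: "emeasure (distr (density (Leb (sub_coords L A)) (\<lambda>\<theta>. ennreal (?k A \<theta> / ?I A))) (Leb (sub_coords L H)) X) B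
      = ennreal (1 / ?I A) * (\<integral>\<^sup>+\<theta>. indicator B (X \<theta>) * ennreal (?k A \<theta>) \<partial>Leb (sub_coords L A))"
    if A: "A \<subseteq> V" and X: "X \<in> measurable (Leb (sub_coords L A)) (Leb (sub_coords L H))" and B: "B \<in> sets (Leb (sub_coords L H))" for A X B
  proof -
    have iX: "(\<lambda>\<theta>. indicator B (X \<theta>) :: ennreal) \<in> borel_measurable (Leb (sub_coords L A))"
      by (rule measurable_compose[OF X borel_measurable_indicator[OF B]])
    have m: "(\<lambda>\<theta>. ennreal (1 / ?I A) * ennreal (?k A \<theta>)) \<in> borel_measurable (Leb (sub_coords L A))"
      by (intro borel_measurable_times_ennreal borel_measurable_const km[OF A])
    let ?N = "density (Leb (sub_coords L A)) (\<lambda>\<theta>. ennreal (1 / ?I A) * ennreal (?k A \<theta>))"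
    have "emeasure (distr ?N (Leb (sub_coords L H)) X) B = (\<integral>\<^sup>+q. indicator B q \<partial>distr ?N (Leb (sub_coords L H)) X)"
      using B by simp
    also have "\<dots> = (\<integral>\<^sup>+\<theta>. indicator B (X \<theta>) \<partial>?N)"
      using X B by (intro nn_integral_distr) simp_all
    also have "\<dots> = (\<integral>\<^sup>+\<theta>. ennreal (1 / ?I A) * ennreal (?k A \<theta>) * indicator B (X \<theta>) \<partial>Leb (sub_coords L A))"
      by (rule nn_integral_density[OF m iX])
    also have "\<dots> = (\<integral>\<^sup>+\<theta>. ennreal (1 / ?I A) * (indicator B (X \<theta>) * ennreal (?k A \<theta>)) \<partial>Leb (sub_coords L A))"
      by (simp only: mult_ac)
    also have "\<dots> = ennreal (1 / ?I A) * (\<integral>\<^sup>+\<theta>. indicator B (X \<theta>) * ennreal (?k A \<theta>) \<partial>Leb (sub_coords L A))"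
      by (intro nn_integral_cmult borel_measurable_times_ennreal iX km[OF A])
    finally show ?thesis unfolding k_div .
  qed
  have law_C: "dirichlet L C (induced_hyper_zero L s \<alpha> C) (induced_hyper L s C)
      = distr (density (Leb (sub_coords L C)) (\<lambda>\<theta>. ennreal (?k C \<theta> / ?I C))) (Leb (sub_coords L C)) (cell_probs C)"
    by (rule dirichlet_eq_saturated_prior[OF CV]) (rule pos)
  have law_H: "dirichlet L H (induced_hyper_zero L s \<alpha> H) (induced_hyper L s H)
      = distr (density (Leb (sub_coords L H)) (\<lambda>\<theta>. ennreal (?k H \<theta> / ?I H))) (Leb (sub_coords L H)) (cell_probs H)"
    by (rule dirichlet_eq_saturated_prior[OF HV]) (rule posH)
  show ?thesis
    unfolding law_C law_H
  proof (rule measure_eqI)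
    let ?MC = "density (Leb (sub_coords L C)) (\<lambda>\<theta>. ennreal (?k C \<theta> / ?I C))"
    fix B assume "B \<in> sets (distr (distr ?MC (Leb (sub_coords L C)) (cell_probs C)) (Leb (sub_coords L H)) (table_marginal L C H))"
    then have B: "B \<in> sets (Leb (sub_coords L H))" by simp
    have g: "(\<lambda>u. indicator B (cell_probs H u) :: ennreal) \<in> borel_measurable (Leb (sub_coords L H))"
      by (rule measurable_compose[OF XH borel_measurable_indicator[OF B]])
    have "ennreal (1 / ?I C) * (\<integral>\<^sup>+\<theta>. indicator B (cell_probs H (restrict (reparam \<theta>) old)) * ennreal (?k C \<theta>) \<partial>Leb (sub_coords L C))
        = ennreal (1 / ?I C) * ((\<integral>\<^sup>+u. indicator B (cell_probs H u) * ennreal (?k H u) \<partial>Leb (sub_coords L H)) * ennreal (?I C / ?I H))" (is "?integral = _")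
      using nn_integral_model_kernel_glue[of "\<lambda>u. indicator B (cell_probs H u)" s \<alpha>] g
      unfolding block D J(1) unfolding J(2) by simp
    also have "\<dots> = ennreal (1 / ?I H) * (\<integral>\<^sup>+u. indicator B (cell_probs H u) * ennreal (?k H u) \<partial>Leb (sub_coords L H))" (is "_ = ?rhs")
    proof -
      have quotient: "ennreal (1 / ?I H) = ennreal (1 / ?I C) * ennreal (?I C / ?I H)"
        using IC IH by (subst ennreal_mult''[symmetric]) simp_all
      show ?thesis unfolding quotient by (simp only: mult_ac)
    qed
    finally have glue: "?integral = ?rhs" .
    have "distr (distr ?MC (Leb (sub_coords L C)) (cell_probs C)) (Leb (sub_coords L H)) (table_marginal L C H)
        = distr ?MC (Leb (sub_coords L H)) (table_marginal L C H \<circ> cell_probs C)"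
      by (rule distr_distr[OF tm]) (use XC in simp)
    then show "emeasure (distr (distr ?MC (Leb (sub_coords L C)) (cell_probs C)) (Leb (sub_coords L H)) (table_marginal L C H)) B
      = emeasure (distr (density (Leb (sub_coords L H)) (\<lambda>\<theta>. ennreal (?k H \<theta> / ?I H))) (Leb (sub_coords L H)) (cell_probs H)) B"
      unfolding law[OF HV XH B] by (simp only: law[OF CV measurable_comp[OF XC tm] B] comp_apply marg glue)
  qed simp
qed

end

section \<open>The prior of a decomposable model\<close>

lemma complete_set_in_clique:
  assumes "finite V" "D \<subseteq> V" "complete_in E D"
  shows "\<exists>A\<in>cliques V E. D \<subseteq> A"
proof -
  let ?S = "{A. A \<subseteq> V \<and> complete_in E A}"
  have "finite ?S" using assms(1) by auto
  moreover have "D \<in> ?S" using assms by simp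
  ultimately obtain A where A: "A \<in> ?S" "D \<subseteq> A" "\<forall>B\<in>?S. A \<subseteq> B \<longrightarrow> A = B"
    using finite_has_maximal2[of ?S D] by blast
  then have "A \<in> cliques V E" by (auto simp: cliques_def)
  then show ?thesis using A(2) by blast
qed

lemma complete_in_subset: "complete_in E A \<Longrightarrow> B \<subseteq> A \<Longrightarrow> complete_in E B"
  by (auto simp: complete_in_def)

text \<open>
  For the last claim: if the earlier cliques covered \<open>C l\<close>, then \<open>C l\<close> would be its own separator and hence be
  contained in an earlier clique, against maximality.
\<close>
lemma perfect_order_facts:
  assumes fin: "finite V" and ne: "V \<noteq> {}" and po: "perfect_order V E C k"
  shows "l \<in> {1..k} \<Longrightarrow> C l \<subseteq> V \<and> complete_in E (C l)"
    and "D \<subseteq> V \<Longrightarrow> complete_in E D \<Longrightarrow> \<exists>l\<in>{1..k}. D \<subseteq> C l"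
    and "1 \<le> k" and "(\<Union>l\<in>{1..k}. C l) = V"
    and "complete_sets V E = {D. D \<noteq> {} \<and> (\<exists>l\<in>{1..k}. D \<subseteq> C l)}"
    and "l \<in> {1..k} \<Longrightarrow> \<exists>\<gamma>\<in>C l. \<gamma> \<notin> (\<Union>j\<in>{1..<l}. C j)"
proof -
  have bij: "bij_betw C {1..k} (cliques V E)"
    and run: "\<And>l. l \<in> {2..k} \<Longrightarrow> \<exists>i\<in>{1..<l}. separator C l \<subseteq> C i"
    using po by (auto simp: perfect_order_def)
  have cl: "C l \<in> cliques V E" if "l \<in> {1..k}" for l using bij that by (auto simp: bij_betw_def)
  show sub: "C l \<subseteq> V \<and> complete_in E (C l)" if "l \<in> {1..k}" for l
    using cl[OF that] by (simp add: cliques_def)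
  show ex: "\<exists>l\<in>{1..k}. D \<subseteq> C l" if D: "D \<subseteq> V" "complete_in E D" for D
  proof -
    obtain A where A: "A \<in> cliques V E" "D \<subseteq> A" using complete_set_in_clique[OF fin D] by blast
    then have "A \<in> C ` {1..k}" using bij_betw_imp_surj_on[OF bij] by simp
    then show ?thesis using A(2) by blast
  qed
  have single: "\<exists>l\<in>{1..k}. v \<in> C l" if "v \<in> V" for v
    using ex[of "{v}"] that by (auto simp: complete_in_def)
  show k1: "1 \<le> k"
  proof -
    obtain v where "v \<in> V" using ne by blast
    from single[OF this] show ?thesis by auto
  qed
  show "(\<Union>l\<in>{1..k}. C l) = V"
  proof
    show "(\<Union>l\<in>{1..k}. C l) \<subseteq> V" using sub by (intro UN_least) blast
    show "V \<subseteq> (\<Union>l\<in>{1..k}. C l)" using single by blast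
  qed
  show "complete_sets V E = {D. D \<noteq> {} \<and> (\<exists>l\<in>{1..k}. D \<subseteq> C l)}"
  proof
    show "complete_sets V E \<subseteq> {D. D \<noteq> {} \<and> (\<exists>l\<in>{1..k}. D \<subseteq> C l)}"
      using ex by (auto simp: complete_sets_def)
    show "{D. D \<noteq> {} \<and> (\<exists>l\<in>{1..k}. D \<subseteq> C l)} \<subseteq> complete_sets V E"
    proof clarify
      fix D l assume D: "D \<noteq> {}" "l \<in> {1..k}" "D \<subseteq> C l"
      have "complete_in E D" using complete_in_subset sub[OF D(2)] D(3) by blast
      then show "D \<in> complete_sets V E" using D sub[OF D(2)] by (auto simp: complete_sets_def)
    qed
  qed
  show "\<exists>\<gamma>\<in>C l. \<gamma> \<notin> (\<Union>j\<in>{1..<l}. C j)" if l: "l \<in> {1..k}"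
  proof (rule ccontr)
    assume "\<not> ?thesis"
    then have covered: "C l \<subseteq> (\<Union>j\<in>{1..<l}. C j)" by blast
    have "C l \<noteq> {}"
    proof
      assume e: "C l = {}"
      obtain v where v: "v \<in> V" using ne by blast
      have "complete_in E {v}" by (simp add: complete_in_def)
      then show False using cl[OF l] v by (auto simp: cliques_def e)
    qed
    then have "l \<noteq> 1" using covered by auto
    then have "l \<in> {2..k}" using l by auto
    from run[OF this] obtain i where i: "i \<in> {1..<l}" "separator C l \<subseteq> C i" by blast
    have "C l \<subseteq> C i" using i(2) covered by (auto simp: separator_def)
    moreover have ik: "i \<in> {1..k}" using i l by auto
    ultimately have "C i = C l" using cl[OF l] sub[OF ik] by (auto simp: cliques_def)
    then have "i = l" by (rule inj_onD[OF bij_betw_imp_inj_on[OF bij] _ ik l])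
    then show False using i by simp
  qed
qed

context finite_levels
begin

lemma sum_star_cells:
  assumes "\<D> \<subseteq> Pow V"
  shows "(\<Sum>D\<in>\<D>. \<Sum>i\<in>cells_star L D. f D i) = (\<Sum>(D, i)\<in>star_coords L \<D>. f D i)"
proof -
  have "finite \<D>" by (rule finite_subset[OF assms]) (simp add: finite_V)
  then show ?thesis unfolding star_coords_def using assms by (intro sum.Sigma) (auto intro: finite_cells_star)
qed

text \<open>
  The partition function groups the cells by their supports.
\<close>
lemma partition_fun_eq: "partition_fun V E L \<theta> = normalizer L (complete_sets V E) V \<theta>"
proof -
  let ?\<D> = "complete_sets V E"
  have z: "weight ?\<D> V \<theta> (zero_cell V) = 1"
  proof -
    have "{F. F \<in> ?\<D> \<and> F \<subseteq> support V (zero_cell V :: 'v \<Rightarrow> 'l)} = {}" by (auto simp: support_zero_cell complete_sets_def)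
    then show ?thesis unfolding weight_def by (simp only: sum.empty exp_zero)
  qed
  have w: "weight ?\<D> V \<theta> (zero_fill V A i) = exp (\<Sum>F | F \<in> ?\<D> \<and> F \<subseteq> A. \<theta> (F, restrict i F))"
    if A: "A \<subseteq> V" "i \<in> cells_star L A" for A i
  proof -
    have "restrict (zero_fill V A i) F = restrict i F" if "F \<subseteq> A" for F
      using restrict_restrict_subset[OF that, of "zero_fill V A i"] restrict_zero_fill[OF A] by simp
    then show ?thesis unfolding weight_def support_zero_fill[OF A]
      by (intro arg_cong[of _ _ exp] sum.cong) auto
  qed
  have sub: "sub_coords L V = star_coords L {A. A \<subseteq> V \<and> A \<noteq> {}}" by (simp add: sub_coords_def star_coords_def)
  have "normalizer L ?\<D> V \<theta> = 1 + (\<Sum>(A, i)\<in>sub_coords L V. weight ?\<D> V \<theta> (zero_fill V A i))"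
    unfolding normalizer_def sum_cells[OF order_refl] z ..
  also have "(\<Sum>(A, i)\<in>sub_coords L V. weight ?\<D> V \<theta> (zero_fill V A i))
      = (\<Sum>A | A \<subseteq> V \<and> A \<noteq> {}. \<Sum>i\<in>cells_star L A. weight ?\<D> V \<theta> (zero_fill V A i))"
    unfolding sub by (rule sum_star_cells[symmetric]) auto
  also have "\<dots> = (\<Sum>A | A \<subseteq> V \<and> A \<noteq> {}. \<Sum>i\<in>cells_star L A. exp (\<Sum>F | F \<in> ?\<D> \<and> F \<subseteq> A. \<theta> (F, restrict i F)))"
    by (rule sum.cong[OF refl], rule sum.cong[OF refl]) (simp add: w)
  finally show ?thesis by (simp only: partition_fun_def)
qed

lemma marginal_prob_eq: "marginal_prob V E L \<theta> A a = marginal L (complete_sets V E) V \<theta> A a"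
  by (simp only: marginal_prob_def cell_prob_def marginal_def partition_fun_eq weight_def support_def sum_divide_distrib)

lemma coords_eq: "coords V E L = star_coords L (complete_sets V E)"
  by (simp add: coords_def star_coords_def)

lemma free_marginals_eq: "free_marginals V E L host = host_marginals L (complete_sets V E) V host"
  by (intro ext) (simp add: free_marginals_def host_marginals_def coords_eq marginal_prob_eq restrict_def split_def)

lemma prior_kernel_eq: "prior_kernel V E L s \<alpha> = model_kernel L (complete_sets V E) V s \<alpha>"
proof -
  have "complete_sets V E \<subseteq> Pow V" by (auto simp: complete_sets_def)
  then show ?thesis
    by (intro ext) (simp add: prior_kernel_def model_kernel_def partition_fun_eq sum_star_cells split_def)
qed

end

theorem proposition4p1:
  fixes V :: "'v set" and E :: "'v set set" and L :: "'v \<Rightarrow> 'l::zero set"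
    and C :: "nat \<Rightarrow> 'v set" and k :: nat and host :: "'v set \<Rightarrow> 'v set"
    and s :: "('v, 'l) coord \<Rightarrow> real" and \<alpha> :: real
  assumes "finite V" and "V \<noteq> {}"
    and "\<forall>\<gamma>\<in>V. finite (L \<gamma>) \<and> 2 \<le> card (L \<gamma>) \<and> 0 \<in> L \<gamma>"
    and "simple_graph V E" and "decomposable V E"
    and "perfect_order V E C k"
    and "free_marginal_choice V E C k host"
    and "prior_integral V E L s \<alpha> < \<infinity>"
  shows "hyper_dirichlet_distributed V E L C k host
           (induced_hyper_zero L s \<alpha>) (induced_hyper L s)
           (prior V E L s \<alpha>) (free_marginals V E L host)
    \<and> prior_integral V E L s \<alpha> = ennreal
        ((\<Prod>l\<in>{1..k}. Gamma (induced_hyper_zero L s \<alpha> (C l)) *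
            (\<Prod>x\<in>sub_coords L (C l). Gamma (induced_hyper L s (C l) x)))
         / (Gamma \<alpha> *
            (\<Prod>l\<in>{2..k}. Gamma (induced_hyper_zero L s \<alpha> (separator C l)) *
              (\<Prod>x\<in>sub_coords L (separator C l). Gamma (induced_hyper L s (separator C l) x)))))"
proof -
  note po = perfect_order_facts[OF assms(1,2,6)]
  interpret clique_tower V L C k
    using assms(1,3,6) po(1) by unfold_locales (auto simp: perfect_order_def)
  let ?\<D> = "complete_sets V E" and ?J = "star_coords L (complete_sets V E)"
  let ?h = "table_hyper (extend_hyper s \<alpha>)" and ?X = "host_marginals L (complete_sets V E) V host"
  let ?az = "induced_hyper_zero L s \<alpha>" and ?a = "induced_hyper L s"
  let ?S = "separator C"
  define gam where "gam A = (\<Prod>c\<in>cells L A. Gamma (?h A c))" for A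
  define Iv where "Iv = (\<Prod>l\<in>{1..k}. gam (C l) / gam (?S l))"
  have faces_k: "faces k = ?\<D>" by (simp add: faces_def po(5))
  have covered_k: "covered k = V" unfolding covered_def by (rule po(4))
  have \<D>V: "?\<D> \<subseteq> Pow V" by (auto simp: complete_sets_def)
  have finJ: "finite ?J"
    unfolding star_coords_def using \<D>V assms(1)
    by (intro finite_SigmaI finite_subset[OF \<D>V] finite_cells_star) auto
  have clique_V: "C l \<subseteq> V" if "l \<in> {1..k}" for l using po(1)[OF that] by simp
  have SC: "?S l \<subseteq> C l" for l by (auto simp: separator_def)
  have sep_V: "?S l \<subseteq> V" if "l \<in> {1..k}" for l using SC clique_V[OF that] by blast
  have S1: "?S 1 = {}" by (simp add: separator_def)
  have k_split: "{1..k} = insert 1 {2..k}" using po(3) by auto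
  have level: "\<exists>\<nu>\<in>L \<gamma>. \<nu> \<noteq> 0" if "\<gamma> \<in> V" for \<gamma>
  proof (rule ccontr)
    assume "\<not> ?thesis"
    then have "L \<gamma> \<subseteq> {0}" by blast
    then have "card (L \<gamma>) \<le> card {0 :: 'l}" by (intro card_mono) auto
    then show False using assms(3) that by auto
  qed
  have new: "\<exists>\<gamma>\<in>C l. \<gamma> \<notin> (\<Union>j\<in>{1..<l}. C j) \<and> (\<exists>\<nu>\<in>L \<gamma>. \<nu> \<noteq> 0)" if l: "l \<in> {1..k}" for l
  proof -
    obtain \<gamma> where \<gamma>: "\<gamma> \<in> C l" "\<gamma> \<notin> (\<Union>j\<in>{1..<l}. C j)" using po(6)[OF l] by (rule bexE)
    have "\<gamma> \<in> V" using \<gamma>(1) clique_V[OF l] by (rule rev_subsetD)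
    from level[OF this] show ?thesis using \<gamma> by (intro bexI[of _ \<gamma>] conjI)
  qed
  have prior_int: "prior_integral V E L s \<alpha> = (\<integral>\<^sup>+\<theta>. ennreal (model_kernel L ?\<D> V s \<alpha> \<theta>) \<partial>Leb ?J)"
    by (simp only: prior_integral_def prior_kernel_eq coords_eq)
  have tower: "(\<forall>l\<in>{1..k}. (\<forall>c\<in>cells L (C l). 0 < ?h (C l) c) \<and> (\<forall>b\<in>cells L (?S l). 0 < ?h (?S l) b))
       \<and> prior_integral V E L s \<alpha> = ennreal Iv"
    using tower_integral[OF new, of k s \<alpha>] assms(8) unfolding faces_k covered_k prior_int Iv_def gam_def by simp
  have posC: "0 < ?h (C l) c" if "l \<in> {1..k}" "c \<in> cells L (C l)" for l c using tower that by blast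
  have posS: "0 < ?h (?S l) c" if "l \<in> {1..k}" "c \<in> cells L (?S l)" for l c using tower that by blast
  have one: "1 \<in> {1..k}" using po(3) by simp
  have \<alpha>: "0 < \<alpha>"
  proof -
    have "0 < (\<Sum>c\<in>cells L (C 1). ?h (C 1) c)"
      by (intro sum_pos finite_cells[OF clique_V[OF one]] cells_nonempty[OF clique_V[OF one]] posC[OF one])
    then show ?thesis by (simp only: sum_hyper[OF clique_V[OF one]])
  qed
  have gamC: "0 < gam (C l)" and gamS: "0 < gam (?S l)" if "l \<in> {1..k}" for l
    unfolding gam_def using posC[OF that] posS[OF that] by (auto intro!: prod_pos Gamma_real_pos)
  have Iv: "0 < Iv" unfolding Iv_def by (intro prod_pos divide_pos_pos ballI gamC gamS)
  have cells_empty: "cells L {} = {\<lambda>_. undefined}" by (simp add: cells_def)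
  \<comment> \<open>the table on the empty set has one cell; this is the factor \<open>\<Gamma>(\<alpha>)\<close> of the prior integral\<close>
  have gam1: "gam (?S 1) = Gamma \<alpha>"
    using sum_hyper[of "{}" s \<alpha>] unfolding gam_def S1 by (simp add: cells_empty)
  have formula: "Iv = (\<Prod>l\<in>{1..k}. gam (C l)) / (Gamma \<alpha> * (\<Prod>l\<in>{2..k}. gam (?S l)))"
  proof -
    have "(\<Prod>l\<in>{1..k}. gam (?S l)) = Gamma \<alpha> * (\<Prod>l\<in>{2..k}. gam (?S l))"
      unfolding k_split by (subst prod.insert) (simp_all add: gam1[simplified])
    then show ?thesis by (simp only: Iv_def prod_dividef)
  qed
  have gamma_eq: "gam A = Gamma (?az A) * (\<Prod>x\<in>sub_coords L A. Gamma (?a A x))" if "A \<subseteq> V" for A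
    unfolding gam_def by (rule hyper_gamma_prod[OF that])
  have result_int: "prior_integral V E L s \<alpha> = ennreal
        ((\<Prod>l\<in>{1..k}. Gamma (?az (C l)) * (\<Prod>x\<in>sub_coords L (C l). Gamma (?a (C l) x)))
         / (Gamma \<alpha> * (\<Prod>l\<in>{2..k}. Gamma (?az (?S l)) * (\<Prod>x\<in>sub_coords L (?S l). Gamma (?a (?S l) x)))))"
  proof -
    have "(\<Prod>l\<in>{1..k}. gam (C l)) = (\<Prod>l\<in>{1..k}. Gamma (?az (C l)) * (\<Prod>x\<in>sub_coords L (C l). Gamma (?a (C l) x)))"
      by (rule prod.cong[OF refl]) (rule gamma_eq[OF clique_V])
    moreover have "(\<Prod>l\<in>{2..k}. gam (?S l)) = (\<Prod>l\<in>{2..k}. Gamma (?az (?S l)) * (\<Prod>x\<in>sub_coords L (?S l). Gamma (?a (?S l) x)))"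
      by (rule prod.cong[OF refl]) (rule gamma_eq[OF sep_V], auto)
    ultimately show ?thesis using tower formula by simp
  qed
  have table_set_cases: "\<exists>l\<in>{1..k}. A = C l \<or> A = ?S l" if "A \<in> C ` {1..k} \<union> ?S ` {2..k}" for A
    using that
  proof (elim UnE imageE)
    fix l assume "A = ?S l" "l \<in> {2..k}"
    moreover from this have "l \<in> {1..k}" by simp
    ultimately show ?thesis by blast
  qed blast
  have positive: "0 < ?az A \<and> (\<forall>x\<in>sub_coords L A. 0 < ?a A x)" if A: "A \<in> C ` {1..k} \<union> ?S ` {2..k}" for A
  proof -
    obtain l where l: "l \<in> {1..k}" "A = C l \<or> A = ?S l" using table_set_cases[OF A] by (rule bexE)
    then have AV: "A \<subseteq> V" and pos: "\<And>c. c \<in> cells L A \<Longrightarrow> 0 < ?h A c"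
      using clique_V[OF l(1)] sep_V[OF l(1)] posC[OF l(1)] posS[OF l(1)] by auto
    have "0 < ?az A" using pos[OF zero_cell_cells[OF AV]] by (simp only: hyper_zero[OF AV])
    moreover have "0 < ?a A (D, i)" if x: "(D, i) \<in> sub_coords L A" for D i
      using pos[OF zero_fill_star[of D A i]] hyper_fill[OF x, of s \<alpha>] AV x by (auto simp: sub_coords_def)
    ultimately show ?thesis by auto
  qed
  have consistent: "hyperconsistent L C k ?az ?a"
    unfolding hyperconsistent_def
  proof (intro ballI impI)
    fix l i j assume l: "l \<in> {2..k}" and ij: "i \<in> {1..k}" "j \<in> {1..k}" and S: "i \<noteq> j \<and> ?S l = C i \<inter> C j"
    have marg: "distr (dirichlet L (C m) (?az (C m)) (?a (C m))) (Leb (sub_coords L (?S l))) (table_marginal L (C m) (?S l))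
       = dirichlet L (?S l) (?az (?S l)) (?a (?S l))" if m: "m \<in> {1..k}" and sub: "?S l \<subseteq> C m" for m
      by (rule dirichlet_marginal[OF sub clique_V[OF m] posC[OF m]])
    show "distr (dirichlet L (C i) (?az (C i)) (?a (C i))) (Leb (sub_coords L (?S l))) (table_marginal L (C i) (?S l))
      = distr (dirichlet L (C j) (?az (C j)) (?a (C j))) (Leb (sub_coords L (?S l))) (table_marginal L (C j) (?S l))"
    proof -
      have "?S l \<subseteq> C i" "?S l \<subseteq> C j" using S by blast+
      then show ?thesis using marg[OF ij(1)] marg[OF ij(2)] by (simp only:)
    qed
  qed
  have host: "hosting ?\<D> V host"
    unfolding hosting_def
  proof (intro ballI)
    fix D assume D: "D \<in> ?\<D>"
    have "D \<subseteq> host D \<and> (if \<exists>l\<in>{2..k}. D \<subseteq> ?S l then host D \<in> ?S ` {2..k} else host D \<in> C ` {1..k})"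
      using assms(7) D unfolding free_marginal_choice_def by (rule bspec)
    then have ch: "D \<subseteq> host D" "host D \<in> C ` {1..k} \<union> ?S ` {2..k}"
      by (cases "\<exists>l\<in>{2..k}. D \<subseteq> ?S l"; simp only: if_True if_False Un_iff simp_thms)+
    obtain m where m: "m \<in> {1..k}" "host D = C m \<or> host D = ?S m" using table_set_cases[OF ch(2)] by (rule bexE)
    have hC: "host D \<subseteq> C m" using m(2) SC[of m] by auto
    have "F \<in> ?\<D>" if "D \<subseteq> F" "F \<subseteq> host D" for F
    proof -
      have "D \<noteq> {}" using D by (simp add: complete_sets_def)
      moreover have "F \<subseteq> C m" using that(2) hC by (rule order_trans)
      ultimately show ?thesis unfolding po(5) using that(1) m(1) by blast
    qed
    then show "D \<subseteq> host D \<and> host D \<subseteq> V \<and> (\<forall>F. D \<subseteq> F \<and> F \<subseteq> host D \<longrightarrow> F \<in> ?\<D>)"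
      using ch(1) order_trans[OF hC clique_V[OF m(1)]] by blast
  qed
  have first: "hosting ?\<D> V first_clique"
    unfolding hosting_def
  proof (intro ballI)
    fix D assume D: "D \<in> ?\<D>"
    then have Df: "D \<in> faces k" by (simp only: faces_k)
    have sub: "D \<subseteq> first_clique D" "first_clique D \<subseteq> V" using first_clique_sub[OF Df] covered_k by auto
    have "\<exists>l\<in>{1..k}. first_clique D \<subseteq> C l" using first_clique_is_clique[OF Df] by blast
    moreover have "D \<noteq> {}" using D by (simp add: complete_sets_def)
    ultimately show "D \<subseteq> first_clique D \<and> first_clique D \<subseteq> V \<and> (\<forall>F. D \<subseteq> F \<and> F \<subseteq> first_clique D \<longrightarrow> F \<in> ?\<D>)"
      unfolding po(5) using sub by blast
  qed
  \<comment> \<open>the tower provides the chart for the first cliques as hosts; the given hosts are another choice\<close>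
  have chart: "lebesgue_chart ?J ?X (jac k)"
    using tower_chart[of k] unfolding faces_k covered_k
    by (intro lebesgue_chart_change_hosts[OF order_refl \<D>V first host]) simp
  have Xm: "?X \<in> measurable (Leb ?J) (Leb ?J)" by (rule measurable_host_marginals[OF order_refl])
  have jm: "jac k \<in> borel_measurable (Leb ?J)" using jac_measurable[of k] by (simp add: faces_k)
  have jpos: "0 < jac k \<theta>" for \<theta> by (rule jac_pos) simp
  \<comment> \<open>the density of the free marginals at the image of \<open>\<theta>\<close>\<close>
  define K where "K \<theta> = ennreal (model_kernel L ?\<D> V s \<alpha> \<theta> / (Iv * jac k \<theta>))" for \<theta>
  have Km: "K \<in> borel_measurable (Leb ?J)"
    unfolding K_def
    by (intro measurable_compose[OF _ measurable_ennreal] borel_measurable_divide borel_measurable_times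
        borel_measurable_const jm log_linear_measurable order_refl)
  define g where "g = (\<lambda>q. if q \<in> ?X ` space (Leb ?J) then K (inv_into (space (Leb ?J)) ?X q) else 0)"
  note density = lebesgue_chart_density[OF finJ chart Xm jm Km, folded g_def]
  have prior_eq: "prior V E L s \<alpha> = density (Leb ?J) (\<lambda>\<theta>. K \<theta> * ennreal (jac k \<theta>))"
  proof -
    have "ennreal (model_kernel L ?\<D> V s \<alpha> \<theta>) / ennreal Iv = K \<theta> * ennreal (jac k \<theta>)" for \<theta>
    proof -
      have m: "0 \<le> model_kernel L ?\<D> V s \<alpha> \<theta>" by (simp add: model_kernel_def)
      have "K \<theta> * ennreal (jac k \<theta>) = ennreal (model_kernel L ?\<D> V s \<alpha> \<theta> / (Iv * jac k \<theta>) * jac k \<theta>)"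
        unfolding K_def by (rule ennreal_mult''[symmetric]) (use jpos[of \<theta>] in simp)
      also have "\<dots> = ennreal (model_kernel L ?\<D> V s \<alpha> \<theta> / Iv)" using jpos[of \<theta>] by simp
      also have "\<dots> = ennreal (model_kernel L ?\<D> V s \<alpha> \<theta>) / ennreal Iv" by (rule divide_ennreal[OF m Iv, symmetric])
      finally show ?thesis by (rule sym)
    qed
    moreover have "prior_integral V E L s \<alpha> = ennreal Iv" using tower by blast
    ultimately show ?thesis by (simp only: prior_def coords_eq prior_kernel_eq)
  qed
  have dens_eq: "hyper_dirichlet_density V E L C k host ?az ?a = g"
  proof
    fix q
    let ?\<theta> = "inv_into (space (Leb ?J)) ?X q" and ?P = "marginal L ?\<D> V"
    have P_def: "P k = ?P" by (simp only: faces_k covered_k)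
    define Dir where "Dir A = dirichlet_fun L A (?az A) (?a A) (?P ?\<theta> A (zero_cell A)) (\<lambda>(D, i). ?P ?\<theta> A (zero_fill A D i))" for A
    define m where "m A = (\<Prod>c\<in>cells L A. ?P ?\<theta> A c powr ?h A c)" for A
    define j where "j A = (\<Prod>c\<in>cells L A. ?P ?\<theta> A c)" for A
    have DirC: "Dir (C l) = Gamma \<alpha> / gam (C l) * (m (C l) / j (C l))" if "l \<in> {1..k}" for l
      unfolding Dir_def gam_def m_def j_def by (rule marginal_dirichlet[OF order_refl clique_V[OF that]])
    have DirS: "Dir (?S l) = Gamma \<alpha> / gam (?S l) * (m (?S l) / j (?S l))" if "l \<in> {1..k}" for l
      unfolding Dir_def gam_def m_def j_def by (rule marginal_dirichlet[OF order_refl sep_V[OF that]])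
    \<comment> \<open>so the product over the separators may include the first, empty one\<close>
    have Dir1: "Dir (?S 1) = 1"
    proof -
      have "{i. i \<in> cells L V \<and> restrict i {} = (\<lambda>_. undefined)} = cells L V" by (auto simp: restrict_def)
      then have "?P ?\<theta> {} (\<lambda>_. undefined) = 1"
        using normalizer_pos[OF order_refl, of ?\<D> ?\<theta>] unfolding marginal_def normalizer_def by simp
      then have "m (?S 1) / j (?S 1) = 1" unfolding m_def j_def S1 by (simp add: cells_empty)
      then show ?thesis using DirS[OF one] Gamma_real_pos[OF \<alpha>] by (simp only: gam1) simp
    qed
    have "(\<Prod>l\<in>{1..k}. Dir (?S l)) = (\<Prod>l\<in>{2..k}. Dir (?S l))"
      unfolding k_split by (subst prod.insert) (simp_all add: Dir1[simplified])
    then have "(\<Prod>l\<in>{1..k}. Dir (C l)) / (\<Prod>l\<in>{2..k}. Dir (?S l)) = (\<Prod>l\<in>{1..k}. Dir (C l) / Dir (?S l))"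
      by (simp only: prod_dividef)
    also have "\<dots> = (\<Prod>l\<in>{1..k}. (m (C l) / m (?S l)) / ((gam (C l) / gam (?S l)) * (j (C l) / j (?S l))))"
    proof (rule prod.cong[OF refl])
      fix l assume l: "l \<in> {1..k}"
      show "Dir (C l) / Dir (?S l) = (m (C l) / m (?S l)) / ((gam (C l) / gam (?S l)) * (j (C l) / j (?S l)))"
        unfolding DirC[OF l] DirS[OF l] using Gamma_real_pos[OF \<alpha>] by (simp add: divide_simps)
    qed
    also have "\<dots> = (\<Prod>l\<in>{1..k}. m (C l) / m (?S l)) / (Iv * (\<Prod>l\<in>{1..k}. j (C l) / j (?S l)))"
      unfolding Iv_def prod_dividef prod.distrib ..
    also have "(\<Prod>l\<in>{1..k}. m (C l) / m (?S l)) = model_kernel L ?\<D> V s \<alpha> ?\<theta>"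
      using tower_kernel[of k s \<alpha> ?\<theta>] unfolding P_def faces_k covered_k m_def by simp
    also have "(\<Prod>l\<in>{1..k}. j (C l) / j (?S l)) = jac k ?\<theta>"
      unfolding jac_def P_def j_def ..
    finally have "ennreal ((\<Prod>l\<in>{1..k}. Dir (C l)) / (\<Prod>l\<in>{2..k}. Dir (?S l))) = K ?\<theta>"
      by (simp only: K_def)
    then show "hyper_dirichlet_density V E L C k host ?az ?a q = g q"
      unfolding hyper_dirichlet_density_def Let_def g_def coords_eq free_marginals_eq marginal_prob_eq Dir_def by simp
  qed
  have "distributed (prior V E L s \<alpha>) (Leb (coords V E L)) (free_marginals V E L host) (hyper_dirichlet_density V E L C k host ?az ?a)"
    unfolding distributed_def dens_eq coords_eq free_marginals_eq
    using density Xm by (simp add: prior_eq measurable_cong_sets[OF sets_density refl])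
  then show ?thesis
    unfolding hyper_dirichlet_distributed_def using positive consistent result_int by blast
qed

end
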